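(* For any integers $k\ge 1$ and $d$ with $d>k$, there exist a nilpotent group $G$ and a maximal abelian subgroup $A$ of $G$ containing $[G,G]$ such that $d$ is the nilpotency degree of $G$, $k$ is the torsion-free rank of $G/A$, and $$\mathrm{Crit}_{[0,1]}(G)=1+\frac1k.$$
   Context: For an integer $n\ge 0$ and a real $\alpha\in[0,1)$, $\mathrm{Diff}_+^{n+\alpha}([0,1])$ denotes the group of all orientation preserving $C^n$-diffeomorphisms of $[0,1]$ whose $n$-th derivative is $\alpha$-H\"older continuous (for $n=0,\alpha=0$: the orientation preserving homeomorphisms of $[0,1]$). The critical regularity of a group $G$ on $[0,1]$ is $$\mathrm{Crit}_{[0,1]}(G)=\sup\{n+\alpha \mid n\ge 0,\ \alpha\in[0,1),\ G \text{ embeds into } \mathrm{Diff}_+^{n+\alpha}([0,1])\},$$ with $\mathrm{Crit}_{[0,1]}(G)=-\infty$ if $G$ does not embed into $\mathrm{Diff}_+^{0}([0,1])$. The torsion-free rank of an abelian group $H$ is the dimension of the $\mathbb{Q}$-vector space $H\otimes\mathbb{Q}$. A group $G$ is nilpotent of degree $n$ if its upper central series $\{e\}=\zeta_0\le\zeta_1\le\cdots$ (with $\zeta_i/\zeta_{i-1}=Z(G/\zeta_{i-1})$) satisfies $\zeta_n=G$ and $\zeta_{n-1}\neq G$. *)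

theory Defs
  imports
    "HOL-Analysis.Analysis"
    "HOL-Algebra.Algebra"
    "HOL-Algebra.Free_Abelian_Groups"
    "Jordan_Normal_Form.Missing_VectorSpace"
begin

section \<open>Nilpotency degree and maximal abelian subgroups\<close>

definition center_of :: "('a, 'b) monoid_scheme \<Rightarrow> 'a set" where
  "center_of G = {z \<in> carrier G. \<forall>x \<in> carrier G. z \<otimes>\<^bsub>G\<^esub> x = x \<otimes>\<^bsub>G\<^esub> z}"

primrec upper_central :: "('a, 'b) monoid_scheme \<Rightarrow> nat \<Rightarrow> 'a set" where
  "upper_central G 0 = {\<one>\<^bsub>G\<^esub>}"
| "upper_central G (Suc i) =
     {x \<in> carrier G. upper_central G i #>\<^bsub>G\<^esub> x \<in> center_of (G Mod upper_central G i)}"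

definition nilpotent_of_degree :: "('a, 'b) monoid_scheme \<Rightarrow> nat \<Rightarrow> bool" where
  "nilpotent_of_degree G n \<longleftrightarrow>
     group G \<and> upper_central G n = carrier G \<and>
     (n = 0 \<or> upper_central G (n - 1) \<noteq> carrier G)"

definition commutative_subgroup :: "'a set \<Rightarrow> ('a, 'b) monoid_scheme \<Rightarrow> bool" where
  "commutative_subgroup A G \<longleftrightarrow> subgroup A G \<and> comm_group (G\<lparr>carrier := A\<rparr>)"

definition maximal_abelian_subgroup :: "'a set \<Rightarrow> ('a, 'b) monoid_scheme \<Rightarrow> bool" where
  "maximal_abelian_subgroup A G \<longleftrightarrow>
     commutative_subgroup A G \<and> (\<forall>B. commutative_subgroup B G \<and> A \<subseteq> B \<longrightarrow> B = A)"

section \<open>Torsion-free rank\<close>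

definition rat_field :: "rat ring" where
  "rat_field = \<lparr>carrier = UNIV, monoid.mult = (*), one = 1, ring.zero = 0, ring.add = (+)\<rparr>"

text \<open>
  The tensor product over the integers of a multiplicatively written abelian group \<open>H\<close> with
  the rationals, as the free abelian group on the symbols \<open>(x, q)\<close> (standing for the pure
  tensors) modulo the subgroup generated by the biadditivity relations. The scalar \<open>q\<close> acts by
  \<open>(x, r) \<mapsto> (x, q * r)\<close>; multiplying the image of a coset by the
  relation subgroup gives the whole coset back.
\<close>

definition tensor_generators :: "('a, 'b) monoid_scheme \<Rightarrow> (('a \<times> rat) \<Rightarrow>\<^sub>0 int) monoid" where
  "tensor_generators H = free_Abelian_group (carrier H \<times> UNIV)"

definition tensor_relations :: "('a, 'b) monoid_scheme \<Rightarrow> (('a \<times> rat) \<Rightarrow>\<^sub>0 int) set" where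
  "tensor_relations H = generate (tensor_generators H)
     ({frag_of (x \<otimes>\<^bsub>H\<^esub> y, q) - frag_of (x, q) - frag_of (y, q) | x y q.
         x \<in> carrier H \<and> y \<in> carrier H} \<union>
      {frag_of (x, q + r) - frag_of (x, q) - frag_of (x, r) | x q r. x \<in> carrier H})"

definition tensor_rat ::
    "('a, 'b) monoid_scheme \<Rightarrow> (rat, (('a \<times> rat) \<Rightarrow>\<^sub>0 int) set) module" where
  "tensor_rat H =
     (let F = tensor_generators H; R = tensor_relations H in
      \<lparr>carrier = carrier (F Mod R), monoid.mult = undefined, one = undefined,
       ring.zero = \<one>\<^bsub>F Mod R\<^esub>, ring.add = (\<otimes>\<^bsub>F Mod R\<^esub>),
       smult = (\<lambda>q S. R <#>\<^bsub>F\<^esub> (frag_extend (\<lambda>(x, r). frag_of (x, q * r)) ` S))\<rparr>)"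

subsection \<open>The tensor product is a rational vector space\<close>

lemma field_rat_field: "field rat_field"
proof -
  have "cring rat_field"
    by (rule cringI, rule abelian_groupI, auto simp: rat_field_def algebra_simps
        intro!: comm_monoidI intro: exI[of _ "- x" for x])
  moreover have "\<exists>b\<in>carrier rat_field. a \<otimes>\<^bsub>rat_field\<^esub> b = \<one>\<^bsub>rat_field\<^esub>"
    if "a \<noteq> \<zero>\<^bsub>rat_field\<^esub>" for a
    using that by (intro bexI[of _ "inverse a"]) (auto simp: rat_field_def)
  ultimately show ?thesis
    by (intro cring.cring_fieldI2) (auto simp: rat_field_def)
qed

abbreviation (input) tensor_scale ::
    "rat \<Rightarrow> (('a \<times> rat) \<Rightarrow>\<^sub>0 int) \<Rightarrow> (('a \<times> rat) \<Rightarrow>\<^sub>0 int)" where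
  "tensor_scale q \<equiv> frag_extend (\<lambda>(x, r). frag_of (x, q * r))"

lemma tensor_generators_simps [simp]:
  "c \<in> carrier (tensor_generators H) \<longleftrightarrow> Poly_Mapping.keys c \<subseteq> carrier H \<times> UNIV"
  "c \<otimes>\<^bsub>tensor_generators H\<^esub> d = c + d"
  "\<one>\<^bsub>tensor_generators H\<^esub> = 0"
  by (simp_all add: tensor_generators_def)

lemma tensor_scale_in_carrier:
  "Poly_Mapping.keys c \<subseteq> carrier H \<times> UNIV \<Longrightarrow>
   Poly_Mapping.keys (tensor_scale q c) \<subseteq> carrier H \<times> UNIV"
  by (fastforce dest: subsetD[OF keys_frag_extend] split: prod.splits)

context comm_group
begin

abbreviation (input) "tF \<equiv> tensor_generators G"
abbreviation (input) "tR \<equiv> tensor_relations G"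

lemma comm_group_tF: "comm_group tF"
  by (simp add: tensor_generators_def abelian_free_Abelian_group)

lemma tensor_relators_in_carrier:
  "{frag_of (x \<otimes> y, q) - frag_of (x, q) - frag_of (y, q) | x y q. x \<in> carrier G \<and> y \<in> carrier G} \<union>
   {frag_of (x, q + r) - frag_of (x, q) - frag_of (x, r) | x q r. x \<in> carrier G} \<subseteq> carrier tF"
proof -
  have *: "Poly_Mapping.keys (frag_of a - frag_of b - frag_of c) \<subseteq> {a, b, c}" for a b c :: "'a \<times> rat"
    using keys_diff[of "frag_of a - frag_of b" "frag_of c"] keys_diff[of "frag_of a" "frag_of b"]
    by auto
  show ?thesis
    by (auto dest!: subsetD[OF *])
qed

lemma subgroup_tR: "subgroup tR tF"
proof -
  interpret F: comm_group tF by (rule comm_group_tF)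
  show ?thesis
    unfolding tensor_relations_def
    by (rule F.generate_is_subgroup) (rule tensor_relators_in_carrier)
qed

lemma normal_tR: "tR \<lhd> tF"
  using comm_group.subgroup_imp_normal[OF comm_group_tF subgroup_tR] .

lemma tR_zero: "0 \<in> tR"
  using subgroup.one_closed[OF subgroup_tR] by simp

lemma tR_add: "c \<in> tR \<Longrightarrow> d \<in> tR \<Longrightarrow> c + d \<in> tR"
  using subgroup.m_closed[OF subgroup_tR, of c d] by simp

lemma tR_keys: "c \<in> tR \<Longrightarrow> Poly_Mapping.keys c \<subseteq> carrier G \<times> UNIV"
  using subgroup.mem_carrier[OF subgroup_tR, of c] by simp

lemma tR_minus: "c \<in> tR \<Longrightarrow> - c \<in> tR"
  using subgroup.m_inv_closed[OF subgroup_tR, of c] tR_keys[of c]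
  by (simp add: tensor_generators_def)

lemma tR_diff: "c \<in> tR \<Longrightarrow> d \<in> tR \<Longrightarrow> c - d \<in> tR"
  using tR_add[of c "- d"] tR_minus[of d] by simp

lemma tR_mult_left:
  "x \<in> carrier G \<Longrightarrow> y \<in> carrier G \<Longrightarrow>
   frag_of (x \<otimes> y, q) - frag_of (x, q) - frag_of (y, q) \<in> tR"
  unfolding tensor_relations_def by (rule generate.incl) blast

lemma tR_add_right:
  "x \<in> carrier G \<Longrightarrow> frag_of (x, q + r) - frag_of (x, q) - frag_of (x, r) \<in> tR"
  unfolding tensor_relations_def by (rule generate.incl) blast

lemma tensor_scale_relator:
  assumes "h \<in> {frag_of (x \<otimes> y, q) - frag_of (x, q) - frag_of (y, q) | x y q.
      x \<in> carrier G \<and> y \<in> carrier G} \<union>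
    {frag_of (x, q + r) - frag_of (x, q) - frag_of (x, r) | x q r. x \<in> carrier G}"
  shows "tensor_scale q h \<in> tR"
  using assms
proof (elim UnE CollectE exE conjE)
  fix x y r assume "h = frag_of (x \<otimes> y, r) - frag_of (x, r) - frag_of (y, r)"
    "x \<in> carrier G" "y \<in> carrier G"
  then show ?thesis
    using tR_mult_left[of x y "q * r"] by (simp add: frag_extend_diff)
next
  fix x r s assume "h = frag_of (x, r + s) - frag_of (x, r) - frag_of (x, s)" "x \<in> carrier G"
  then show ?thesis
    using tR_add_right[of x "q * r" "q * s"] by (simp add: frag_extend_diff distrib_left)
qed

lemma tensor_scale_tR:
  assumes "c \<in> tR"
  shows "tensor_scale q c \<in> tR"
  using assms[unfolded tensor_relations_def]
proof (induction c rule: generate.induct)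
  case one
  then show ?case
    using tR_zero by simp
next
  case (incl h)
  then show ?case
    by (rule tensor_scale_relator)
next
  case (inv h)
  have "h \<in> carrier tF"
    using tensor_relators_in_carrier inv by (rule subsetD)
  then have "inv\<^bsub>tF\<^esub> h = - h"
    by (simp add: tensor_generators_def)
  with tR_minus[OF tensor_scale_relator[OF inv]] show ?case
    by (simp add: frag_extend_minus)
next
  case (eng h1 h2)
  then show ?case
    using tR_add by (simp add: frag_extend_add)
qed

lemma tR_coset: "tR #>\<^bsub>tF\<^esub> c = {r + c | r. r \<in> tR}"
  by (auto simp: r_coset_def)

lemma tR_coset_eq:
  assumes "c - d \<in> tR"
  shows "tR #>\<^bsub>tF\<^esub> c = tR #>\<^bsub>tF\<^esub> d"
proof -
  have "\<exists>r'. r + c = r' + d \<and> r' \<in> tR" if "r \<in> tR" for r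
    using tR_add[OF that assms] by (intro exI[of _ "r + (c - d)"]) simp
  moreover have "\<exists>r'. r + d = r' + c \<and> r' \<in> tR" if "r \<in> tR" for r
    using tR_diff[OF that assms] by (intro exI[of _ "r - (c - d)"]) simp
  ultimately show ?thesis
    by (auto simp: tR_coset)
qed

lemma tensor_carrier: "carrier (tensor_rat G) = {tR #>\<^bsub>tF\<^esub> c | c. c \<in> carrier tF}"
  by (auto simp: tensor_rat_def Let_def FactGroup_def RCOSETS_def)

lemma tensor_zero: "\<zero>\<^bsub>tensor_rat G\<^esub> = tR #>\<^bsub>tF\<^esub> 0"
  by (auto simp: tensor_rat_def Let_def FactGroup_def tR_coset)

lemma tensor_add:
  "c \<in> carrier tF \<Longrightarrow> d \<in> carrier tF \<Longrightarrow>
   (tR #>\<^bsub>tF\<^esub> c) \<oplus>\<^bsub>tensor_rat G\<^esub> (tR #>\<^bsub>tF\<^esub> d) = tR #>\<^bsub>tF\<^esub> (c + d)"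
  using normal.rcos_sum[OF normal_tR, of c d]
  by (simp add: tensor_rat_def Let_def FactGroup_def)

lemma tensor_smult:
  "q \<odot>\<^bsub>tensor_rat G\<^esub> (tR #>\<^bsub>tF\<^esub> c) = tR #>\<^bsub>tF\<^esub> tensor_scale q c"
proof -
  have "q \<odot>\<^bsub>tensor_rat G\<^esub> (tR #>\<^bsub>tF\<^esub> c) =
      {r + tensor_scale q (s + c) | r s. r \<in> tR \<and> s \<in> tR}"
    unfolding tensor_rat_def Let_def set_mult_def tR_coset by auto
  also have "\<dots> = {r + tensor_scale q c | r. r \<in> tR}" (is "?L = ?R")
  proof (intro subset_antisym subsetI; elim CollectE exE conjE)
    fix x r s assume "x = r + tensor_scale q (s + c)" "r \<in> tR" "s \<in> tR"
    then have "x = (r + tensor_scale q s) + tensor_scale q c" "r + tensor_scale q s \<in> tR"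
      by (simp_all only: frag_extend_add add.assoc tR_add tensor_scale_tR)
    then show "x \<in> ?R" by blast
  next
    fix x r assume "x = r + tensor_scale q c" "r \<in> tR"
    then have "x = r + tensor_scale q (0 + c)" "r \<in> tR" by simp_all
    with tR_zero show "x \<in> ?L" by blast
  qed
  finally show ?thesis
    by (simp add: tR_coset)
qed

lemma tensor_scale_add_in_tR:
  assumes "c \<in> carrier tF"
  shows "tensor_scale (p + q) c - (tensor_scale p c + tensor_scale q c) \<in> tR"
proof -
  from assms have "Poly_Mapping.keys c \<subseteq> carrier G \<times> UNIV"
    by simp
  then show ?thesis
  proof (rule free_Abelian_group_induct, goal_cases)
    case 1
    then show ?case by (simp add: tR_zero)
  next
    case (2 x y)
    then show ?case
      using tR_diff[OF 2(3,4)] by (simp add: frag_extend_diff algebra_simps)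
  next
    case (3 a)
    obtain x r where a: "a = (x, r)" by (cases a)
    then show ?case
      using 3 tR_add_right[of x "p * r" "q * r"] by (simp add: distrib_right diff_diff_eq)
  qed
qed

lemma tensor_scale_scale:
  "tensor_scale p (tensor_scale q c) = tensor_scale (p * q) c"
proof -
  have "Poly_Mapping.keys c \<subseteq> UNIV" by simp
  then show ?thesis
    by (rule free_Abelian_group_induct)
       (auto simp: frag_extend_diff mult.assoc)
qed

lemma tensor_scale_one: "tensor_scale 1 c = c"
proof -
  have "Poly_Mapping.keys c \<subseteq> UNIV" by simp
  then show ?thesis
    by (rule free_Abelian_group_induct)
       (auto simp: frag_extend_diff)
qed

lemma tensor_carrierI: "c \<in> carrier tF \<Longrightarrow> tR #>\<^bsub>tF\<^esub> c \<in> carrier (tensor_rat G)"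
  unfolding tensor_carrier by blast

lemma tensor_carrierE:
  assumes "u \<in> carrier (tensor_rat G)"
  obtains c where "u = tR #>\<^bsub>tF\<^esub> c" "c \<in> carrier tF"
  using assms unfolding tensor_carrier by blast

lemma vectorspace_tensor_rat: "vectorspace rat_field (tensor_rat G)"
proof -
  have add_carrier: "c + d \<in> carrier tF" if "c \<in> carrier tF" "d \<in> carrier tF" for c d
    using that keys_add[of c d] by auto
  have scale_carrier: "tensor_scale q c \<in> carrier tF" if "c \<in> carrier tF" for q c
    using that tensor_scale_in_carrier by simp
  interpret K: field rat_field by (rule field_rat_field)
  have "abelian_group (tensor_rat G)"
  proof (rule abelian_groupI)
    fix u v assume "u \<in> carrier (tensor_rat G)" "v \<in> carrier (tensor_rat G)"
    then obtain c d where cd: "u = tR #>\<^bsub>tF\<^esub> c" "c \<in> carrier tF" "v = tR #>\<^bsub>tF\<^esub> d" "d \<in> carrier tF"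
      by (elim tensor_carrierE)
    show "u \<oplus>\<^bsub>tensor_rat G\<^esub> v \<in> carrier (tensor_rat G)"
      unfolding cd(1,3) tensor_add[OF cd(2,4)] by (intro tensor_carrierI add_carrier cd)
    show "u \<oplus>\<^bsub>tensor_rat G\<^esub> v = v \<oplus>\<^bsub>tensor_rat G\<^esub> u"
      unfolding cd(1,3) tensor_add[OF cd(2,4)] tensor_add[OF cd(4,2)] by (simp only: add.commute)
    fix w assume "w \<in> carrier (tensor_rat G)"
    then obtain e where e: "w = tR #>\<^bsub>tF\<^esub> e" "e \<in> carrier tF"
      by (elim tensor_carrierE)
    show "(u \<oplus>\<^bsub>tensor_rat G\<^esub> v) \<oplus>\<^bsub>tensor_rat G\<^esub> w = u \<oplus>\<^bsub>tensor_rat G\<^esub> (v \<oplus>\<^bsub>tensor_rat G\<^esub> w)"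
      unfolding cd(1,3) e(1)
      by (simp only: tensor_add add_carrier cd(2,4) e(2) add.assoc)
  next
    show "\<zero>\<^bsub>tensor_rat G\<^esub> \<in> carrier (tensor_rat G)"
      unfolding tensor_zero by (rule tensor_carrierI) simp
  next
    fix u assume "u \<in> carrier (tensor_rat G)"
    then obtain c where c: "u = tR #>\<^bsub>tF\<^esub> c" "c \<in> carrier tF"
      by (elim tensor_carrierE)
    have zero: "0 \<in> carrier tF" and minus: "- c \<in> carrier tF"
      using c by simp_all
    show "\<zero>\<^bsub>tensor_rat G\<^esub> \<oplus>\<^bsub>tensor_rat G\<^esub> u = u"
      unfolding c(1) tensor_zero tensor_add[OF zero c(2)] by simp
    show "\<exists>v\<in>carrier (tensor_rat G). v \<oplus>\<^bsub>tensor_rat G\<^esub> u = \<zero>\<^bsub>tensor_rat G\<^esub>"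
      using tensor_add[OF minus c(2)] tensor_carrierI[OF minus]
      by (intro bexI[of _ "tR #>\<^bsub>tF\<^esub> (- c)"]) (simp_all only: c(1) tensor_zero left_minus)
  qed
  then have "Module.module rat_field (tensor_rat G)"
  proof (rule Module.moduleI[OF K.is_cring])
    fix a b u assume "u \<in> carrier (tensor_rat G)"
    then obtain c where c: "u = tR #>\<^bsub>tF\<^esub> c" "c \<in> carrier tF"
      by (elim tensor_carrierE)
    show "a \<odot>\<^bsub>tensor_rat G\<^esub> u \<in> carrier (tensor_rat G)"
      unfolding c(1) tensor_smult by (intro tensor_carrierI scale_carrier c)
    have "a \<oplus>\<^bsub>rat_field\<^esub> b = a + b" "a \<otimes>\<^bsub>rat_field\<^esub> b = a * b" "\<one>\<^bsub>rat_field\<^esub> = 1"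
      by (simp_all add: rat_field_def)
    note K_simps = this
    show "(a \<oplus>\<^bsub>rat_field\<^esub> b) \<odot>\<^bsub>tensor_rat G\<^esub> u =
        a \<odot>\<^bsub>tensor_rat G\<^esub> u \<oplus>\<^bsub>tensor_rat G\<^esub> b \<odot>\<^bsub>tensor_rat G\<^esub> u"
      unfolding c(1) K_simps tensor_smult tensor_add[OF scale_carrier scale_carrier, OF c(2) c(2)]
      by (rule tR_coset_eq[OF tensor_scale_add_in_tR[OF c(2)]])
    show "(a \<otimes>\<^bsub>rat_field\<^esub> b) \<odot>\<^bsub>tensor_rat G\<^esub> u = a \<odot>\<^bsub>tensor_rat G\<^esub> (b \<odot>\<^bsub>tensor_rat G\<^esub> u)"
      unfolding c(1) K_simps tensor_smult tensor_scale_scale ..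
    show "\<one>\<^bsub>rat_field\<^esub> \<odot>\<^bsub>tensor_rat G\<^esub> u = u"
      unfolding c(1) K_simps tensor_smult tensor_scale_one ..
    fix v assume "v \<in> carrier (tensor_rat G)"
    then obtain d where d: "v = tR #>\<^bsub>tF\<^esub> d" "d \<in> carrier tF"
      by (elim tensor_carrierE)
    show "a \<odot>\<^bsub>tensor_rat G\<^esub> (u \<oplus>\<^bsub>tensor_rat G\<^esub> v) =
        a \<odot>\<^bsub>tensor_rat G\<^esub> u \<oplus>\<^bsub>tensor_rat G\<^esub> a \<odot>\<^bsub>tensor_rat G\<^esub> v"
      unfolding c(1) d(1)
      by (simp only: tensor_smult tensor_add c(2) d(2) scale_carrier frag_extend_add)
  qed
  then show ?thesis
    by (intro vectorspace.intro field_rat_field)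
qed

end

text \<open>
  \<open>vectorspace.dim\<close> is only meaningful in the finite-dimensional case, which is therefore
  required separately.
\<close>

definition has_torsion_free_rank :: "('a, 'b) monoid_scheme \<Rightarrow> nat \<Rightarrow> bool" where
  "has_torsion_free_rank H k \<longleftrightarrow>
     vectorspace.fin_dim rat_field (tensor_rat H) \<and>
     vectorspace.dim rat_field (tensor_rat H) = k"

section \<open>Diffeomorphisms of the unit interval and critical regularity\<close>

text \<open>Derivatives within \<open>{0..1}\<close> are one-sided at the endpoints.\<close>

primrec unit_deriv :: "nat \<Rightarrow> (real \<Rightarrow> real) \<Rightarrow> real \<Rightarrow> real" where
  "unit_deriv 0 f = f"
| "unit_deriv (Suc i) f = (\<lambda>x. vector_derivative (unit_deriv i f) (at x within {0..1}))"

definition C_on_unit :: "nat \<Rightarrow> (real \<Rightarrow> real) \<Rightarrow> bool" where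
  "C_on_unit n f \<longleftrightarrow>
     (\<forall>i<n. unit_deriv i f differentiable_on {0..1}) \<and> continuous_on {0..1} (unit_deriv n f)"

text \<open>In the case \<open>\<alpha> = 0\<close> this says that \<open>g\<close> is bounded, as \<open>0 powr 0 = 0\<close> only matters for
  \<open>x = y\<close>.\<close>

definition holder_on_unit :: "real \<Rightarrow> (real \<Rightarrow> real) \<Rightarrow> bool" where
  "holder_on_unit \<alpha> g \<longleftrightarrow>
     (\<exists>C. \<forall>x\<in>{0..1}. \<forall>y\<in>{0..1}. \<bar>g x - g y\<bar> \<le> C * \<bar>x - y\<bar> powr \<alpha>)"

text \<open>
  As a set of extensional bijections with composition. For \<open>n = 0\<close> and \<open>0 < \<alpha>\<close> it is not closed
  under composition, so an embedding is to be read as an injective homomorphism into the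
  homeomorphisms all of whose values have the required regularity.
\<close>

definition Diff_plus :: "nat \<Rightarrow> real \<Rightarrow> (real \<Rightarrow> real) monoid" where
  "Diff_plus n \<alpha> = (BijGroup {0..1})\<lparr>carrier :=
     {f \<in> Bij {0..1}. strict_mono_on {0..1} f \<and>
        C_on_unit n f \<and> C_on_unit n (inv_into {0..1} f) \<and>
        holder_on_unit \<alpha> (unit_deriv n f)}\<rparr>"

definition embeds_in_Diff :: "('a, 'b) monoid_scheme \<Rightarrow> nat \<Rightarrow> real \<Rightarrow> bool" where
  "embeds_in_Diff G n \<alpha> \<longleftrightarrow> mon G (Diff_plus n \<alpha>) \<noteq> {}"

text \<open>
  If \<open>G\<close> does not embed into \<open>Diff_plus 0 0\<close>, then it embeds into no \<open>Diff_plus n \<alpha>\<close>, and the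
  supremum of the empty set is \<open>-\<infinity>\<close>.
\<close>

definition Crit :: "('a, 'b) monoid_scheme \<Rightarrow> ereal" where
  "Crit G = Sup {ereal (real n + \<alpha>) | n \<alpha>. 0 \<le> \<alpha> \<and> \<alpha> < 1 \<and> embeds_in_Diff G n \<alpha>}"

end

theory Submission
  imports
    Defs
    "HOL-Computational_Algebra.Polynomial"
    "HOL-Real_Asymp.Real_Asymp"
    "Jordan_Normal_Form.VS_Connect"
begin

text \<open>
Let \<open>d \<ge> 2\<close>. The group is the semidirect product of the lattice of rank \<open>k\<close> with the abelian group of
integer valued polynomial functions of degree less than \<open>d\<close> on it, where a lattice vector acts on a
function by translating its argument. The pair \<open>(v, p)\<close> is best seen as the transformation
\<open>(w, t) \<mapsto> (w + v, t + p w)\<close> of the product of the lattice with the real line. The subgroup \<open>A\<close>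
consists of the polynomial functions. A commutator of a function with a translation is a difference
of the function, so the upper central series consists of the functions of bounded degree and only
reaches the whole group in step \<open>d\<close> (\<open>nilpotent_poly_group\<close>). Linear functions are available because
\<open>d \<ge> 2\<close>, and they detect every translation, so \<open>A\<close> is its own centralizer. The quotient by \<open>A\<close> is the
lattice.

Upper bound on the regularity (\<open>regularity_bound\<close>). Consider a faithful action by diffeomorphisms
whose derivatives are \<open>\<tau>\<close>-Hoelder with \<open>\<tau> > 1 / k\<close>. The constant functions are central; let \<open>J\<close> be
a component of the set moved by the constant \<open>1\<close>. Two elements that preserve \<open>J\<close> cannot have a
nontrivial constant as commutator, because a homeomorphism of \<open>J\<close> that commutes with the
central element displaces any two points by almost the same number of its fundamental domains
(\<open>no_central_commutator\<close>). Hence the stabilizer of \<open>J\<close> is isotropic for the pairing of translations with linear functions, and like every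
isotropic subgroup it is transverse to one of the Lagrangian subgroups spanned by coordinate
translations and complementary coordinate functions (\<open>exists_transverse_split\<close>). So there are \<open>k\<close>
commuting elements whose monomials move \<open>J\<close> to pairwise disjoint intervals. A random lattice path
that is uniformly distributed on every level meets intervals with finite expected sum of the
\<open>\<tau>\<close>-th powers of their lengths, exactly because \<open>\<tau> > 1 / k\<close> (\<open>cheap_orthant_paths\<close>). Along
a good path the distortion stays bounded, while the intervals become so short that the central
element is almost linear on them. Since the central element commutes with the path, all its powers
are boundedly close to linear on \<open>J\<close>, although they push every point of \<open>J\<close> to an endpoint
(\<open>generalized_Kopell\<close>). For \<open>k = 1\<close>
the derivatives are Lipschitz, and this is the classical argument of Kopell.

Lower bound (\<open>poly_group_embeds\<close>). Given \<open>\<alpha> < 1 / k\<close>, put \<open>r = 1 / \<alpha> > k\<close> and line up intervals of length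
proportional to \<open>(1 + |w|) powr (-r)\<close>, one for every lattice vector \<open>w\<close>, in a translation
invariant order of the lattice; the lengths are summable because \<open>r > k\<close>. Identify the interval of
\<open>w\<close> with the real line by a density of the form \<open>((1 + |w|) ^ (2 * M) + t ^ 2) powr (- \<beta>)\<close>. The
transformation of \<open>(v, p)\<close> becomes a map of the unit interval whose derivative is a ratio of two such
densities. If the time scale \<open>(1 + |w|) ^ M\<close> dominates the values of the polynomials, this ratio
differs from \<open>1\<close> by \<open>O (1 / (1 + |w|))\<close>, which is the \<open>\<alpha>\<close>-th power of the length, and it tends to
\<open>1\<close> at both ends of the interval whatever \<open>w\<close> and \<open>p\<close> are. This makes the derivative
\<open>\<alpha>\<close>-Hoelder on the whole unit interval.
\<close>

section \<open>Integer valued polynomial functions on a lattice\<close>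

text \<open>
The lattice of rank \<open>k\<close>, as the coefficient vectors of integer polynomials of degree less than \<open>k\<close>.
The type of integer polynomials comes with a translation invariant linear order, which is what places
the intervals of the construction in the unit interval.
\<close>

definition grid :: "nat \<Rightarrow> int poly set" where
  "grid k = {v. \<forall>i\<ge>k. Polynomial.coeff v i = 0}"

lemma grid_0 [simp]: "0 \<in> grid k"
  and grid_add [simp]: "v \<in> grid k \<Longrightarrow> w \<in> grid k \<Longrightarrow> v + w \<in> grid k"
  and grid_minus [simp]: "v \<in> grid k \<Longrightarrow> - v \<in> grid k"
  and grid_diff [simp]: "v \<in> grid k \<Longrightarrow> w \<in> grid k \<Longrightarrow> v - w \<in> grid k"
  and grid_monom [simp]: "i < k \<Longrightarrow> Polynomial.monom c i \<in> grid k"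
  by (auto simp: grid_def)

lemma grid_add_cancel [simp]: "v \<in> grid k \<Longrightarrow> w + v \<in> grid k \<longleftrightarrow> w \<in> grid k"
  by (auto simp: grid_def)

text \<open>
The integer valued functions on the lattice all of whose \<open>n\<close>-fold differences vanish, that is, the
polynomial functions of degree less than \<open>n\<close>. They are extended by \<open>0\<close> off the lattice so that
equality of functions is equality on the lattice.
\<close>

primrec polyfun :: "nat \<Rightarrow> nat \<Rightarrow> (int poly \<Rightarrow> int) set" where
  "polyfun k 0 = {\<lambda>_. 0}"
| "polyfun k (Suc n) = {p. (\<forall>w. w \<notin> grid k \<longrightarrow> p w = 0) \<and> (\<forall>v\<in>grid k. (\<lambda>w. p (w + v) - p w) \<in> polyfun k n)}"

lemma polyfun_outside: "p \<in> polyfun k n \<Longrightarrow> w \<notin> grid k \<Longrightarrow> p w = 0"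
  by (cases n) auto

lemma polyfun_delta: "p \<in> polyfun k (Suc n) \<Longrightarrow> v \<in> grid k \<Longrightarrow> (\<lambda>w. p (w + v) - p w) \<in> polyfun k n"
  by simp

lemma polyfun_zero [simp]: "(\<lambda>_. 0) \<in> polyfun k n"
  by (induction n) auto

lemma polyfun_add:
  "p \<in> polyfun k n \<Longrightarrow> q \<in> polyfun k n \<Longrightarrow> (\<lambda>w. p w + q w) \<in> polyfun k n"
proof (induction n arbitrary: p q)
  case (Suc n)
  have "(\<lambda>w. (p (w + v) - p w) + (q (w + v) - q w)) \<in> polyfun k n" if "v \<in> grid k" for v
    using Suc that by auto
  then show ?case using Suc.prems by (auto simp: algebra_simps)
qed simp

lemma polyfun_uminus:
  "p \<in> polyfun k n \<Longrightarrow> (\<lambda>w. - p w) \<in> polyfun k n"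
proof (induction n arbitrary: p)
  case (Suc n)
  have "(\<lambda>w. - (p (w + v) - p w)) \<in> polyfun k n" if "v \<in> grid k" for v
    by (rule Suc.IH[OF polyfun_delta[OF Suc.prems that]])
  then show ?case using Suc.prems by auto
qed simp

lemma polyfun_diff:
  "p \<in> polyfun k n \<Longrightarrow> q \<in> polyfun k n \<Longrightarrow> (\<lambda>w. p w - q w) \<in> polyfun k n"
  using polyfun_add[OF _ polyfun_uminus] by fastforce

lemma polyfun_mono_Suc: "p \<in> polyfun k n \<Longrightarrow> p \<in> polyfun k (Suc n)"
proof (induction n arbitrary: p)
  case (Suc n)
  then show ?case by (auto simp del: polyfun.simps(1) simp: polyfun.simps(2)[of k n] polyfun.simps(2)[of k "Suc n"])
qed auto

lemma polyfun_mono: "p \<in> polyfun k m \<Longrightarrow> m \<le> n \<Longrightarrow> p \<in> polyfun k n"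
  using lift_Suc_mono_le[of "polyfun k" m n] polyfun_mono_Suc by blast

lemma polyfun_translate:
  assumes "p \<in> polyfun k n" "v \<in> grid k" shows "(\<lambda>w. p (w + v)) \<in> polyfun k n"
proof -
  have "(\<lambda>w. (p (w + v) - p w) + p w) \<in> polyfun k n"
    using assms polyfun_delta[OF polyfun_mono_Suc[OF assms(1)] assms(2)] by (intro polyfun_add) auto
  then show ?thesis by simp
qed

declare polyfun.simps(2) [simp del]

definition const_fun :: "nat \<Rightarrow> int \<Rightarrow> int poly \<Rightarrow> int" where
  "const_fun k c w = (if w \<in> grid k then c else 0)"

lemma polyfun_1: "p \<in> polyfun k (Suc 0) \<longleftrightarrow> (\<exists>c. p = const_fun k c)"
proof
  assume p: "p \<in> polyfun k (Suc 0)"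
  have const: "p w = p 0" if "w \<in> grid k" for w
  proof -
    have "(\<lambda>u. p (u + w) - p u) = (\<lambda>_. 0)"
      using polyfun_delta[OF p that] by (simp only: polyfun.simps(1) singleton_iff)
    from fun_cong[OF this, of 0] show ?thesis by simp
  qed
  then have "p w = const_fun k (p 0) w" for w
  proof (cases "w \<in> grid k")
    case True
    then show ?thesis unfolding const_fun_def if_P[OF True] by (rule const)
  next
    case False
    then show ?thesis unfolding const_fun_def if_not_P[OF False] by (rule polyfun_outside[OF p])
  qed
  then have "p = const_fun k (p 0)" by (rule ext)
  then show "\<exists>c. p = const_fun k c" ..
next
  assume "\<exists>c. p = const_fun k c"
  then obtain c where c: "p = const_fun k c" ..
  show "p \<in> polyfun k (Suc 0)"
    unfolding polyfun.simps c by (simp add: const_fun_def)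
qed

definition power_fun :: "nat \<Rightarrow> nat \<Rightarrow> nat \<Rightarrow> int poly \<Rightarrow> int" where
  "power_fun k i n w = (if w \<in> grid k then Polynomial.coeff w i ^ n else 0)"

lemma polyfun_sum:
  "finite A \<Longrightarrow> (\<And>x. x \<in> A \<Longrightarrow> f x \<in> polyfun k n) \<Longrightarrow> (\<lambda>w. \<Sum>x\<in>A. f x w) \<in> polyfun k n"
proof (induction A rule: finite_induct)
  case (insert x A)
  have "(\<lambda>w. f x w + (\<Sum>x\<in>A. f x w)) \<in> polyfun k n"
    using insert by (intro polyfun_add) simp_all
  then show ?case using insert(1,2) by simp
qed simp

lemma polyfun_scale: "p \<in> polyfun k n \<Longrightarrow> (\<lambda>w. c * p w) \<in> polyfun k n"
proof (induction n arbitrary: p)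
  case (Suc n)
  have "(\<lambda>w. c * p (w + v) - c * p w) \<in> polyfun k n" if "v \<in> grid k" for v
    using Suc.IH[OF polyfun_delta[OF Suc.prems that]] by (simp only: right_diff_distrib)
  then show ?case using Suc.prems by (simp add: polyfun.simps(2))
qed simp

text \<open>
By the binomial theorem the difference of an \<open>n\<close>-th power is a combination of lower powers.
\<close>

lemma power_fun_polyfun: "power_fun k i n \<in> polyfun k (Suc n)"
proof (induction n rule: less_induct)
  case (less n)
  have "(\<lambda>w. power_fun k i n (w + v) - power_fun k i n w) \<in> polyfun k n" if v: "v \<in> grid k" for v
  proof -
    have "(\<lambda>w. power_fun k i n (w + v) - power_fun k i n w)
       = (\<lambda>w. \<Sum>j<n. (of_nat (n choose j) * Polynomial.coeff v i ^ (n - j)) * power_fun k i j w)"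
    proof
      fix w
      show "power_fun k i n (w + v) - power_fun k i n w
        = (\<Sum>j<n. (of_nat (n choose j) * Polynomial.coeff v i ^ (n - j)) * power_fun k i j w)"
      proof (cases "w \<in> grid k")
        case True
        have "(Polynomial.coeff w i + Polynomial.coeff v i) ^ n = (\<Sum>j\<le>n. of_nat (n choose j) * Polynomial.coeff w i ^ j * Polynomial.coeff v i ^ (n - j))"
          by (rule binomial_ring)
        also have "\<dots> = (\<Sum>j<n. of_nat (n choose j) * Polynomial.coeff w i ^ j * Polynomial.coeff v i ^ (n - j)) + Polynomial.coeff w i ^ n"
          unfolding lessThan_Suc_atMost[symmetric] sum.lessThan_Suc by simp
        also have "(\<Sum>j<n. of_nat (n choose j) * Polynomial.coeff w i ^ j * Polynomial.coeff v i ^ (n - j))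
           = (\<Sum>j<n. (of_nat (n choose j) * Polynomial.coeff v i ^ (n - j)) * power_fun k i j w)"
          using True by (intro sum.cong) (auto simp: power_fun_def)
        finally have "(Polynomial.coeff w i + Polynomial.coeff v i) ^ n - Polynomial.coeff w i ^ n
           = (\<Sum>j<n. (of_nat (n choose j) * Polynomial.coeff v i ^ (n - j)) * power_fun k i j w)"
          by (simp only: diff_eq_eq)
        then show ?thesis using True v by (simp only: power_fun_def grid_add coeff_add if_True)
      qed (use v in \<open>simp add: power_fun_def\<close>)
    qed
    also have "\<dots> \<in> polyfun k n"
    proof (rule polyfun_sum, simp, rule polyfun_scale)
      fix j assume "j \<in> {..<n}"
      then show "power_fun k i j \<in> polyfun k n"
        by (intro polyfun_mono[OF less]) simp_all
    qed
    finally show ?thesis .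
  qed
  note delta = this
  show ?case
    unfolding polyfun.simps(2)
  proof (intro CollectI conjI allI impI ballI)
    show "power_fun k i n w = 0" if "w \<notin> grid k" for w
      using that by (simp add: power_fun_def)
  qed (rule delta)
qed

definition gnorm :: "nat \<Rightarrow> int poly \<Rightarrow> nat" where
  "gnorm k w = (\<Sum>i<k. nat \<bar>Polynomial.coeff w i\<bar>)"

lemma gnorm_add: "gnorm k (v + w) \<le> gnorm k v + gnorm k w"
  unfolding gnorm_def sum.distrib[symmetric] by (intro sum_mono) auto

lemma gnorm_uminus [simp]: "gnorm k (- v) = gnorm k v"
  by (simp add: gnorm_def)

lemma gnorm_0 [simp]: "gnorm k 0 = 0"
  by (simp add: gnorm_def)

lemma gnorm_eq_0:
  assumes "w \<in> grid k" shows "gnorm k w = 0 \<longleftrightarrow> w = 0"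
proof
  assume "gnorm k w = 0"
  moreover from this have "Polynomial.coeff w i = 0" if "i < k" for i
    using that by (simp add: gnorm_def)
  ultimately have "Polynomial.coeff w i = 0" for i
    by (cases "i < k") (use assms in \<open>auto simp: grid_def\<close>)
  then show "w = 0" by (simp add: poly_eq_iff)
qed simp

text \<open>
Every lattice vector is reached from the origin by unit steps; this is the induction scheme for the
growth estimate below.
\<close>

lemma gnorm_descend:
  assumes w: "w \<in> grid k" "gnorm k w = Suc m"
  obtains i s where "i < k" "s = 1 \<or> s = -1" "gnorm k (w - Polynomial.monom s i) = m"
proof -
  have "\<exists>i<k. Polynomial.coeff w i \<noteq> 0"
  proof (rule ccontr)
    assume "\<not> ?thesis"
    then have "gnorm k w = 0" by (simp add: gnorm_def)
    with w show False by simp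
  qed
  then obtain i where i: "i < k" "Polynomial.coeff w i \<noteq> 0" by blast
  define s where "s = sgn (Polynomial.coeff w i)"
  have "(\<Sum>j<k. nat \<bar>Polynomial.coeff w j\<bar>) = (\<Sum>j<k. nat \<bar>Polynomial.coeff (w - Polynomial.monom s i) j\<bar> + (if j = i then 1 else 0))"
    using i(2) by (intro sum.cong) (auto simp: s_def sgn_if)
  also have "\<dots> = gnorm k (w - Polynomial.monom s i) + 1"
    using i by (simp add: sum.distrib gnorm_def)
  finally have "gnorm k (w - Polynomial.monom s i) = m" using w by (simp add: gnorm_def)
  moreover have "s = 1 \<or> s = -1" using i(2) by (auto simp: s_def sgn_if)
  ultimately show ?thesis using that i by blast
qed

text \<open>
Summing the difference of the function along a shortest path of unit steps from the origin gains one
power of the distance.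
\<close>

lemma polyfun_growth:
  "p \<in> polyfun k (Suc n) \<Longrightarrow> \<exists>C\<ge>0. \<forall>w\<in>grid k. real_of_int \<bar>p w\<bar> \<le> C * (1 + real (gnorm k w)) ^ n"
proof (induction n arbitrary: p)
  case 0
  then obtain c where "p = const_fun k c" using polyfun_1 by blast
  then show ?case by (intro exI[of _ "real_of_int \<bar>c\<bar>"]) (auto simp: const_fun_def)
next
  case (Suc n)
  define Q where "Q v C \<longleftrightarrow> C \<ge> 0 \<and> (\<forall>w\<in>grid k. real_of_int \<bar>p (w + v) - p w\<bar> \<le> C * (1 + real (gnorm k w)) ^ n)" for v C
  have "\<exists>C. Q v C" if "v \<in> grid k" for v
    using Suc.IH[OF polyfun_delta[OF Suc.prems that]] unfolding Q_def .
  then obtain C where Q: "\<And>v. v \<in> grid k \<Longrightarrow> Q v (C v)" by metis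
  have C: "C v \<ge> 0" "w \<in> grid k \<Longrightarrow> real_of_int \<bar>p (w + v) - p w\<bar> \<le> C v * (1 + real (gnorm k w)) ^ n"
    if "v \<in> grid k" for v w
    using Q[OF that] by (simp_all add: Q_def)
  define V where "V = (\<lambda>(s, i). Polynomial.monom s i :: int poly) ` ({1, -1} \<times> {..<k})"
  define D where "D = (\<Sum>v\<in>V. C v)"
  have V: "finite V" "V \<subseteq> grid k" by (auto simp: V_def)
  have D: "C v \<le> D" if "v \<in> V" for v
    unfolding D_def using that V C by (intro member_le_sum) auto
  have D0: "D \<ge> 0" unfolding D_def using V C by (intro sum_nonneg) auto
  have "real_of_int \<bar>p w\<bar> \<le> \<bar>p 0\<bar> + real m * D * (1 + real m) ^ n" if "w \<in> grid k" "gnorm k w = m" for w m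
    using that
  proof (induction m arbitrary: w)
    case 0
    then show ?case by (simp add: gnorm_eq_0)
  next
    case (Suc m)
    then obtain i s where ii: "i < k" "s = 1 \<or> s = -1" "gnorm k (w - Polynomial.monom s i) = m"
      using gnorm_descend by blast
    let ?u = "w - Polynomial.monom s i"
    have v: "Polynomial.monom s i \<in> V" using ii by (auto simp: V_def)
    have u: "?u \<in> grid k" using Suc ii by simp
    have "real_of_int \<bar>p w\<bar> \<le> real_of_int \<bar>p ?u\<bar> + real_of_int \<bar>p (?u + Polynomial.monom s i) - p ?u\<bar>"
      unfolding of_int_add[symmetric] of_int_le_iff diff_add_cancel by linarith
    also have "\<dots> \<le> (\<bar>p 0\<bar> + real m * D * (1 + real m) ^ n) + C (Polynomial.monom s i) * (1 + real m) ^ n"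
      using C(2)[OF subsetD[OF V(2) v] u] by (intro add_mono Suc.IH[OF u ii(3)]) (simp add: ii(3))
    also have "\<dots> \<le> (\<bar>p 0\<bar> + real m * D * (1 + real (Suc m)) ^ n) + D * (1 + real (Suc m)) ^ n"
    proof (intro add_mono order.refl)
      show "real m * D * (1 + real m) ^ n \<le> real m * D * (1 + real (Suc m)) ^ n"
        using D0 by (intro mult_left_mono power_mono) auto
      show "C (Polynomial.monom s i) * (1 + real m) ^ n \<le> D * (1 + real (Suc m)) ^ n"
        using D[OF v] D0 by (intro mult_mono power_mono) auto
    qed
    finally show ?case by (simp add: algebra_simps)
  qed
  note bound = this
  show ?case
  proof (intro exI[of _ "\<bar>p 0\<bar> + D"] conjI ballI)
    show "0 \<le> \<bar>p 0\<bar> + D" using D0 by simp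
    fix w assume w: "w \<in> grid k"
    let ?m = "real (gnorm k w)"
    have "real_of_int \<bar>p w\<bar> \<le> real_of_int \<bar>p 0\<bar> * 1 + D * (?m * (1 + ?m) ^ n)"
      using bound[OF w refl] by (simp add: mult_ac)
    also have "\<dots> \<le> real_of_int \<bar>p 0\<bar> * (1 + ?m) ^ Suc n + D * ((1 + ?m) * (1 + ?m) ^ n)"
    proof (rule add_mono)
      show "real_of_int \<bar>p 0\<bar> * 1 \<le> \<bar>p 0\<bar> * (1 + ?m) ^ Suc n"
        by (intro mult_left_mono one_le_power) auto
      show "D * (?m * (1 + ?m) ^ n) \<le> D * ((1 + ?m) * (1 + ?m) ^ n)"
        using D0 by (intro mult_left_mono mult_right_mono) auto
    qed
    finally show "real_of_int \<bar>p w\<bar> \<le> (\<bar>p 0\<bar> + D) * (1 + ?m) ^ Suc n"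
      by (simp add: algebra_simps)
  qed
qed

text \<open>
An \<open>n\<close>-th power outgrows every polynomial function of degree less than \<open>n\<close>.
\<close>

lemma power_fun_not_polyfun:
  assumes k: "k \<ge> 1" shows "power_fun k 0 n \<notin> polyfun k n"
proof (cases n)
  case 0
  have "power_fun k 0 0 0 \<noteq> 0" by (simp add: power_fun_def)
  then show ?thesis using 0 by (auto simp: fun_eq_iff)
next
  case (Suc m)
  show ?thesis
  proof
    assume "power_fun k 0 n \<in> polyfun k n"
    then have "power_fun k 0 n \<in> polyfun k (Suc m)" by (simp only: Suc)
    from polyfun_growth[OF this]
    obtain C where C: "C \<ge> 0" "\<forall>w\<in>grid k. real_of_int \<bar>power_fun k 0 n w\<bar> \<le> C * (1 + real (gnorm k w)) ^ m"
      by blast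
    obtain x :: nat where x: "real x > C * 2 ^ m + 1" using reals_Archimedean2 by blast
    then have x1: "real x \<ge> 1" using mult_nonneg_nonneg[OF C(1), of "2 ^ m"] by simp
    define w where "w = Polynomial.monom (int x) 0"
    have w: "w \<in> grid k" using k by (simp add: w_def)
    have "gnorm k w = (\<Sum>i<k. if i = 0 then x else 0)"
      unfolding gnorm_def w_def by (intro sum.cong) auto
    then have gw: "gnorm k w = x" using k by simp
    have "real x ^ n \<le> C * (1 + real x) ^ m"
      using bspec[OF C(2) w] w unfolding gw by (simp add: power_fun_def w_def)
    also have "\<dots> \<le> C * (2 * real x) ^ m"
      using C(1) x1 by (intro mult_left_mono power_mono) auto
    finally have "real x * real x ^ m \<le> (C * 2 ^ m) * real x ^ m"
      by (simp add: Suc power_mult_distrib mult_ac)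
    then have "real x \<le> C * 2 ^ m"
      by (rule mult_right_le_imp_le) (use x1 in simp)
    with x show False by simp
  qed
qed

section \<open>The group of translations and polynomial functions\<close>

text \<open>
The multiplication is composition of the transformations \<open>(w, t) \<mapsto> (w + v, t + p w)\<close>.
\<close>

definition poly_group :: "nat \<Rightarrow> nat \<Rightarrow> (int poly \<times> (int poly \<Rightarrow> int)) monoid" where
  "poly_group k d = \<lparr>carrier = grid k \<times> polyfun k d,
     monoid.mult = (\<lambda>(v, p) (v', p'). (v + v', \<lambda>w. p (w + v') + p' w)),
     one = (0, \<lambda>_. 0)\<rparr>"

lemma poly_group_simps [simp]:
  "(v, p) \<in> carrier (poly_group k d) \<longleftrightarrow> v \<in> grid k \<and> p \<in> polyfun k d"
  "(v, p) \<otimes>\<^bsub>poly_group k d\<^esub> (v', p') = (v + v', \<lambda>w. p (w + v') + p' w)"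
  "\<one>\<^bsub>poly_group k d\<^esub> = (0, \<lambda>_. 0)"
  by (simp_all add: poly_group_def)

lemma poly_group_mult_closed:
  assumes "v \<in> grid k" "p \<in> polyfun k d" "v' \<in> grid k" "p' \<in> polyfun k d"
  shows "(\<lambda>w. p (w + v') + p' w) \<in> polyfun k d"
  using polyfun_add[OF polyfun_translate] assms by blast

lemma group_poly_group: "group (poly_group k d)"
proof (rule groupI)
  fix x y assume "x \<in> carrier (poly_group k d)" "y \<in> carrier (poly_group k d)"
  moreover obtain v p v' p' where "x = (v, p)" "y = (v', p')" by (cases x; cases y)
  ultimately show "x \<otimes>\<^bsub>poly_group k d\<^esub> y \<in> carrier (poly_group k d)"
    using poly_group_mult_closed[of v k p d v' p'] by simp
next
  fix x y z assume "x \<in> carrier (poly_group k d)" "y \<in> carrier (poly_group k d)" "z \<in> carrier (poly_group k d)"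
  show "x \<otimes>\<^bsub>poly_group k d\<^esub> y \<otimes>\<^bsub>poly_group k d\<^esub> z = x \<otimes>\<^bsub>poly_group k d\<^esub> (y \<otimes>\<^bsub>poly_group k d\<^esub> z)"
    by (cases x; cases y; cases z) (simp add: ac_simps)
next
  fix x assume x: "x \<in> carrier (poly_group k d)"
  obtain v p where vp: "x = (v, p)" by (cases x)
  have "(\<lambda>w. - p (w + - v)) \<in> polyfun k d"
    using x vp by (intro polyfun_uminus polyfun_translate) simp_all
  with x vp show "\<exists>y\<in>carrier (poly_group k d). y \<otimes>\<^bsub>poly_group k d\<^esub> x = \<one>\<^bsub>poly_group k d\<^esub>"
    by (intro bexI[of _ "(- v, \<lambda>w. - p (w + - v))"]) simp_all
  show "\<one>\<^bsub>poly_group k d\<^esub> \<otimes>\<^bsub>poly_group k d\<^esub> x = x" by (simp add: vp)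
qed simp

lemma (in group) rcoset_eq_iff:
  assumes "subgroup N G" "a \<in> carrier G" "b \<in> carrier G"
  shows "N #> a = N #> b \<longleftrightarrow> (\<exists>z\<in>N. a = z \<otimes> b)"
proof
  assume "N #> a = N #> b"
  then have "a \<in> N #> b" using rcos_self[OF assms(2,1)] by simp
  then show "\<exists>z\<in>N. a = z \<otimes> b" by (auto simp: r_coset_def)
next
  assume "\<exists>z\<in>N. a = z \<otimes> b"
  then have "a \<in> N #> b" by (auto simp: r_coset_def)
  then show "N #> a = N #> b" using repr_independence[OF _ assms(3,1)] by simp
qed

lemma (in group) mem_center_FactGroup_iff:
  assumes N: "N \<lhd> G" and x: "x \<in> carrier G"
  shows "N #> x \<in> center_of (G Mod N) \<longleftrightarrow> (\<forall>y\<in>carrier G. \<exists>z\<in>N. x \<otimes> y = z \<otimes> (y \<otimes> x))"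
proof -
  have sub: "subgroup N G" using N by (rule normal_imp_subgroup)
  have "N #> x \<in> center_of (G Mod N) \<longleftrightarrow> (\<forall>y\<in>carrier G. (N #> x) <#> (N #> y) = (N #> y) <#> (N #> x))"
    using x by (auto simp: center_of_def FactGroup_def RCOSETS_def)
  also have "\<dots> \<longleftrightarrow> (\<forall>y\<in>carrier G. N #> (x \<otimes> y) = N #> (y \<otimes> x))"
    using x by (simp add: normal.rcos_sum[OF N])
  also have "\<dots> \<longleftrightarrow> (\<forall>y\<in>carrier G. \<exists>z\<in>N. x \<otimes> y = z \<otimes> (y \<otimes> x))"
    using x by (simp add: rcoset_eq_iff[OF sub])
  finally show ?thesis .
qed

lemma (in group) normal_center_preimage:
  assumes N: "N \<lhd> G"
  shows "{x \<in> carrier G. N #> x \<in> center_of (G Mod N)} \<lhd> G" (is "?Z \<lhd> G")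
proof -
  interpret N: normal N G by (rule N)
  interpret Q: group "G Mod N" by (rule N.factorgroup_is_group)
  have hom: "(\<lambda>x. N #> x) \<in> hom G (G Mod N)" by (rule N.r_coset_hom_Mod)
  interpret h: group_hom G "G Mod N" "\<lambda>x. N #> x"
    by unfold_locales (rule hom)
  have central: "N #> x \<in> center_of (G Mod N) \<longleftrightarrow>
      (\<forall>Y\<in>carrier (G Mod N). (N #> x) \<otimes>\<^bsub>G Mod N\<^esub> Y = Y \<otimes>\<^bsub>G Mod N\<^esub> (N #> x))" if "x \<in> carrier G" for x
    using h.hom_closed[OF that] by (simp add: center_of_def)
  show ?thesis unfolding normal_inv_iff
  proof (intro conjI ballI)
    show "subgroup ?Z G"
    proof (rule subgroupI)
      have "(N #> \<one>) \<otimes>\<^bsub>G Mod N\<^esub> Y = Y \<otimes>\<^bsub>G Mod N\<^esub> (N #> \<one>)" if "Y \<in> carrier (G Mod N)" for Y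
        unfolding h.hom_one by (simp only: Q.l_one[OF that] Q.r_one[OF that])
      then have "\<one> \<in> ?Z" using central[OF one_closed] by blast
      then show "?Z \<noteq> {}" by blast
      fix x assume x: "x \<in> ?Z"
      have "inv\<^bsub>G Mod N\<^esub> (N #> x) \<otimes>\<^bsub>G Mod N\<^esub> Y = Y \<otimes>\<^bsub>G Mod N\<^esub> inv\<^bsub>G Mod N\<^esub> (N #> x)"
        if "Y \<in> carrier (G Mod N)" for Y
        using x that central[of x]
        by (metis (no_types, lifting) Q.inv_closed Q.inv_solve_left' Q.inv_solve_right Q.m_assoc Q.m_closed h.hom_closed mem_Collect_eq)
      then show "inv x \<in> ?Z" using x central[of "inv x"] by simp
      fix y assume y: "y \<in> ?Z"
      have "((N #> x) \<otimes>\<^bsub>G Mod N\<^esub> (N #> y)) \<otimes>\<^bsub>G Mod N\<^esub> Y = Y \<otimes>\<^bsub>G Mod N\<^esub> ((N #> x) \<otimes>\<^bsub>G Mod N\<^esub> (N #> y))"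
        if Y: "Y \<in> carrier (G Mod N)" for Y
      proof -
        have c: "N #> x \<in> carrier (G Mod N)" "N #> y \<in> carrier (G Mod N)" using x y by simp_all
        have cx: "(N #> x) \<otimes>\<^bsub>G Mod N\<^esub> Y = Y \<otimes>\<^bsub>G Mod N\<^esub> (N #> x)"
          using x Y central[of x] by blast
        have cy: "(N #> y) \<otimes>\<^bsub>G Mod N\<^esub> Y = Y \<otimes>\<^bsub>G Mod N\<^esub> (N #> y)"
          using y Y central[of y] by blast
        show ?thesis
          using c Y by (metis Q.m_assoc cx cy)
      qed
      then show "x \<otimes> y \<in> ?Z" using x y central[of "x \<otimes> y"] by simp
    qed auto
    fix g x assume g: "g \<in> carrier G" and x: "x \<in> ?Z"
    have c: "N #> x \<in> carrier (G Mod N)" "N #> g \<in> carrier (G Mod N)" using x g by simp_all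
    have "(N #> x) \<otimes>\<^bsub>G Mod N\<^esub> (N #> g) = (N #> g) \<otimes>\<^bsub>G Mod N\<^esub> (N #> x)"
      using x c central[of x] by blast
    then have "(N #> g) \<otimes>\<^bsub>G Mod N\<^esub> (N #> x) \<otimes>\<^bsub>G Mod N\<^esub> inv\<^bsub>G Mod N\<^esub> (N #> g) = N #> x"
      using c by (metis Q.inv_solve_right' Q.m_closed)
    then have "N #> (g \<otimes> x \<otimes> inv g) = N #> x"
      using g x by (simp only: h.hom_mult h.hom_inv mem_Collect_eq m_closed inv_closed)
    then show "g \<otimes> x \<otimes> inv g \<in> ?Z" using g x by simp
  qed
qed

lemma (in group) upper_central_normal: "upper_central G i \<lhd> G"
proof (induction i)
  case 0
  show ?case by (simp add: one_is_normal)
next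
  case (Suc i)
  then show ?case by (simp add: normal_center_preimage)
qed

text \<open>
A form of the upper central series without quotient groups: the commutator with every group element
lies in the previous term.
\<close>

lemma (in group) upper_central_Suc:
  "x \<in> upper_central G (Suc i) \<longleftrightarrow>
   x \<in> carrier G \<and> (\<forall>y\<in>carrier G. \<exists>z\<in>upper_central G i. x \<otimes> y = z \<otimes> (y \<otimes> x))"
  using mem_center_FactGroup_iff[OF upper_central_normal] by auto

lemma (in group) upper_central_subset: "upper_central G i \<subseteq> carrier G"
  using normal_imp_subgroup[OF upper_central_normal] subgroup.subset by blast

text \<open>
The commutator of \<open>(0, p)\<close> with \<open>(v, q)\<close> is a translate of the difference of \<open>p\<close> in direction \<open>v\<close>.
\<close>

lemma poly_group_central_series:
  assumes "i \<le> d"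
  shows "(0, p) \<in> upper_central (poly_group k d) i \<longleftrightarrow> p \<in> polyfun k i"
  using assms
proof (induction i arbitrary: p)
  case 0
  show ?case by simp
next
  case (Suc i)
  interpret group "poly_group k d" by (rule group_poly_group)
  let ?Z = "upper_central (poly_group k d)"
  show ?case
  proof
    assume *: "(0, p) \<in> ?Z (Suc i)"
    then have p: "p \<in> polyfun k d" using upper_central_subset[of "Suc i"] by auto
    have "(\<lambda>w. p (w + v) - p w) \<in> polyfun k i" if v: "v \<in> grid k" for v
    proof -
      have "(v, \<lambda>_. 0) \<in> carrier (poly_group k d)" using v by simp
      with * obtain z where z: "z \<in> ?Z i" "(0, p) \<otimes>\<^bsub>poly_group k d\<^esub> (v, \<lambda>_. 0) = z \<otimes>\<^bsub>poly_group k d\<^esub> ((v, \<lambda>_. 0) \<otimes>\<^bsub>poly_group k d\<^esub> (0, p))"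
        unfolding upper_central_Suc by blast
      obtain u r where u: "z = (u, r)" by (cases z)
      from z(2) have "u = 0" and r: "(\<lambda>w. p (w + v)) = (\<lambda>w. r (w + v) + p w)" by (simp_all add: u)
      with z(1) Suc have "r \<in> polyfun k i" by (simp add: u)
      then have "(\<lambda>w. r (w + v)) \<in> polyfun k i" using v by (rule polyfun_translate)
      moreover have "r (w + v) = p (w + v) - p w" for w
        using fun_cong[OF r, of w] by simp
      ultimately show ?thesis by (simp only:)
    qed
    then show "p \<in> polyfun k (Suc i)"
      using polyfun_outside[OF p] by (simp add: polyfun.simps(2))
  next
    assume p: "p \<in> polyfun k (Suc i)"
    show "(0, p) \<in> ?Z (Suc i)"
      unfolding upper_central_Suc
    proof (intro conjI ballI)
      show "(0, p) \<in> carrier (poly_group k d)"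
        using polyfun_mono[OF p] Suc by simp
      fix y assume y: "y \<in> carrier (poly_group k d)"
      obtain v q where vq: "y = (v, q)" by (cases y)
      with y have v: "v \<in> grid k" by simp
      have "(\<lambda>w. p (w + - v + v) - p (w + - v)) \<in> polyfun k i"
        using polyfun_translate[OF polyfun_delta[OF p v], of "- v"] v by simp
      then have "(\<lambda>w. p w - p (w - v)) \<in> polyfun k i" by simp
      with Suc have "(0, \<lambda>w. p w - p (w - v)) \<in> ?Z i" by simp
      then show "\<exists>z\<in>?Z i. (0, p) \<otimes>\<^bsub>poly_group k d\<^esub> y = z \<otimes>\<^bsub>poly_group k d\<^esub> (y \<otimes>\<^bsub>poly_group k d\<^esub> (0, p))"
        by (rule bexI[rotated]) (simp add: vq add.commute)
    qed
  qed
qed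

text \<open>
A commutator of arbitrary elements is a difference of functions of degree less than \<open>d\<close>, so it lies
in the \<open>(d - 1)\<close>-st term of the series; the \<open>(d - 1)\<close>-st power of a coordinate shows that this term is
not everything.
\<close>

lemma nilpotent_poly_group:
  assumes k: "k \<ge> 1" and d: "d \<ge> 1"
  shows "nilpotent_of_degree (poly_group k d) d"
proof -
  obtain e where e: "d = Suc e" using d by (cases d) auto
  interpret group "poly_group k (Suc e)" by (rule group_poly_group)
  let ?Z = "upper_central (poly_group k (Suc e))"
  have "x \<in> ?Z (Suc e)" if x: "x \<in> carrier (poly_group k (Suc e))" for x
    unfolding upper_central_Suc
  proof (intro conjI ballI)
    show "x \<in> carrier (poly_group k (Suc e))" by (rule x)
    fix y assume y: "y \<in> carrier (poly_group k (Suc e))"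
    obtain v p u q where vp: "x = (v, p)" "y = (u, q)" by (cases x; cases y)
    have vp': "v \<in> grid k" "p \<in> polyfun k (Suc e)" "u \<in> grid k" "q \<in> polyfun k (Suc e)"
      using x y vp by simp_all
    let ?r = "\<lambda>w. (p (w + u) - p w) - (q (w + v) - q w)"
    have "?r \<in> polyfun k e"
      by (intro polyfun_diff polyfun_delta vp')
    then have "(\<lambda>w. ?r (w + - (u + v))) \<in> polyfun k e"
      using vp' by (intro polyfun_translate) simp_all
    then have "(0, \<lambda>w. ?r (w + - (u + v))) \<in> upper_central (poly_group k (Suc e)) e"
      by (simp add: poly_group_central_series del: upper_central.simps)
    then show "\<exists>z\<in>upper_central (poly_group k (Suc e)) e.
        x \<otimes>\<^bsub>poly_group k (Suc e)\<^esub> y = z \<otimes>\<^bsub>poly_group k (Suc e)\<^esub> (y \<otimes>\<^bsub>poly_group k (Suc e)\<^esub> x)"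
      by (rule bexI[rotated]) (simp add: vp add.commute)
  qed
  then have "?Z (Suc e) = carrier (poly_group k (Suc e))" using upper_central_subset[of "Suc e"] by blast
  moreover have "(0, power_fun k 0 e) \<notin> ?Z (Suc e - 1)"
    using poly_group_central_series[of e "Suc e" "power_fun k 0 e" k] power_fun_not_polyfun[OF k, of e] by simp
  moreover have "(0, power_fun k 0 e) \<in> carrier (poly_group k (Suc e))"
    using power_fun_polyfun[of k 0 e] by simp
  ultimately show ?thesis
    unfolding nilpotent_of_degree_def e using is_group by blast
qed

section \<open>Torsion-free rank of a lattice\<close>

definition grid_group :: "nat \<Rightarrow> int poly monoid" where
  "grid_group k = \<lparr>carrier = grid k, monoid.mult = (+), one = 0\<rparr>"

lemma comm_group_grid_group: "comm_group (grid_group k)"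
proof (rule comm_groupI)
  fix x assume "x \<in> carrier (grid_group k)"
  then show "\<exists>y\<in>carrier (grid_group k). y \<otimes>\<^bsub>grid_group k\<^esub> x = \<one>\<^bsub>grid_group k\<^esub>"
    by (intro bexI[of _ "- x"]) (auto simp: grid_group_def)
qed (auto simp: grid_group_def)

text \<open>
The additive extension of \<open>f\<close> to the free abelian group. Applied to the coordinates of pure tensors
it separates the elements of the tensor product.
\<close>

definition frag_coord :: "('a \<Rightarrow> rat) \<Rightarrow> ('a \<Rightarrow>\<^sub>0 int) \<Rightarrow> rat" where
  "frag_coord f c = (\<Sum>x\<in>Poly_Mapping.keys c. of_int (Poly_Mapping.lookup c x) * f x)"

lemma frag_coord_superset:
  assumes "finite A" "Poly_Mapping.keys c \<subseteq> A"
  shows "frag_coord f c = (\<Sum>x\<in>A. of_int (Poly_Mapping.lookup c x) * f x)"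
  unfolding frag_coord_def using assms
  by (intro sum.mono_neutral_left) (auto simp: in_keys_iff)

lemma frag_coord_add: "frag_coord f (c + d) = frag_coord f c + frag_coord f d"
proof -
  let ?A = "Poly_Mapping.keys c \<union> Poly_Mapping.keys d"
  have "Poly_Mapping.keys (c + d) \<subseteq> ?A" by (rule Poly_Mapping.keys_add)
  then show ?thesis
    using frag_coord_superset[of ?A c f] frag_coord_superset[of ?A d f] frag_coord_superset[of ?A "c + d" f]
    by (simp add: lookup_add distrib_right sum.distrib)
qed

lemma frag_coord_uminus: "frag_coord f (- c) = - frag_coord f c"
  by (simp add: frag_coord_def sum_negf)

lemma frag_coord_diff: "frag_coord f (c - d) = frag_coord f c - frag_coord f d"
  using frag_coord_add[of f c "- d"] by (simp add: frag_coord_uminus)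

lemma frag_coord_of [simp]: "frag_coord f (frag_of x) = f x"
  by (simp add: frag_coord_def)

lemma frag_coord_0 [simp]: "frag_coord f 0 = 0"
  by (simp add: frag_coord_def)

lemma frag_coord_sum: "frag_coord f (\<Sum>x\<in>A. g x) = (\<Sum>x\<in>A. frag_coord f (g x))"
  by (induction A rule: infinite_finite_induct) (auto simp: frag_coord_add)

context comm_group
begin

lemma tR_sum: "(\<And>x. x \<in> A \<Longrightarrow> g x \<in> tensor_relations G) \<Longrightarrow> (\<Sum>x\<in>A. g x) \<in> tensor_relations G"
  by (induction A rule: infinite_finite_induct) (auto intro: tR_zero tR_add)

lemma tR_frag_one: "frag_of (\<one>, q) \<in> tensor_relations G"
  using tR_minus[OF tR_mult_left[of \<one> \<one> q]] by simp

lemma tR_frag_zero: "x \<in> carrier G \<Longrightarrow> frag_of (x, 0) \<in> tensor_relations G"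
  using tR_minus[OF tR_add_right[of x 0 0]] by simp

lemma frag_coord_tR:
  assumes mult: "\<And>x y q. x \<in> carrier G \<Longrightarrow> y \<in> carrier G \<Longrightarrow> f (x \<otimes> y, q) = f (x, q) + f (y, q)"
    and add: "\<And>x q r. x \<in> carrier G \<Longrightarrow> f (x, q + r) = f (x, q) + f (x, r)"
    and c: "c \<in> tensor_relations G"
  shows "frag_coord f c = 0"
proof -
  have relator: "frag_coord f h = 0" if "h \<in> {frag_of (x \<otimes> y, q) - frag_of (x, q) - frag_of (y, q) | x y q.
      x \<in> carrier G \<and> y \<in> carrier G} \<union>
    {frag_of (x, q + r) - frag_of (x, q) - frag_of (x, r) | x q r. x \<in> carrier G}" for h
    using that by (auto simp: frag_coord_diff mult add)
  show ?thesis
    using c[unfolded tensor_relations_def]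
  proof (induction c rule: generate.induct)
    case (inv h)
    have "h \<in> carrier (tensor_generators G)"
      using tensor_relators_in_carrier inv by (rule subsetD)
    then have "inv\<^bsub>tensor_generators G\<^esub> h = - h"
      by (simp add: tensor_generators_def)
    then show ?case using relator[OF inv] by (simp add: frag_coord_uminus)
  qed (auto simp: frag_coord_add relator)
qed

text \<open>
The rational vectors of length \<open>k\<close> map linearly onto the tensor product, by sending the \<open>i\<close>-th unit
vector to the tensor of the \<open>i\<close>-th lattice generator with \<open>1\<close>. The map is onto because every pure
tensor expands along the generators, and injective because the coordinate functionals vanish on the
relations.
\<close>

lemma tensor_rank_of_iso_grid:
  assumes \<phi>: "\<phi> \<in> iso G (grid_group k)"
  shows "has_torsion_free_rank G k"
proof -
  let ?R = "tensor_relations G" and ?F = "tensor_generators G" and ?V = "module_vec TYPE(rat) k"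
  have bij: "bij_betw \<phi> (carrier G) (grid k)" and hom: "\<phi> \<in> hom G (grid_group k)"
    using \<phi> by (auto simp: iso_def grid_group_def)
  define E where "E = inv_into (carrier G) \<phi>"
  have E [simp]: "E v \<in> carrier G" "\<phi> (E v) = v" if "v \<in> grid k" for v
    using bij that unfolding E_def
    by (auto simp: bij_betw_def intro: inv_into_into f_inv_into_f)
  have E\<phi>: "E (\<phi> x) = x" "\<phi> x \<in> grid k" if "x \<in> carrier G" for x
    using bij that unfolding E_def by (auto simp: bij_betw_def)
  have \<phi>_mult: "\<phi> (x \<otimes> y) = \<phi> x + \<phi> y" if "x \<in> carrier G" "y \<in> carrier G" for x y
    using hom_mult[OF hom that] by (simp add: grid_group_def)
  have inj: "x = y" if "\<phi> x = \<phi> y" "x \<in> carrier G" "y \<in> carrier G" for x y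
    using bij that by (auto simp: bij_betw_def inj_on_def)
  have E_add: "E (v + w) = E v \<otimes> E w" if "v \<in> grid k" "w \<in> grid k" for v w
    using that by (intro inj) (auto simp: \<phi>_mult)
  have E_0: "E 0 = \<one>"
  proof (rule inj)
    have "\<phi> \<one> + \<phi> \<one> = \<phi> \<one>" using \<phi>_mult[of \<one> \<one>] by simp
    then show "\<phi> (E 0) = \<phi> \<one>" by simp
  qed auto
  let ?e = "\<lambda>i. E (Polynomial.monom 1 i)"

  \<comment> \<open>Every pure tensor is a rational combination of the coordinate vectors.\<close>
  have monomial: "frag_of (E (Polynomial.monom n i), q) - frag_of (?e i, of_int n * q) \<in> ?R"
    if i: "i < k" for i n q
  proof -
    let ?D = "\<lambda>n. frag_of (E (Polynomial.monom n i), q) - frag_of (?e i, of_int n * q)"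
    \<comment> \<open>The difference of the two sides is additive in the coefficient \<open>n\<close> modulo relations.\<close>
    have step: "?D (n + 1) - ?D n \<in> ?R" for n
    proof -
      have "frag_of (E (Polynomial.monom n i) \<otimes> ?e i, q) - frag_of (E (Polynomial.monom n i), q) - frag_of (?e i, q) \<in> ?R"
        using i by (intro tR_mult_left) auto
      also have "E (Polynomial.monom n i) \<otimes> ?e i = E (Polynomial.monom (n + 1) i)"
        using i by (simp add: E_add[symmetric] add_monom)
      finally have 1: "frag_of (E (Polynomial.monom (n + 1) i), q) - frag_of (E (Polynomial.monom n i), q) - frag_of (?e i, q) \<in> ?R" .
      have "frag_of (?e i, of_int n * q + q) - frag_of (?e i, of_int n * q) - frag_of (?e i, q) \<in> ?R"
        using i by (intro tR_add_right) auto
      from tR_diff[OF 1 this] show ?thesis by (simp add: distrib_right algebra_simps)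
    qed
    show ?thesis
    proof (induction n rule: int_induct[where k = 0])
      case base
      have "Polynomial.monom (0::int) i = 0" by simp
      then show ?case using tR_diff[OF tR_frag_one tR_frag_zero[of "?e i"]] i by (simp add: E_0)
    next
      case (step1 n)
      show ?case using tR_add[OF step[of n] step1(2)] by simp
    next
      case (step2 n)
      show ?case using tR_diff[OF step2(2) step[of "n - 1"]] by simp
    qed
  qed
  have partial: "frag_of (E (\<Sum>i<m. Polynomial.monom (Polynomial.coeff v i) i), q)
      - (\<Sum>i<m. frag_of (?e i, of_int (Polynomial.coeff v i) * q)) \<in> ?R" if "m \<le> k" for m v q
    using that
  proof (induction m)
    case 0
    show ?case using tR_frag_one by (simp add: E_0)
  next
    case (Suc m)
    let ?s = "\<Sum>i<m. Polynomial.monom (Polynomial.coeff v i) i" and ?t = "Polynomial.monom (Polynomial.coeff v m) m"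
    have s: "?s \<in> grid k" using Suc by (auto simp: grid_def coeff_sum)
    have t: "?t \<in> grid k" using Suc by simp
    have 1: "frag_of (E (?s + ?t), q) - frag_of (E ?s, q) - frag_of (E ?t, q) \<in> ?R"
      using tR_mult_left[of "E ?s" "E ?t" q] s t by (simp add: E_add)
    have 2: "frag_of (E ?s, q) - (\<Sum>i<m. frag_of (?e i, of_int (Polynomial.coeff v i) * q)) \<in> ?R"
      using Suc by simp
    have 3: "frag_of (E ?t, q) - frag_of (?e m, of_int (Polynomial.coeff v m) * q) \<in> ?R"
      using monomial[of m] Suc by simp
    show ?case using tR_add[OF tR_add[OF 1 2] 3] by (simp add: algebra_simps)
  qed
  define coord where "coord i = (\<lambda>(x, q). of_int (Polynomial.coeff (\<phi> x) i) * q :: rat)" for i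
  have coord_tR: "frag_coord (coord i) c = 0" if "c \<in> ?R" for i c
    by (rule frag_coord_tR[OF _ _ that]) (auto simp: coord_def \<phi>_mult distrib_left distrib_right)
  define nf where "nf c = (\<Sum>i<k. frag_of (?e i, frag_coord (coord i) c))" for c
  have nf_keys: "nf c \<in> carrier ?F" for c
  proof -
    have "Poly_Mapping.keys (\<Sum>i\<in>I. frag_of (?e i, frag_coord (coord i) c)) \<subseteq> carrier G \<times> UNIV" if "I \<subseteq> {..<k}" for I
      using finite_subset[OF that finite_lessThan] that
    proof (induction I rule: finite_induct)
      case (insert i I)
      have "Poly_Mapping.keys (frag_of (?e i, frag_coord (coord i) c) + (\<Sum>i\<in>I. frag_of (?e i, frag_coord (coord i) c)))
         \<subseteq> Poly_Mapping.keys (frag_of (?e i, frag_coord (coord i) c)) \<union> Poly_Mapping.keys (\<Sum>i\<in>I. frag_of (?e i, frag_coord (coord i) c))"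
        by (rule Poly_Mapping.keys_add)
      then show ?case using insert by auto
    qed simp
    then show ?thesis by (simp add: nf_def)
  qed
  have nf: "c - nf c \<in> ?R" if c: "c \<in> carrier ?F" for c
  proof -
    from c have "Poly_Mapping.keys c \<subseteq> carrier G \<times> UNIV" by simp
    then show ?thesis
    proof (rule free_Abelian_group_induct)
      show "0 - nf 0 \<in> ?R"
        unfolding nf_def diff_0 by (intro tR_minus tR_sum) (simp add: tR_frag_zero)
    next
      fix x y :: "('a \<times> rat) \<Rightarrow>\<^sub>0 int"
      assume xy: "x - nf x \<in> ?R" "y - nf y \<in> ?R"
      have "(\<Sum>i<k. frag_of (?e i, frag_coord (coord i) x) - frag_of (?e i, frag_coord (coord i) y)
          - frag_of (?e i, frag_coord (coord i) (x - y))) \<in> ?R"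
      proof (intro tR_sum)
        fix i assume "i \<in> {..<k}"
        then have "frag_of (?e i, frag_coord (coord i) (x - y) + frag_coord (coord i) y)
           - frag_of (?e i, frag_coord (coord i) (x - y)) - frag_of (?e i, frag_coord (coord i) y) \<in> ?R"
          by (intro tR_add_right) auto
        then show "frag_of (?e i, frag_coord (coord i) x) - frag_of (?e i, frag_coord (coord i) y)
          - frag_of (?e i, frag_coord (coord i) (x - y)) \<in> ?R"
          by (simp add: frag_coord_diff algebra_simps)
      qed
      then have "nf x - nf y - nf (x - y) \<in> ?R" by (simp add: nf_def sum_subtractf)
      from tR_add[OF tR_diff[OF xy] this] show "x - y - nf (x - y) \<in> ?R" by (simp add: algebra_simps)
    next
      fix a :: "'a \<times> rat" assume a: "a \<in> carrier G \<times> UNIV"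
      obtain x q where xq: "a = (x, q)" "x \<in> carrier G" using a by auto
      have "\<phi> x \<in> grid k" using xq E\<phi> by simp
      then have "Polynomial.coeff (\<Sum>i<k. Polynomial.monom (Polynomial.coeff (\<phi> x) i) i) j = Polynomial.coeff (\<phi> x) j" for j
        by (cases "j < k") (auto simp: coeff_sum grid_def)
      then have "(\<Sum>i<k. Polynomial.monom (Polynomial.coeff (\<phi> x) i) i) = \<phi> x"
        by (simp add: poly_eq_iff)
      with partial[of k "\<phi> x" q] show "frag_of a - nf (frag_of a) \<in> ?R"
        using xq by (simp add: nf_def coord_def E\<phi>)
    qed
  qed

  define T where "T u = ?R #>\<^bsub>?F\<^esub> (\<Sum>i<k. frag_of (?e i, u $ i))" for u :: "rat vec"
  have T_car: "(\<Sum>i<k. frag_of (?e i, u $ i)) \<in> carrier ?F" for u :: "rat vec"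
  proof -
    have "Poly_Mapping.keys (\<Sum>i\<in>I. frag_of (?e i, u $ i)) \<subseteq> carrier G \<times> UNIV" if "I \<subseteq> {..<k}" for I
      using finite_subset[OF that finite_lessThan] that
    proof (induction I rule: finite_induct)
      case (insert i I)
      have "Poly_Mapping.keys (frag_of (?e i, u $ i) + (\<Sum>i\<in>I. frag_of (?e i, u $ i)))
         \<subseteq> Poly_Mapping.keys (frag_of (?e i, u $ i)) \<union> Poly_Mapping.keys (\<Sum>i\<in>I. frag_of (?e i, u $ i))"
        by (rule Poly_Mapping.keys_add)
      then show ?case using insert by auto
    qed simp
    then show ?thesis by simp
  qed
  have coord_e: "coord i (?e j, q) = (if i = j then q else 0)" if "j < k" for i j q
    using that by (simp add: coord_def)
  have coord_T: "frag_coord (coord i) (\<Sum>j<k. frag_of (?e j, u $ j)) = u $ i" if "i < k" for i and u :: "rat vec"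
  proof -
    have "frag_coord (coord i) (\<Sum>j<k. frag_of (?e j, u $ j)) = (\<Sum>j<k. if i = j then u $ j else 0)"
      unfolding frag_coord_sum by (intro sum.cong) (auto simp: coord_e)
    with that show ?thesis by simp
  qed
  interpret F: comm_group ?F by (rule comm_group_tF)
  have coset_eqD: "c - d \<in> ?R" if "?R #>\<^bsub>?F\<^esub> c = ?R #>\<^bsub>?F\<^esub> d" for c d
  proof -
    have "c \<in> ?R #>\<^bsub>?F\<^esub> c" using tR_zero by (force simp: tR_coset)
    then have "c \<in> ?R #>\<^bsub>?F\<^esub> d" using that by simp
    then obtain r where "r \<in> ?R" "c = r + d" by (auto simp: tR_coset)
    then show ?thesis by simp
  qed
  have K: "rat_field = class_ring" by (simp add: rat_field_def)
  interpret V: vectorspace rat_field ?V unfolding K by (rule vec_vs)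
  interpret W: vectorspace rat_field "tensor_rat G" by (rule vectorspace_tensor_rat)
  have T_hom: "T \<in> module_hom rat_field ?V (tensor_rat G)"
    unfolding module_hom_def
  proof (intro CollectI conjI allI impI Pi_I; (elim conjE)?)
    show "T u \<in> carrier (tensor_rat G)" for u
      unfolding T_def by (rule tensor_carrierI[OF T_car])
    fix u w assume "u \<in> carrier ?V" "w \<in> carrier ?V"
    then have uw: "u \<in> carrier_vec k" "w \<in> carrier_vec k" by (simp_all add: module_vec_def)
    have "(\<Sum>i<k. frag_of (?e i, u $ i + w $ i) - frag_of (?e i, u $ i) - frag_of (?e i, w $ i)) \<in> ?R"
      by (intro tR_sum tR_add_right) auto
    also have "(\<Sum>i<k. frag_of (?e i, u $ i + w $ i) - frag_of (?e i, u $ i) - frag_of (?e i, w $ i))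
       = (\<Sum>i<k. frag_of (?e i, (u + w) $ i)) - ((\<Sum>i<k. frag_of (?e i, u $ i)) + (\<Sum>i<k. frag_of (?e i, w $ i)))"
      using uw by (simp add: sum_subtractf sum.distrib algebra_simps)
    finally have "?R #>\<^bsub>?F\<^esub> (\<Sum>i<k. frag_of (?e i, (u + w) $ i))
       = ?R #>\<^bsub>?F\<^esub> ((\<Sum>i<k. frag_of (?e i, u $ i)) + (\<Sum>i<k. frag_of (?e i, w $ i)))"
      by (rule tR_coset_eq)
    then show "T (u \<oplus>\<^bsub>?V\<^esub> w) = T u \<oplus>\<^bsub>tensor_rat G\<^esub> T w"
      unfolding T_def by (simp only: tensor_add[OF T_car T_car]) (simp add: module_vec_def)
  next
    fix r u assume "u \<in> carrier ?V"
    then have u: "u \<in> carrier_vec k" by (simp add: module_vec_def)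
    have ext: "frag_extend f (\<Sum>i\<in>I. g i) = (\<Sum>i\<in>I. frag_extend f (g i))" for f :: "'a \<times> rat \<Rightarrow> ('a \<times> rat) \<Rightarrow>\<^sub>0 int" and g and I :: "nat set"
      by (induction I rule: infinite_finite_induct) (auto simp: frag_extend_add)
    show "T (r \<odot>\<^bsub>?V\<^esub> u) = r \<odot>\<^bsub>tensor_rat G\<^esub> T u"
      unfolding T_def tensor_smult ext using u by (simp add: module_vec_def)
  qed
  interpret T: linear_map rat_field ?V "tensor_rat G" T
    by (intro linear_map.intro mod_hom.intro mod_hom_axioms.intro T_hom V.vectorspace_axioms W.vectorspace_axioms
        V.module_axioms W.module_axioms)
  have T_inj: "inj_on T (carrier ?V)"
  proof (rule inj_onI)
    fix u w assume uw: "u \<in> carrier ?V" "w \<in> carrier ?V" "T u = T w"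
    have "u $ i = w $ i" if i: "i < k" for i
    proof -
      have "(\<Sum>i<k. frag_of (?e i, u $ i)) - (\<Sum>i<k. frag_of (?e i, w $ i)) \<in> ?R"
        using uw(3) unfolding T_def by (rule coset_eqD)
      from coord_tR[OF this, of i] show ?thesis
        unfolding frag_coord_diff coord_T[OF i] by simp
    qed
    then show "u = w" using uw(1,2) by (intro eq_vecI) (auto simp: module_vec_def)
  qed
  have T_surj: "T ` carrier ?V = carrier (tensor_rat G)"
  proof
    show "T ` carrier ?V \<subseteq> carrier (tensor_rat G)"
      unfolding T_def by (auto intro: tensor_carrierI[OF T_car])
    show "carrier (tensor_rat G) \<subseteq> T ` carrier ?V"
    proof
      fix z assume "z \<in> carrier (tensor_rat G)"
      then obtain c where c: "z = ?R #>\<^bsub>?F\<^esub> c" "c \<in> carrier ?F" by (elim tensor_carrierE)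
      let ?u = "vec k (\<lambda>i. frag_coord (coord i) c)"
      have "z = T ?u"
        unfolding c T_def using tR_coset_eq[OF nf[OF c(2)]] by (simp add: nf_def)
      moreover have "?u \<in> carrier ?V" by (simp add: module_vec_def)
      ultimately show "z \<in> T ` carrier ?V" by blast
    qed
  qed
  have fin: "V.fin_dim" and dim: "V.dim = k"
    unfolding K by (rule vec_space.fin_dim, rule vec_space.dim_is_n)
  have "W.fin_dim" by (rule T.surj_fin_dim[OF fin T_surj])
  moreover have "W.dim = k" using T.dim_eq[OF fin T_inj T_surj] dim by simp
  ultimately show ?thesis unfolding has_torsion_free_rank_def ..
qed

end

section \<open>Lattice paths of small total weight\<close>

definition level :: "nat \<Rightarrow> nat \<Rightarrow> (nat \<Rightarrow> nat) set" where
  "level k m = {n. (\<forall>i\<ge>k. n i = 0) \<and> (\<Sum>i<k. n i) = m}"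

abbreviation step :: "(nat \<Rightarrow> nat) \<Rightarrow> nat \<Rightarrow> (nat \<Rightarrow> nat)" where
  "step n i \<equiv> n(i := Suc (n i))"

lemma level_finite: "finite (level k m)"
proof (rule finite_subset)
  show "level k m \<subseteq> {f. \<forall>x. (x \<in> {..<k} \<longrightarrow> f x \<in> {..m}) \<and> (x \<notin> {..<k} \<longrightarrow> f x = 0)}"
  proof (clarsimp simp: level_def not_less)
    fix n :: "nat \<Rightarrow> nat" and x assume "x < k"
    then show "n x \<le> (\<Sum>i<k. n i)"
      by (intro member_le_sum) auto
  qed
  show "finite {f. \<forall>x. (x \<in> {..<k} \<longrightarrow> f x \<in> {..m}) \<and> (x \<notin> {..<k} \<longrightarrow> f x = 0)}"
    by (rule finite_set_of_finite_funs) auto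
qed

lemma level_0: "level k 0 = {\<lambda>_. 0}"
  by (auto simp: level_def fun_eq_iff) (metis lessThan_iff not_less)

lemma sum_step:
  assumes "i < k"
  shows "(\<Sum>j<k. step n i j) = Suc (\<Sum>j<k. n j)"
proof -
  have "(\<Sum>j<k. step n i j) = (\<Sum>j<k. n j + (if j = i then 1 else 0))"
    by (intro sum.cong) auto
  also have "\<dots> = Suc (\<Sum>j<k. n j)"
    using assms by (simp add: sum.distrib)
  finally show ?thesis .
qed

lemma step_level: "n \<in> level k m \<Longrightarrow> i < k \<Longrightarrow> step n i \<in> level k (Suc m)"
  using sum_step[of i k n] by (auto simp: level_def)

text \<open>
Double counting of the edges between consecutive levels: a point \<open>n\<close> of the upper level is entered
with weights \<open>n i\<close>, which add up to its level. These weights are the transition probabilities of the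
Polya urn, up to normalization, and the identity says that the urn preserves uniform distribution on
levels.
\<close>

lemma sum_over_steps:
  fixes g :: "(nat \<Rightarrow> nat) \<Rightarrow> real"
  shows "(\<Sum>n\<in>level k m. \<Sum>i<k. real (Suc (n i)) * g (step n i))
       = real (Suc m) * (\<Sum>n\<in>level k (Suc m). g n)"
proof -
  have "(\<Sum>n\<in>level k m. \<Sum>i<k. real (Suc (n i)) * g (step n i))
      = (\<Sum>(n, i)\<in>level k m \<times> {..<k}. real (Suc (n i)) * g (step n i))"
    by (simp add: sum.cartesian_product)
  also have "\<dots> = (\<Sum>(n, i)\<in>{(n, i). n \<in> level k (Suc m) \<and> i < k \<and> n i \<noteq> 0}. real (n i) * g n)"
  proof (rule sum.reindex_bij_witness[where i = "\<lambda>(n, i). (n(i := n i - 1), i)"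
        and j = "\<lambda>(n, i). (step n i, i)"], goal_cases)
    case (4 b)
    obtain n i where b: "b = (n, i)" by (cases b)
    have ni: "n \<in> level k (Suc m)" "i < k" "n i \<noteq> 0" using 4 b by auto
    then have "step (n(i := n i - 1)) i = n" by auto
    with sum_step[OF ni(2), of "n(i := n i - 1)"] ni have "(\<Sum>j<k. (n(i := n i - 1)) j) = m"
      by (simp add: level_def)
    with ni show ?case by (auto simp: b level_def)
  qed (auto simp: step_level)
  also have "\<dots> = (\<Sum>(n, i)\<in>level k (Suc m) \<times> {..<k}. real (n i) * g n)"
    by (rule sum.mono_neutral_left) (auto simp: level_finite)
  also have "\<dots> = (\<Sum>n\<in>level k (Suc m). \<Sum>i<k. real (n i) * g n)"
    by (simp add: sum.cartesian_product)
  also have "\<dots> = (\<Sum>n\<in>level k (Suc m). real (Suc m) * g n)"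
  proof (rule sum.cong)
    fix n assume "n \<in> level k (Suc m)"
    then have "real (\<Sum>i<k. n i) = real (Suc m)" by (simp add: level_def)
    then show "(\<Sum>i<k. real (n i) * g n) = real (Suc m) * g n"
      by (simp add: sum_distrib_right[symmetric])
  qed simp
  finally show ?thesis by (simp add: sum_distrib_left)
qed

lemma sum_Suc_level:
  assumes "n \<in> level k m" shows "(\<Sum>i<k. real (Suc (n i))) = real (m + k)"
proof -
  have "(\<Sum>i<k. real (n i)) = real m"
    using assms by (simp add: level_def flip: of_nat_sum)
  then show ?thesis by (simp add: sum.distrib)
qed

lemma card_level_Suc: "real (m + k) * real (card (level k m)) = real (Suc m) * real (card (level k (Suc m)))"
  using sum_over_steps[where k = k and m = m and g = "\<lambda>_. 1"] sum_Suc_level[where k = k and m = m] by (simp del: of_nat_Suc of_nat_add add: mult.commute)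

lemma card_level:
  assumes "k \<ge> 1" shows "card (level k m) = (m + k - 1) choose (k - 1)"
proof (induction m)
  case 0
  then show ?case by (simp add: level_0)
next
  case (Suc m)
  have "Suc m * card (level k (Suc m)) = (m + k) * ((m + k - 1) choose (k - 1))"
    using card_level_Suc[of m k] Suc by (metis of_nat_eq_iff of_nat_mult)
  also have "\<dots> = Suc m * ((m + k) choose (k - 1))"
    using binomial_absorb_comp[of "m + k" "k - 1"] assms by (simp add: Suc_diff_le)
  finally have "card (level k (Suc m)) = (m + k) choose (k - 1)"
    by (metis Suc_mult_cancel1)
  then show ?case using assms by simp
qed

lemma card_level_pos: "k \<ge> 1 \<Longrightarrow> card (level k m) > 0"
  by (simp add: card_level)

lemma card_level_ge:
  assumes "k \<ge> 2" shows "(real m / real (k - 1)) ^ (k - 1) \<le> real (card (level k m))"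
proof -
  have "(real m / real (k - 1)) ^ (k - 1) \<le> (real (m + k - 1) / real (k - 1)) ^ (k - 1)"
    using assms by (intro power_mono divide_right_mono) auto
  also have "\<dots> \<le> real ((m + k - 1) choose (k - 1))"
    by (rule binomial_ge_n_over_k_pow_k) (use assms in auto)
  finally show ?thesis using assms by (simp add: card_level)
qed

text \<open>
The least total weight of a path of \<open>r\<close> unit steps from \<open>n\<close>.
\<close>

primrec cheapest :: "nat \<Rightarrow> ((nat \<Rightarrow> nat) \<Rightarrow> real) \<Rightarrow> nat \<Rightarrow> (nat \<Rightarrow> nat) \<Rightarrow> real" where
  "cheapest k a 0 n = a n"
| "cheapest k a (Suc r) n = a n + Min ((\<lambda>i. cheapest k a r (step n i)) ` {..<k})"

lemma cheapest_path:
  assumes "k \<ge> 1"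
  shows "\<exists>\<nu> \<iota>. \<nu> 0 = n \<and> (\<forall>j<r. \<iota> j < k \<and> \<nu> (Suc j) = step (\<nu> j) (\<iota> j))
     \<and> (\<Sum>j\<le>r. a (\<nu> j)) = cheapest k a r n"
proof (induction r arbitrary: n)
  case 0
  show ?case by (intro exI[of _ "\<lambda>_. n"]) auto
next
  case (Suc r)
  have "Min ((\<lambda>i. cheapest k a r (step n i)) ` {..<k}) \<in> (\<lambda>i. cheapest k a r (step n i)) ` {..<k}"
    using assms by (intro Min_in) (auto simp: lessThan_empty_iff)
  then obtain i where i: "i < k" "Min ((\<lambda>i. cheapest k a r (step n i)) ` {..<k}) = cheapest k a r (step n i)"
    by auto
  obtain \<nu> \<iota> where *: "\<nu> 0 = step n i" "\<forall>j<r. \<iota> j < k \<and> \<nu> (Suc j) = step (\<nu> j) (\<iota> j)"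
    "(\<Sum>j\<le>r. a (\<nu> j)) = cheapest k a r (step n i)"
    using Suc by blast
  show ?case
  proof (intro exI[of _ "case_nat n \<nu>"] exI[of _ "case_nat i \<iota>"] conjI allI impI)
    fix j assume "j < Suc r"
    then show "case_nat i \<iota> j < k"
      "case_nat n \<nu> (Suc j) = step (case_nat n \<nu> j) (case_nat i \<iota> j)"
      using * i by (auto split: nat.splits)
  next
    show "(\<Sum>j\<le>Suc r. a (case_nat n \<nu> j)) = cheapest k a (Suc r) n"
      using * i by (subst sum.atMost_Suc_shift) simp
  qed simp_all
qed

text \<open>
The minimum over the possible next steps is at most the average with the transition probabilities of
the Polya urn, and these carry the average over one level to the average over the next.
\<close>

lemma average_cheapest:
  fixes a :: "(nat \<Rightarrow> nat) \<Rightarrow> real"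
  assumes k: "k \<ge> 1"
  shows "(\<Sum>n\<in>level k m. cheapest k a r n) / card (level k m)
     \<le> (\<Sum>j=m..m+r. (\<Sum>n\<in>level k j. a n) / card (level k j))"
proof (induction r arbitrary: m)
  case 0
  show ?case by simp
next
  case (Suc r)
  have min: "real (m + k) * Min ((\<lambda>i. cheapest k a r (step n i)) ` {..<k})
      \<le> (\<Sum>i<k. real (Suc (n i)) * cheapest k a r (step n i))" if "n \<in> level k m" for n
  proof -
    have "real (m + k) * Min ((\<lambda>i. cheapest k a r (step n i)) ` {..<k})
       = (\<Sum>i<k. real (Suc (n i)) * Min ((\<lambda>i. cheapest k a r (step n i)) ` {..<k}))"
      using sum_Suc_level[OF that] by (metis sum_distrib_right)
    also have "\<dots> \<le> (\<Sum>i<k. real (Suc (n i)) * cheapest k a r (step n i))"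
      by (intro sum_mono mult_left_mono Min_le) auto
    finally show ?thesis .
  qed
  have pos: "real (card (level k m)) > 0" "real (card (level k (Suc m))) > 0"
    using card_level_pos[OF k] by auto
  have "real (m + k) * (\<Sum>n\<in>level k m. Min ((\<lambda>i. cheapest k a r (step n i)) ` {..<k}))
      \<le> (\<Sum>n\<in>level k m. \<Sum>i<k. real (Suc (n i)) * cheapest k a r (step n i))"
    unfolding sum_distrib_left by (rule sum_mono) (rule min)
  also have "\<dots> = real (Suc m) * (\<Sum>n\<in>level k (Suc m). cheapest k a r n)"
    by (rule sum_over_steps)
  finally have "real (m + k) * (\<Sum>n\<in>level k m. Min ((\<lambda>i. cheapest k a r (step n i)) ` {..<k}))
      / (real (m + k) * real (card (level k m)))
     \<le> real (Suc m) * (\<Sum>n\<in>level k (Suc m). cheapest k a r n) / (real (m + k) * real (card (level k m)))"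
    by (intro divide_right_mono) auto
  also have "real (Suc m) * (\<Sum>n\<in>level k (Suc m). cheapest k a r n) / (real (m + k) * real (card (level k m)))
    = (\<Sum>n\<in>level k (Suc m). cheapest k a r n) / card (level k (Suc m))"
    unfolding card_level_Suc by (simp del: of_nat_Suc)
  finally have "(\<Sum>n\<in>level k m. Min ((\<lambda>i. cheapest k a r (step n i)) ` {..<k})) / card (level k m)
     \<le> (\<Sum>n\<in>level k (Suc m). cheapest k a r n) / card (level k (Suc m))"
    using k by simp
  also have "\<dots> \<le> (\<Sum>j=Suc m..Suc m+r. (\<Sum>n\<in>level k j. a n) / card (level k j))"
    by (rule Suc)
  also have "{Suc m..Suc m + r} = {Suc m..m + Suc r}" by simp
  finally show ?case
    by (simp only: cheapest.simps sum.distrib add_divide_distrib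
        sum.atLeast_Suc_atMost[of m "m + Suc r"] le_add1 add_left_mono)
qed

lemma exists_cheap_path:
  fixes a :: "(nat \<Rightarrow> nat) \<Rightarrow> real"
  assumes k: "k \<ge> 1"
    and S: "(\<Sum>j\<le>r. (\<Sum>n\<in>level k j. a n) / card (level k j)) \<le> S"
  shows "\<exists>\<nu> \<iota>. \<nu> 0 = (\<lambda>_. 0) \<and> (\<forall>j<r. \<iota> j < k \<and> \<nu> (Suc j) = step (\<nu> j) (\<iota> j))
     \<and> (\<Sum>j\<le>r. a (\<nu> j)) \<le> S"
proof -
  have "cheapest k a r (\<lambda>_. 0) \<le> S"
    using average_cheapest[OF k, where m = 0 and r = r and a = a] S
    by (simp add: level_0 atMost_atLeast0)
  with cheapest_path[OF k, of "\<lambda>_. 0" r a] show ?thesis by metis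
qed

text \<open>
The inequality of Young, with both constants relaxed to \<open>1\<close>. It separates the lengths, whose sum is
at most \<open>1\<close>, from the sizes of the levels.
\<close>

lemma young_weight:
  fixes l N \<tau> :: real
  assumes "l \<ge> 0" "N > 0" "0 < \<tau>" "\<tau> < 1"
  shows "l powr \<tau> / N \<le> l + N powr (- (1 / (1 - \<tau>)))"
proof (cases "l \<ge> N powr (- (1 / (1 - \<tau>)))")
  case True
  then have "l > 0" using assms by (smt (verit) powr_gt_zero)
  have "N powr (-1) = (N powr (- (1 / (1 - \<tau>)))) powr (1 - \<tau>)"
    using assms by (simp add: powr_powr)
  also have "\<dots> \<le> l powr (1 - \<tau>)"
    using True assms by (intro powr_mono2) auto
  finally have "l powr \<tau> * N powr (-1) \<le> l powr \<tau> * l powr (1 - \<tau>)"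
    by (intro mult_left_mono) auto
  also have "\<dots> = l" using \<open>l > 0\<close> by (simp flip: powr_add)
  finally have "l powr \<tau> / N \<le> l" using assms by (simp add: powr_minus divide_inverse)
  then show ?thesis by (smt (verit) powr_ge_zero)
next
  case False
  then have "l powr \<tau> \<le> (N powr (- (1 / (1 - \<tau>)))) powr \<tau>"
    using assms by (intro powr_mono2) auto
  then have "l powr \<tau> / N \<le> (N powr (- (1 / (1 - \<tau>)))) powr \<tau> / N powr 1"
    using assms by (simp add: divide_right_mono)
  also have "\<dots> = N powr (- (1 / (1 - \<tau>)) * \<tau> - 1)"
    by (simp only: powr_powr powr_diff)
  also have "- (1 / (1 - \<tau>)) * \<tau> - 1 = - (1 / (1 - \<tau>))"
    using assms by (simp add: field_simps)
  finally show ?thesis using assms by linarith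
qed

text \<open>
The level \<open>m\<close> has about \<open>m ^ (k - 1)\<close> points, and \<open>(k - 1) * \<tau> / (1 - \<tau>) > 1\<close> says precisely that
\<open>\<tau> > 1 / k\<close>.
\<close>

lemma summable_card_level:
  assumes k: "k \<ge> 2" and \<tau>: "1 / real k < \<tau>" "\<tau> < 1"
  shows "summable (\<lambda>m. real (card (level k m)) powr (- (\<tau> / (1 - \<tau>))))"
proof (rule summable_comparison_test')
  define e where "e = real (k - 1) * (\<tau> / (1 - \<tau>))"
  have "real k * \<tau> > 1" using k \<tau> by (simp add: field_simps)
  then have e: "e > 1" using k \<tau> by (simp add: e_def field_simps of_nat_diff)
  have \<tau>0: "\<tau> / (1 - \<tau>) > 0" "\<tau> > 0"
    using k \<tau> by (auto intro!: divide_pos_pos intro: less_trans[OF _ \<tau>(1)])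
  show "summable (\<lambda>m. real (k - 1) powr e * real m powr (-e))"
    by (intro summable_mult) (use e in \<open>simp add: summable_real_powr_iff\<close>)
  fix m :: nat assume m: "m \<ge> 1"
  have "real (card (level k m)) powr (- (\<tau> / (1 - \<tau>)))
     \<le> ((real m / real (k - 1)) ^ (k - 1)) powr (- (\<tau> / (1 - \<tau>)))"
    using m k \<tau>0 card_level_ge[OF k, of m] by (intro powr_mono2') auto
  also have "\<dots> = (real m / real (k - 1)) powr (real (k - 1) * - (\<tau> / (1 - \<tau>)))"
    using m k by (subst powr_realpow[symmetric]) (auto simp: powr_powr)
  also have "real (k - 1) * - (\<tau> / (1 - \<tau>)) = - e" by (simp add: e_def)
  also have "(real m / real (k - 1)) powr (- e) = real (k - 1) powr e * real m powr (-e)"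
    using m k by (simp add: powr_divide powr_minus field_simps)
  finally show "norm (real (card (level k m)) powr (- (\<tau> / (1 - \<tau>)))) \<le> real (k - 1) powr e * real m powr (-e)"
    by simp
qed

definition orthant :: "nat \<Rightarrow> (nat \<Rightarrow> nat) set" where
  "orthant k = {n. \<forall>i\<ge>k. n i = 0}"

lemma level_orthant: "level k m \<subseteq> orthant k" by (auto simp: level_def orthant_def)

lemma level_disjoint: "j \<noteq> j' \<Longrightarrow> level k j \<inter> level k j' = {}"
  by (auto simp: level_def)

text \<open>
The bound \<open>S\<close> does not depend on the length of the path. By \<open>young_weight\<close>, the expected weight of a
random path is at most the sum of all lengths plus the convergent series of \<open>summable_card_level\<close>. In
the case \<open>k = 1\<close> there is only one path.
\<close>

lemma cheap_orthant_paths: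
  fixes l :: "(nat \<Rightarrow> nat) \<Rightarrow> real"
  assumes k: "k \<ge> 1" and \<tau>: "1 / real k < \<tau> \<and> \<tau> < 1 \<or> k = 1 \<and> \<tau> = 1"
    and l0: "\<And>n. n \<in> orthant k \<Longrightarrow> l n \<ge> 0"
    and l1: "\<And>F. finite F \<Longrightarrow> F \<subseteq> orthant k \<Longrightarrow> sum l F \<le> 1"
  shows "\<exists>S. \<forall>r. \<exists>\<nu> \<iota>. \<nu> 0 = (\<lambda>_. 0) \<and> (\<forall>j<r. \<iota> j < k \<and> \<nu> (Suc j) = step (\<nu> j) (\<iota> j))
     \<and> (\<Sum>j\<le>r. l (\<nu> j) powr \<tau>) \<le> S"
proof -
  have levels: "(\<Sum>j\<le>r. \<Sum>n\<in>level k j. l n) \<le> 1" for r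
  proof -
    have "(\<Sum>j\<le>r. \<Sum>n\<in>level k j. l n) = sum l (\<Union>j\<le>r. level k j)"
      by (subst sum.UNION_disjoint) (auto simp: level_finite level_disjoint)
    also have "\<dots> \<le> 1"
      using level_orthant by (intro l1) (auto simp: level_finite)
    finally show ?thesis .
  qed
  have "\<exists>S. \<forall>r. (\<Sum>j\<le>r. (\<Sum>n\<in>level k j. l n powr \<tau>) / card (level k j)) \<le> S"
    using \<tau>
  proof
    assume \<tau>: "k = 1 \<and> \<tau> = 1"
    have "(\<Sum>j\<le>r. (\<Sum>n\<in>level k j. l n powr \<tau>) / card (level k j)) \<le> 1" for r
    proof -
      have "(\<Sum>j\<le>r. (\<Sum>n\<in>level k j. l n powr \<tau>) / card (level k j)) = (\<Sum>j\<le>r. \<Sum>n\<in>level k j. l n)"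
        using \<tau> l0 level_orthant[of k] by (intro sum.cong) (auto simp: card_level subset_iff intro!: sum.cong)
      with levels show ?thesis by simp
    qed
    then show ?thesis by blast
  next
    assume t: "1 / real k < \<tau> \<and> \<tau> < 1"
    then have k2: "k \<ge> 2" using k by (cases "k = 1") auto
    have \<tau>0: "\<tau> > 0" using t k by (smt (verit) divide_nonneg_nonneg of_nat_0_le_iff)
    let ?N = "\<lambda>j. real (card (level k j))"
    define T where "T = suminf (\<lambda>m. ?N m powr (- (\<tau> / (1 - \<tau>))))"
    have "(\<Sum>j\<le>r. (\<Sum>n\<in>level k j. l n powr \<tau>) / card (level k j)) \<le> 1 + T" for r
    proof -
      have "(\<Sum>n\<in>level k j. l n powr \<tau>) / ?N j \<le> (\<Sum>n\<in>level k j. l n) + ?N j powr (- (\<tau> / (1 - \<tau>)))" for j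
      proof -
        have N: "?N j > 0" using card_level_pos[OF k] by simp
        have "(\<Sum>n\<in>level k j. l n powr \<tau>) / ?N j = (\<Sum>n\<in>level k j. l n powr \<tau> / ?N j)"
          by (simp add: sum_divide_distrib)
        also have "\<dots> \<le> (\<Sum>n\<in>level k j. l n + ?N j powr (- (1 / (1 - \<tau>))))"
          using l0 level_orthant N t \<tau>0 by (intro sum_mono young_weight) auto
        also have "\<dots> = (\<Sum>n\<in>level k j. l n) + ?N j powr 1 * ?N j powr (- (1 / (1 - \<tau>)))"
          using N by (simp add: sum.distrib)
        also have "?N j powr 1 * ?N j powr (- (1 / (1 - \<tau>))) = ?N j powr (1 + - (1 / (1 - \<tau>)))"
          by (simp only: powr_add)
        also have "1 + - (1 / (1 - \<tau>)) = - (\<tau> / (1 - \<tau>))"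
          using t by (simp add: field_simps)
        finally show ?thesis .
      qed
      then have "(\<Sum>j\<le>r. (\<Sum>n\<in>level k j. l n powr \<tau>) / ?N j)
          \<le> (\<Sum>j\<le>r. (\<Sum>n\<in>level k j. l n)) + (\<Sum>j\<le>r. ?N j powr (- (\<tau> / (1 - \<tau>))))"
        by (subst sum.distrib[symmetric]) (rule sum_mono)
      also have "(\<Sum>j\<le>r. ?N j powr (- (\<tau> / (1 - \<tau>)))) \<le> T"
        unfolding T_def using summable_card_level[OF k2] t
        by (intro sum_le_suminf) auto
      finally show ?thesis using levels[of r] by linarith
    qed
    then show ?thesis by blast
  qed
  then obtain S where "\<And>r. (\<Sum>j\<le>r. (\<Sum>n\<in>level k j. l n powr \<tau>) / card (level k j)) \<le> S" by blast
  from exists_cheap_path[OF k this] show ?thesis by blast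
qed

section \<open>Bounded distortion and a higher rank Kopell lemma\<close>

text \<open>
Up to the factor \<open>exp (K * |I| powr \<tau>)\<close>, the map stretches all subintervals of \<open>I = {p..q}\<close> by the
same amount. Stated with difference quotients multiplied out, the property composes along a path
without any mention of derivatives.
\<close>

definition distortion_bound :: "real \<Rightarrow> real \<Rightarrow> (real \<Rightarrow> real) \<Rightarrow> bool" where
  "distortion_bound \<tau> K f \<longleftrightarrow> (\<forall>p q u u' v v'.
     0 \<le> p \<and> q \<le> 1 \<and> p \<le> u \<and> u \<le> u' \<and> u' \<le> q \<and> p \<le> v \<and> v \<le> v' \<and> v' \<le> q \<longrightarrow>
     (f u' - f u) * (v' - v) \<le> exp (K * (q - p) powr \<tau>) * ((f v' - f v) * (u' - u)))"

definition bounded_distortion :: "real \<Rightarrow> (real \<Rightarrow> real) \<Rightarrow> bool" where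
  "bounded_distortion \<tau> f \<longleftrightarrow> (\<exists>K\<ge>0. distortion_bound \<tau> K f)"

lemma distortion_boundD:
  assumes "distortion_bound \<tau> K f" "0 \<le> p" "q \<le> 1" "p \<le> u" "u \<le> u'" "u' \<le> q" "p \<le> v" "v \<le> v'" "v' \<le> q"
  shows "(f u' - f u) * (v' - v) \<le> exp (K * (q - p) powr \<tau>) * ((f v' - f v) * (u' - u))"
  using assms unfolding distortion_bound_def by blast

lemma derivative_within_subinterval_MVT:
  fixes f f' :: "real \<Rightarrow> real"
  assumes f: "\<And>x. x \<in> {0..1} \<Longrightarrow> (f has_real_derivative f' x) (at x within {0..1})"
    and "0 \<le> u" "u \<le> v" "v \<le> 1"
  obtains \<xi> where "u \<le> \<xi>" "\<xi> \<le> v" "f v - f u = f' \<xi> * (v - u)"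
proof (cases "u = v")
  case True
  then show ?thesis using that[of u] by simp
next
  case False
  with assms have uv: "u < v" by simp
  have "\<exists>x\<in>{u<..<v}. f v - f u = (\<lambda>y. y * f' x) (v - u)"
  proof (rule mvt_simple[OF uv])
    fix x assume "u \<le> x" "x \<le> v"
    then have "(f has_real_derivative f' x) (at x within {u..v})"
      using assms by (intro DERIV_subset[OF f]) auto
    then show "(f has_derivative (\<lambda>y. y * f' x)) (at x within {u..v})"
      by (simp add: has_field_derivative_def mult_commute_abs)
  qed
  then obtain x where "u < x" "x < v" "f v - f u = (v - u) * f' x" by auto
  then show ?thesis using that[of x] by (simp add: mult.commute)
qed

text \<open>
By the mean value theorem the stretching factors are two values of the derivative, which is bounded
away from \<open>0\<close>; their quotient is at most \<open>1 + C * |I| powr \<tau>\<close> and thus at most the exponential.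
\<close>

lemma bounded_distortion_of_Holder_derivative:
  fixes f f' :: "real \<Rightarrow> real"
  assumes f: "\<And>x. x \<in> {0..1} \<Longrightarrow> (f has_real_derivative f' x) (at x within {0..1})"
    and cont: "continuous_on {0..1} f'"
    and pos: "\<And>x. x \<in> {0..1} \<Longrightarrow> f' x > 0"
    and holder: "\<And>x y. x \<in> {0..1} \<Longrightarrow> y \<in> {0..1} \<Longrightarrow> \<bar>f' x - f' y\<bar> \<le> C * \<bar>x - y\<bar> powr \<tau>"
    and \<tau>: "\<tau> > 0"
  shows "bounded_distortion \<tau> f"
proof -
  obtain x0 where x0: "x0 \<in> {0..1}" "\<And>x. x \<in> {0..1} \<Longrightarrow> f' x0 \<le> f' x"
    using continuous_attains_inf[OF compact_Icc _ cont] by auto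
  have m: "f' x0 > 0" using pos x0 by auto
  have C: "C \<ge> 0" using holder[of 0 1] by simp
  show ?thesis unfolding bounded_distortion_def distortion_bound_def
  proof (intro exI[of _ "C / f' x0"] conjI allI impI; (elim conjE)?)
    show "C / f' x0 \<ge> 0" using C m by simp
    fix p q u u' v v' :: real
    assume *: "0 \<le> p" "q \<le> 1" "p \<le> u" "u \<le> u'" "u' \<le> q" "p \<le> v" "v \<le> v'" "v' \<le> q"
    obtain \<xi> where \<xi>: "u \<le> \<xi>" "\<xi> \<le> u'" "f u' - f u = f' \<xi> * (u' - u)"
      using derivative_within_subinterval_MVT[OF f, of u u'] * by (metis order_trans)
    obtain \<eta> where \<eta>: "v \<le> \<eta>" "\<eta> \<le> v'" "f v' - f v = f' \<eta> * (v' - v)"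
      using derivative_within_subinterval_MVT[OF f, of v v'] * by (metis order_trans)
    have "f' \<xi> - f' \<eta> \<le> C * \<bar>\<xi> - \<eta>\<bar> powr \<tau>"
      using holder[of \<xi> \<eta>] * \<xi> \<eta> by auto
    also have "\<dots> \<le> C * (q - p) powr \<tau>"
      using * \<xi> \<eta> C \<tau> by (intro mult_left_mono powr_mono2) auto
    also have "\<dots> = (C / f' x0 * (q - p) powr \<tau>) * f' x0" using m by simp
    also have "\<dots> \<le> (C / f' x0 * (q - p) powr \<tau>) * f' \<eta>"
      using * \<eta> m C by (intro mult_left_mono x0) auto
    finally have "f' \<xi> \<le> (1 + C / f' x0 * (q - p) powr \<tau>) * f' \<eta>"
      by (simp add: algebra_simps)
    also have "\<dots> \<le> exp (C / f' x0 * (q - p) powr \<tau>) * f' \<eta>"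
      using * \<eta> pos[of \<eta>] by (intro mult_right_mono exp_ge_add_one_self) auto
    finally have "f' \<xi> * ((u' - u) * (v' - v)) \<le> exp (C / f' x0 * (q - p) powr \<tau>) * f' \<eta> * ((u' - u) * (v' - v))"
      using * by (intro mult_right_mono) auto
    then show "(f u' - f u) * (v' - v) \<le> exp (C / f' x0 * (q - p) powr \<tau>) * ((f v' - f v) * (u' - u))"
      by (simp only: \<xi> \<eta> mult_ac)
  qed
qed

lemma sum_disjoint_intervals_le_1:
  fixes A B :: "'a \<Rightarrow> real"
  assumes "finite F" and AB: "\<And>n. n \<in> F \<Longrightarrow> 0 \<le> A n \<and> A n \<le> B n \<and> B n \<le> 1"
    and disj: "\<And>n n'. n \<in> F \<Longrightarrow> n' \<in> F \<Longrightarrow> n \<noteq> n' \<Longrightarrow> {A n<..<B n} \<inter> {A n'<..<B n'} = {}"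
  shows "(\<Sum>n\<in>F. B n - A n) \<le> 1"
proof -
  have "(\<Sum>n\<in>F. B n - A n) = (\<Sum>n\<in>F. measure lborel {A n<..<B n})"
    using AB by (intro sum.cong) auto
  also have "\<dots> = measure lborel (\<Union>n\<in>F. {A n<..<B n})"
    using \<open>finite F\<close> AB disj
    by (intro measure_finite_Union[symmetric])
       (auto simp: disjoint_family_on_def emeasure_lborel_Ioo)
  also have "\<dots> \<le> measure lborel {0..1::real}"
  proof (rule measure_mono_fmeasurable)
    show "(\<Union>n\<in>F. {A n<..<B n}) \<subseteq> {0..1}"
    proof (rule UN_least)
      fix n assume "n \<in> F"
      with AB[of n] show "{A n<..<B n} \<subseteq> {0..1}" by auto
    qed
    show "(\<Union>n\<in>F. {A n<..<B n}) \<in> sets lborel" using \<open>finite F\<close> by (intro sets.finite_UN) auto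
    show "{0..1::real} \<in> fmeasurable lborel" by (simp add: fmeasurable_def)
  qed
  also have "\<dots> = 1" by simp
  finally show ?thesis .
qed

text \<open>
The maps \<open>f i\<close> commute in effect, since \<open>g n\<close> is their monomial with exponents \<open>n\<close>, and \<open>c m\<close> plays the
role of the \<open>m\<close>-th power of a map commuting with all of them. The key estimate is \<open>uniform\<close> in the
proof: for every \<open>y\<close> in \<open>{a<..<b}\<close> and all \<open>m\<close>, the distance from \<open>a\<close> to \<open>c m y\<close> is at most a fixed
multiple of the distance from \<open>a\<close> to \<open>y\<close>. Letting \<open>y\<close> tend to \<open>a\<close> contradicts the convergence of
\<open>c m y\<close> to \<open>b\<close>.
\<close>

theorem generalized_Kopell:
  fixes f c :: "nat \<Rightarrow> real \<Rightarrow> real" and g :: "(nat \<Rightarrow> nat) \<Rightarrow> real \<Rightarrow> real" and a b :: real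
  assumes k: "k \<ge> 1" and \<tau>: "1 / real k < \<tau> \<and> \<tau> < 1 \<or> k = 1 \<and> \<tau> = 1"
    and f: "\<And>i. i < k \<Longrightarrow> bounded_distortion \<tau> (f i)"
    and c: "\<And>m. bounded_distortion \<tau> (c m)"
    and g0: "\<And>x. x \<in> {0..1} \<Longrightarrow> g (\<lambda>_. 0) x = x"
    and gf: "\<And>n i x. n \<in> orthant k \<Longrightarrow> i < k \<Longrightarrow> x \<in> {0..1} \<Longrightarrow> g (step n i) x = f i (g n x)"
    and g01: "\<And>n x. n \<in> orthant k \<Longrightarrow> x \<in> {0..1} \<Longrightarrow> g n x \<in> {0..1}"
    and gmono: "\<And>n. n \<in> orthant k \<Longrightarrow> strict_mono_on {0..1} (g n)"
    and gc: "\<And>n m x. n \<in> orthant k \<Longrightarrow> x \<in> {0..1} \<Longrightarrow> c m (g n x) = g n (c m x)"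
    and ab: "0 \<le> a" "a < b" "b \<le> 1"
    and fixed: "\<And>m. c m a = a" "\<And>m. c m b = b"
    and inside: "\<And>m y. a < y \<Longrightarrow> y < b \<Longrightarrow> a \<le> c m y \<and> c m y \<le> b"
    and attract: "\<And>y. a < y \<Longrightarrow> y < b \<Longrightarrow> (\<lambda>m. c m y) \<longlonglongrightarrow> b"
    and disj: "\<And>n n'. n \<in> orthant k \<Longrightarrow> n' \<in> orthant k \<Longrightarrow> n \<noteq> n' \<Longrightarrow>
       {g n a<..<g n b} \<inter> {g n' a<..<g n' b} = {}"
  shows False
proof -
  define l where "l n = g n b - g n a" for n
  have lpos: "l n > 0" if "n \<in> orthant k" for n
    using strict_mono_onD[OF gmono[OF that], of a b] ab by (auto simp: l_def)
  have \<tau>0: "\<tau> > 0" using \<tau> k by (smt (verit) divide_nonneg_nonneg of_nat_0_le_iff)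
  obtain Kf where Kf: "\<And>i. i < k \<Longrightarrow> Kf i \<ge> 0" "\<And>i. i < k \<Longrightarrow> distortion_bound \<tau> (Kf i) (f i)"
    using f unfolding bounded_distortion_def by metis
  define K where "K = (\<Sum>i<k. Kf i)"
  have KfK: "Kf i \<le> K" if "i < k" for i
    unfolding K_def using that Kf by (intro member_le_sum) auto
  have K0: "K \<ge> 0" unfolding K_def using Kf by (intro sum_nonneg) auto
  have lsum: "sum l F \<le> 1" if "finite F" "F \<subseteq> orthant k" for F
    unfolding l_def
  proof (rule sum_disjoint_intervals_le_1[OF that(1)])
    fix n assume "n \<in> F"
    with that have n: "n \<in> orthant k" by auto
    show "0 \<le> g n a \<and> g n a \<le> g n b \<and> g n b \<le> 1"
      using g01[OF n, of a] g01[OF n, of b] ab lpos[OF n] by (auto simp: l_def)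
  qed (use that disj in blast)
  have "\<exists>S. \<forall>r. \<exists>\<nu> \<iota>. \<nu> 0 = (\<lambda>_. 0) \<and> (\<forall>j<r. \<iota> j < k \<and> \<nu> (Suc j) = step (\<nu> j) (\<iota> j))
     \<and> (\<Sum>j\<le>r. l (\<nu> j) powr \<tau>) \<le> S"
    by (rule cheap_orthant_paths[OF k \<tau> less_imp_le[OF lpos] lsum])
  then obtain S where S: "\<And>r. \<exists>\<nu> \<iota>. \<nu> 0 = (\<lambda>_. 0) \<and> (\<forall>j<r. \<iota> j < k \<and> \<nu> (Suc j) = step (\<nu> j) (\<iota> j))
     \<and> (\<Sum>j\<le>r. l (\<nu> j) powr \<tau>) \<le> S"
    by blast
  \<comment> \<open>The constant is independent of \<open>m\<close>: the path contributes \<open>exp (K * S)\<close>, and on its last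
    interval \<open>c m\<close> has distortion at most \<open>exp 1\<close>.\<close>
  have uniform: "v - a \<le> exp (K * S) * exp 1 * (y - a)" if y: "a < y" "y < b" and v: "v = c m y" for v y m
  proof -
    obtain Km where Km: "Km \<ge> 0" "distortion_bound \<tau> Km (c m)"
      using c[of m] unfolding bounded_distortion_def by blast
    \<comment> \<open>Among \<open>r + 1\<close> disjoint intervals one has length at most \<open>1 / (r + 1)\<close>; on it the distortion of
      \<open>c m\<close> is controlled if \<open>r\<close> is large.\<close>
    have "(\<lambda>r. Km * inverse (real (Suc r)) powr \<tau>) \<longlonglongrightarrow> Km * 0 powr \<tau>"
      using \<tau>0 by (intro tendsto_intros LIMSEQ_inverse_real_of_nat tendsto_powr') auto
    then have "\<forall>\<^sub>F r in sequentially. Km * inverse (real (Suc r)) powr \<tau> < 1"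
      using \<tau>0 by (intro order_tendstoD(2)[of _ 0]) auto
    then obtain r where r: "Km * inverse (real (Suc r)) powr \<tau> < 1"
      by (auto simp: eventually_sequentially)
    obtain \<nu> \<iota> where \<nu>: "\<nu> 0 = (\<lambda>_. 0)" "\<And>j. j < r \<Longrightarrow> \<iota> j < k"
      "\<And>j. j < r \<Longrightarrow> \<nu> (Suc j) = step (\<nu> j) (\<iota> j)" "(\<Sum>j\<le>r. l (\<nu> j) powr \<tau>) \<le> S"
      using S[of r] by blast
    have lev: "\<nu> j \<in> level k j" if "j \<le> r" for j
      using that by (induction j) (auto simp: \<nu> level_0 intro: step_level)
    then have orth: "\<nu> j \<in> orthant k" if "j \<le> r" for j
      using that level_orthant by blast
    have inj: "inj_on \<nu> {..r}"
    proof (rule inj_onI)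
      fix i j assume "i \<in> {..r}" "j \<in> {..r}" "\<nu> i = \<nu> j"
      then show "i = j" using lev[of i] lev[of j] by (auto simp: level_def)
    qed
    have "\<exists>j\<le>r. l (\<nu> j) \<le> inverse (real (Suc r))"
    proof (rule ccontr)
      assume "\<not> ?thesis"
      then have "(\<Sum>j\<le>r. inverse (real (Suc r))) < (\<Sum>j\<le>r. l (\<nu> j))"
        by (intro sum_strict_mono) auto
      also have "\<dots> = sum l (\<nu> ` {..r})" using inj by (simp add: sum.reindex)
      also have "\<dots> \<le> 1" using orth by (intro lsum) auto
      finally show False by simp
    qed
    then obtain j where j: "j \<le> r" "l (\<nu> j) \<le> inverse (real (Suc r))" by blast
    have vb: "a \<le> v" "v \<le> b" using inside[OF y] v by auto
    \<comment> \<open>The stretching factors of \<open>{a..v}\<close> and \<open>{a..y}\<close> are comparable along the path.\<close>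
    have chain: "(v - a) * (g (\<nu> i) y - g (\<nu> i) a)
       \<le> exp (K * (\<Sum>h<i. l (\<nu> h) powr \<tau>)) * ((g (\<nu> i) v - g (\<nu> i) a) * (y - a))" if "i \<le> j" for i
      using that
    proof (induction i)
      case 0
      then show ?case using y vb ab by (simp add: \<nu> g0)
    next
      case (Suc i)
      then have i: "i < r" "i \<le> r" "\<nu> i \<in> orthant k" "\<iota> i < k" using j orth \<nu> by auto
      have mono: "g (\<nu> i) s \<le> g (\<nu> i) t" if "a \<le> s" "s \<le> t" "t \<le> b" for s t
        using strict_mono_onD[OF gmono[OF i(3)], of s t] that ab by (cases "s = t") auto
      have lower: "0 \<le> g (\<nu> i) a" "g (\<nu> i) b \<le> 1" using g01[OF i(3)] ab by auto
      have step: "g (\<nu> (Suc i)) x = f (\<iota> i) (g (\<nu> i) x)" if "a \<le> x" "x \<le> b" for x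
        using that ab i by (subst \<nu>(3)) (auto intro: gf)
      let ?G = "g (\<nu> i)" and ?H = "g (\<nu> (Suc i))"
      have d: "(?H y - ?H a) * (?G v - ?G a)
        \<le> exp (Kf (\<iota> i) * (l (\<nu> i)) powr \<tau>) * ((?H v - ?H a) * (?G y - ?G a))"
        using distortion_boundD[OF Kf(2)[OF i(4)] lower, of "?G a" "?G y" "?G a" "?G v"] mono y vb ab
        by (simp add: step l_def)
      have "strict_mono_on {0..1} ?H" using j Suc orth by (intro gmono) auto
      then have Hmono: "?H a \<le> ?H v" "?H a \<le> ?H y" "?H a < ?H y"
        using strict_mono_onD[of "{0..1}" ?H a v] strict_mono_onD[of "{0..1}" ?H a y] y vb ab
        by (cases "a = v"; force)+
      have Gpos: "?G y - ?G a > 0"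
        using strict_mono_onD[OF gmono[OF i(3)], of a y] y ab by auto
      have e: "exp (Kf (\<iota> i) * (l (\<nu> i)) powr \<tau>) \<le> exp (K * l (\<nu> i) powr \<tau>)"
        using KfK[OF i(4)] by (simp add: mult_right_mono)
      let ?E = "exp (K * (\<Sum>h<i. l (\<nu> h) powr \<tau>))"
      have IH: "(v - a) * (?G y - ?G a) \<le> ?E * ((?G v - ?G a) * (y - a))"
        using Suc by simp
      have "((v - a) * (?H y - ?H a)) * (?G y - ?G a) = ((v - a) * (?G y - ?G a)) * (?H y - ?H a)"
        by (simp only: mult_ac)
      also have "\<dots> \<le> (?E * ((?G v - ?G a) * (y - a))) * (?H y - ?H a)"
        using Hmono by (intro mult_right_mono IH) auto
      also have "\<dots> = (?E * (y - a)) * ((?H y - ?H a) * (?G v - ?G a))"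
        by (simp only: mult_ac)
      also have "\<dots> \<le> (?E * (y - a)) * (exp (Kf (\<iota> i) * (l (\<nu> i)) powr \<tau>) * ((?H v - ?H a) * (?G y - ?G a)))"
        using y by (intro mult_left_mono d) auto
      also have "\<dots> \<le> (?E * (y - a)) * (exp (K * l (\<nu> i) powr \<tau>) * ((?H v - ?H a) * (?G y - ?G a)))"
        using y Hmono Gpos by (intro mult_left_mono mult_right_mono e) auto
      also have "\<dots> = (exp (K * (\<Sum>h<Suc i. l (\<nu> h) powr \<tau>)) * ((?H v - ?H a) * (y - a))) * (?G y - ?G a)"
        by (simp add: distrib_left exp_add)
      finally show ?case using Gpos by (simp only: mult_le_cancel_right_pos)
    qed
    have oj: "\<nu> j \<in> orthant k" using orth j by simp
    let ?A = "g (\<nu> j) a" and ?B = "g (\<nu> j) b" and ?Y = "g (\<nu> j) y" and ?V = "g (\<nu> j) v"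
    have AB: "?A < ?B" "?A < ?Y" "?Y < ?B" "0 \<le> ?A" "?B \<le> 1"
      using strict_mono_onD[OF gmono[OF oj]] g01[OF oj] y ab by auto
    have cm: "c m ?A = ?A" "c m ?B = ?B" "c m ?Y = ?V"
      using gc[OF oj] fixed v y ab by auto
    have "(c m ?Y - c m ?A) * (?B - ?A) \<le> exp (Km * (?B - ?A) powr \<tau>) * ((c m ?B - c m ?A) * (?Y - ?A))"
      using AB by (intro distortion_boundD[OF Km(2)]) auto
    then have "(?V - ?A) * (?B - ?A) \<le> exp (Km * l (\<nu> j) powr \<tau>) * (?Y - ?A) * (?B - ?A)"
      by (simp add: cm l_def mult_ac)
    then have "?V - ?A \<le> exp (Km * l (\<nu> j) powr \<tau>) * (?Y - ?A)"
      using AB by (simp add: mult_le_cancel_right_pos)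
    also have "\<dots> \<le> exp 1 * (?Y - ?A)"
    proof -
      have "Km * l (\<nu> j) powr \<tau> \<le> Km * inverse (real (Suc r)) powr \<tau>"
        using j Km(1) \<tau>0 lpos[OF oj] by (intro mult_left_mono powr_mono2) auto
      with r AB show ?thesis by (intro mult_right_mono) auto
    qed
    finally have V: "?V - ?A \<le> exp 1 * (?Y - ?A)" .
    have "(\<Sum>h<j. l (\<nu> h) powr \<tau>) \<le> (\<Sum>h\<le>r. l (\<nu> h) powr \<tau>)"
      using j by (intro sum_mono2) auto
    also note \<nu>(4)
    finally have SS: "exp (K * (\<Sum>h<j. l (\<nu> h) powr \<tau>)) \<le> exp (K * S)"
      using K0 by (simp add: mult_left_mono)
    have "(v - a) * (?Y - ?A) \<le> exp (K * (\<Sum>h<j. l (\<nu> h) powr \<tau>)) * ((?V - ?A) * (y - a))"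
      by (rule chain) simp
    also have "\<dots> \<le> exp (K * (\<Sum>h<j. l (\<nu> h) powr \<tau>)) * ((exp 1 * (?Y - ?A)) * (y - a))"
      using y by (intro mult_left_mono mult_right_mono V) auto
    also have "\<dots> \<le> exp (K * S) * ((exp 1 * (?Y - ?A)) * (y - a))"
      using y AB by (intro mult_right_mono SS) auto
    also have "\<dots> = (exp (K * S) * exp 1 * (y - a)) * (?Y - ?A)"
      by (simp only: mult_ac)
    finally show ?thesis using AB by (simp only: mult_le_cancel_right_pos diff_gt_0_iff_gt)
  qed
  define E where "E = exp (K * S) * exp 1"
  have E: "E > 0" by (simp add: E_def)
  \<comment> \<open>A point so close to \<open>a\<close> that the uniform bound keeps its whole orbit away from \<open>b\<close>.\<close>
  define y where "y = a + min ((b - a) / 2) ((b - a) / (2 * E))"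
  have y: "a < y" "y < b" "E * (y - a) < b - a"
  proof -
    show "a < y" using ab E by (simp add: y_def)
    have "y \<le> a + (b - a) / 2"
      unfolding y_def by (intro add_left_mono min.cobounded1)
    then show "y < b" using ab by (simp add: field_simps)
    have "y - a \<le> (b - a) / (2 * E)" by (simp add: y_def)
    then have "E * (y - a) \<le> E * ((b - a) / (2 * E))" using E by (intro mult_left_mono) auto
    also have "\<dots> = (b - a) / 2" using E by simp
    also have "\<dots> < b - a" using ab by simp
    finally show "E * (y - a) < b - a" .
  qed
  have "b \<le> a + E * (y - a)"
  proof (rule LIMSEQ_le_const2[OF attract[OF y(1,2)]], intro exI allI impI)
    fix m show "c m y \<le> a + E * (y - a)" using uniform[OF y(1,2) refl, of m] by (simp add: E_def)
  qed
  with y(3) show False by simp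
qed

section \<open>Derivatives of diffeomorphisms of the interval\<close>

lemma Diff_plus_carrier:
  "f \<in> carrier (Diff_plus n \<alpha>) \<longleftrightarrow> f \<in> Bij {0..1} \<and> strict_mono_on {0..1} f \<and>
     C_on_unit n f \<and> C_on_unit n (inv_into {0..1} f) \<and> holder_on_unit \<alpha> (unit_deriv n f)"
  by (simp add: Diff_plus_def)

lemma Diff_plus_mult:
  assumes "g \<in> carrier (Diff_plus n \<alpha>)" "f \<in> carrier (Diff_plus n \<alpha>)" "x \<in> {0..1}"
  shows "(g \<otimes>\<^bsub>Diff_plus n \<alpha>\<^esub> f) x = g (f x)"
  using assms by (simp add: Diff_plus_def BijGroup_def compose_def)

lemma unit_bij_endpoints:
  fixes f :: "real \<Rightarrow> real"
  assumes "f \<in> Bij {0..1}" "strict_mono_on {0..1} f"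
  shows "f ` {0..1} = {0..1}" "f 0 = 0" "f 1 = 1"
proof -
  show im: "f ` {0..1} = {0..1}"
    using assms by (auto simp: Bij_def bij_betw_def)
  have mono: "f x \<le> f y" if "x \<in> {0..1}" "y \<in> {0..1}" "x \<le> y" for x y
    using strict_mono_onD[OF assms(2), of x y] that by (cases "x = y") auto
  have in_unit: "f x \<in> {0..1}" if "x \<in> {0..1}" for x
    using im that by blast
  have "0 \<in> f ` {0..1}" "1 \<in> f ` {0..1}" by (simp_all add: im)
  then obtain x y where "x \<in> {0..1}" "f x = 0" "y \<in> {0..1}" "f y = 1"
    unfolding image_iff by metis
  with mono[of 0 x] mono[of y 1] in_unit[of 0] in_unit[of 1] show "f 0 = 0" "f 1 = 1"
    by auto
qed

lemma at_within_unit_nontrivial: "x \<in> {0..1} \<Longrightarrow> at x within {0..1::real} \<noteq> bot"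
  by (simp add: trivial_limit_within islimpt_Icc)

lemma C_on_unit_has_deriv:
  assumes "C_on_unit n f" "i < n" "x \<in> {0..1}"
  shows "(unit_deriv i f has_real_derivative unit_deriv (Suc i) f x) (at x within {0..1})"
proof -
  have "unit_deriv i f differentiable (at x within {0..1})"
    using assms by (auto simp: C_on_unit_def differentiable_on_def)
  then show ?thesis
    by (simp add: vector_derivative_works has_real_derivative_iff_has_vector_derivative)
qed

lemma C_on_unit_continuous:
  assumes "C_on_unit n f" "i \<le> n"
  shows "continuous_on {0..1} (unit_deriv i f)"
  using assms by (cases "i = n") (auto simp: C_on_unit_def intro: differentiable_imp_continuous_on)

text \<open>
The derivative is nonnegative by monotonicity and has an inverse, the derivative of the inverse map.
\<close>

lemma Diff_plus_deriv_pos: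
  assumes f: "f \<in> carrier (Diff_plus n \<alpha>)" and n: "n \<ge> 1" and x: "x \<in> {0..1}"
  shows "unit_deriv 1 f x > 0"
proof -
  note F = f[unfolded Diff_plus_carrier]
  let ?g = "inv_into {0..1} f"
  have im: "f ` {0..1} = {0..1}" using F unit_bij_endpoints by blast
  have inj: "inj_on f {0..1}" using F by (auto simp: Bij_def bij_betw_def)
  have df: "(f has_real_derivative unit_deriv 1 f x) (at x within {0..1})"
    using C_on_unit_has_deriv[of n f 0 x] F n x by simp
  have dg: "(?g has_real_derivative unit_deriv 1 ?g (f x)) (at (f x) within f ` {0..1})"
    using C_on_unit_has_deriv[of n ?g 0 "f x"] F n imageI[OF x, of f] unfolding im by simp
  have "(?g \<circ> f has_real_derivative unit_deriv 1 ?g (f x) * unit_deriv 1 f x) (at x within {0..1})"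
    using dg df by (rule DERIV_image_chain)
  moreover have "((\<lambda>y. y) has_real_derivative 1) (at x within {0..1})" by simp
  then have "(?g \<circ> f has_real_derivative 1) (at x within {0..1})"
    by (rule has_field_derivative_transform_within[where d = 1]) (use x inj in auto)
  ultimately have prod: "unit_deriv 1 ?g (f x) * unit_deriv 1 f x = 1"
    using has_field_derivative_unique[OF _ _ at_within_unit_nontrivial[OF x]] by blast
  have lim: "((\<lambda>y. (f y - f x) / (y - x)) \<longlongrightarrow> unit_deriv 1 f x) (at x within {0..1})"
    using df by (simp add: has_field_derivative_iff)
  have "0 \<le> unit_deriv 1 f x"
  proof (rule tendsto_lowerbound[OF lim _ at_within_unit_nontrivial[OF x]])
    have "0 \<le> (f y - f x) / (y - x)" if "y \<in> {0..1}" "y \<noteq> x" for y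
      using strict_mono_onD[of "{0..1}" f x y] strict_mono_onD[of "{0..1}" f y x] F that x
      by (cases "x < y") (auto intro!: divide_nonneg_nonneg divide_nonpos_nonpos)
    then show "\<forall>\<^sub>F y in at x within {0..1}. 0 \<le> (f y - f x) / (y - x)"
      by (auto simp: eventually_at_filter)
  qed
  moreover have "unit_deriv 1 f x \<noteq> 0" using prod by (metis mult_zero_right zero_neq_one)
  ultimately show ?thesis by (metis order_le_less)
qed

text \<open>
If there is a continuous second derivative, the first derivative is Lipschitz and hence Hoelder for
every exponent up to \<open>1\<close>.
\<close>

lemma Diff_plus_bounded_distortion:
  assumes f: "f \<in> carrier (Diff_plus n \<alpha>)" and n: "n = 1 \<and> \<tau> = \<alpha> \<or> n \<ge> 2 \<and> \<tau> \<le> 1" and \<tau>: "\<tau> > 0"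
  shows "bounded_distortion \<tau> f"
proof -
  note F = f[unfolded Diff_plus_carrier]
  have n1: "n \<ge> 1" using n by auto
  have "\<exists>C. \<forall>x\<in>{0..1}. \<forall>y\<in>{0..1}. \<bar>unit_deriv 1 f x - unit_deriv 1 f y\<bar> \<le> C * \<bar>x - y\<bar> powr \<tau>"
    using n
  proof
    assume "n = 1 \<and> \<tau> = \<alpha>"
    then show ?thesis using F by (auto simp: holder_on_unit_def)
  next
    assume n2: "n \<ge> 2 \<and> \<tau> \<le> 1"
    have "continuous_on {0..1} (\<lambda>x. \<bar>unit_deriv 2 f x\<bar>)"
      using C_on_unit_continuous[of n f 2] F n2 by (intro continuous_intros) auto
    from continuous_attains_sup[OF compact_Icc _ this]
    obtain x0 where x0: "x0 \<in> {0..1}" "\<And>x. x \<in> {0..1} \<Longrightarrow> \<bar>unit_deriv 2 f x\<bar> \<le> \<bar>unit_deriv 2 f x0\<bar>"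
      by auto
    let ?C = "\<bar>unit_deriv 2 f x0\<bar>"
    have d2: "(unit_deriv 1 f has_real_derivative unit_deriv 2 f x) (at x within {0..1})"
      if "x \<in> {0..1}" for x
      using C_on_unit_has_deriv[of n f 1 x] F n2 that by (simp add: numeral_2_eq_2 del: unit_deriv.simps)
    have main: "unit_deriv 1 f y - unit_deriv 1 f x \<le> ?C * (y - x) \<and> unit_deriv 1 f x - unit_deriv 1 f y \<le> ?C * (y - x)"
      if xy: "0 \<le> x" "x \<le> y" "y \<le> 1" for x y
    proof -
      obtain \<xi> where \<xi>: "x \<le> \<xi>" "\<xi> \<le> y" "unit_deriv 1 f y - unit_deriv 1 f x = unit_deriv 2 f \<xi> * (y - x)"
        by (rule derivative_within_subinterval_MVT[OF d2 xy])
      have "\<bar>unit_deriv 2 f \<xi>\<bar> * (y - x) \<le> ?C * (y - x)"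
        using xy \<xi> by (intro mult_right_mono x0) auto
      then have "\<bar>unit_deriv 1 f y - unit_deriv 1 f x\<bar> \<le> ?C * (y - x)"
        using xy by (simp only: \<xi>(3) abs_mult)
      then show ?thesis by (simp add: abs_le_iff)
    qed
    have lip: "\<bar>unit_deriv 1 f x - unit_deriv 1 f y\<bar> \<le> ?C * \<bar>x - y\<bar>" if "x \<in> {0..1}" "y \<in> {0..1}" for x y
    proof (cases "x \<le> y")
      case True
      with main[of x y] that show ?thesis by (simp add: abs_le_iff)
    next
      case False
      with main[of y x] that show ?thesis by (simp add: abs_le_iff)
    qed
    have "\<bar>x - y\<bar> \<le> \<bar>x - y\<bar> powr \<tau>" if "x \<in> {0..1}" "y \<in> {0..1}" for x y :: real
    proof (cases "x = y")
      case False
      have "\<bar>x - y\<bar> powr 1 \<le> \<bar>x - y\<bar> powr \<tau>"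
        using that n2 False by (intro powr_mono') auto
      then show ?thesis using False by simp
    qed simp
    then have powr: "?C * \<bar>x - y\<bar> \<le> ?C * \<bar>x - y\<bar> powr \<tau>" if "x \<in> {0..1}" "y \<in> {0..1}" for x y :: real
      using that by (intro mult_left_mono) auto
    show ?thesis
    proof (intro exI[of _ ?C] ballI)
      fix x y :: real assume "x \<in> {0..1}" "y \<in> {0..1}"
      from order_trans[OF lip[OF this] powr[OF this]]
      show "\<bar>unit_deriv 1 f x - unit_deriv 1 f y\<bar> \<le> ?C * \<bar>x - y\<bar> powr \<tau>" .
    qed
  qed
  then obtain C where "\<forall>x\<in>{0..1}. \<forall>y\<in>{0..1}.
     \<bar>unit_deriv 1 f x - unit_deriv 1 f y\<bar> \<le> C * \<bar>x - y\<bar> powr \<tau>" ..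
  then have C: "\<bar>unit_deriv 1 f x - unit_deriv 1 f y\<bar> \<le> C * \<bar>x - y\<bar> powr \<tau>"
    if "x \<in> {0..1}" "y \<in> {0..1}" for x y
    using that by (simp only: Ball_def)
  show ?thesis
  proof (rule bounded_distortion_of_Holder_derivative[OF _ _ _ C \<tau>])
    show "(f has_real_derivative unit_deriv 1 f x) (at x within {0..1})" if "x \<in> {0..1}" for x
      using C_on_unit_has_deriv[of n f 0 x] F n1 that by simp
    show "continuous_on {0..1} (unit_deriv 1 f)"
      using C_on_unit_continuous[of n f 1] F n1 by simp
  qed (use Diff_plus_deriv_pos[OF f n1] in auto)
qed

lemma Diff_plus_continuous:
  assumes "f \<in> carrier (Diff_plus n \<alpha>)"
  shows "continuous_on {0..1} f"
  using C_on_unit_continuous[of n f 0] assms by (auto simp: Diff_plus_carrier)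

section \<open>Upper bound on the regularity of faithful actions\<close>

text \<open>
The endpoints are the nearest fixed points on the two sides of \<open>x\<close>.
\<close>

lemma moved_component:
  fixes f :: "real \<Rightarrow> real"
  assumes cont: "continuous_on {0..1} f" and f01: "f 0 = 0" "f 1 = 1" and x: "x \<in> {0..1}" "f x \<noteq> x"
  obtains a b where "0 \<le> a" "a < b" "b \<le> 1" "f a = a" "f b = b" "\<forall>y. a < y \<and> y < b \<longrightarrow> f y \<noteq> y"
proof -
  define Fix where "Fix = {y \<in> {0..1}. f y - y = 0}"
  have closed: "closed Fix"
    unfolding Fix_def by (rule continuous_closed_preimage_constant) (auto intro!: continuous_intros cont)
  let ?L = "Fix \<inter> {0..x}" and ?U = "Fix \<inter> {x..1}"
  have L: "closed ?L" "?L \<noteq> {}" "bdd_above ?L" and U: "closed ?U" "?U \<noteq> {}" "bdd_below ?U"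
  proof -
    have "0 \<in> ?L" "1 \<in> ?U" using x f01 by (auto simp: Fix_def)
    then show "?L \<noteq> {}" "?U \<noteq> {}" by blast+
  qed (use closed in auto)
  have a: "Sup ?L \<in> ?L" by (rule closed_contains_Sup[OF L(2,3,1)])
  have b: "Inf ?U \<in> ?U" by (rule closed_contains_Inf[OF U(2,3,1)])
  have "Sup ?L \<noteq> x" "Inf ?U \<noteq> x" using a b x by (auto simp: Fix_def)
  then have ax: "Sup ?L < x" "x < Inf ?U" using a b by auto
  show ?thesis
  proof (rule that[of "Sup ?L" "Inf ?U"])
    show "\<forall>y. Sup ?L < y \<and> y < Inf ?U \<longrightarrow> f y \<noteq> y"
    proof (intro allI impI notI; elim conjE)
      fix y assume y: "Sup ?L < y" "y < Inf ?U"
      assume "f y = y"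
      then have "y \<in> Fix" using y a b by (auto simp: Fix_def)
      then have "y \<in> ?L \<or> y \<in> ?U" using y a b by (auto simp: Fix_def)
      with cSup_upper[OF _ L(3), of y] cInf_lower[OF _ U(3), of y] y show False by linarith
    qed
  qed (use a b ax in \<open>auto simp: Fix_def\<close>)
qed

lemma const_fun_polyfun: "const_fun k c \<in> polyfun k (Suc n)"
  using polyfun_1[of "const_fun k c" k] polyfun_mono[of "const_fun k c" k "Suc 0" "Suc n"] by auto

text \<open>
The linear function with coefficients \<open>n i\<close> at the coordinates in \<open>I\<close>.
\<close>

definition partial_coord :: "nat \<Rightarrow> nat set \<Rightarrow> (nat \<Rightarrow> int) \<Rightarrow> int poly \<Rightarrow> int" where
  "partial_coord k I n w = (if w \<in> grid k then \<Sum>i\<in>I. n i * Polynomial.coeff w i else 0)"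

lemma partial_coord_polyfun:
  assumes "finite I" shows "partial_coord k I n \<in> polyfun k (Suc (Suc m))"
proof -
  have "(\<lambda>w. \<Sum>i\<in>I. n i * power_fun k i 1 w) \<in> polyfun k (Suc (Suc m))"
    by (rule polyfun_sum[OF assms], rule polyfun_scale, rule polyfun_mono[OF power_fun_polyfun]) simp
  also have "(\<lambda>w. \<Sum>i\<in>I. n i * power_fun k i 1 w) = partial_coord k I n"
    by (auto simp: partial_coord_def power_fun_def fun_eq_iff)
  finally show ?thesis .
qed

definition partial_vec :: "nat set \<Rightarrow> (nat \<Rightarrow> int) \<Rightarrow> int poly" where
  "partial_vec S n = (\<Sum>i\<in>S. Polynomial.monom (n i) i)"

lemma coeff_partial_vec: "finite S \<Longrightarrow> Polynomial.coeff (partial_vec S n) j = (if j \<in> S then n j else 0)"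
  by (simp add: partial_vec_def coeff_sum)

lemma partial_vec_grid:
  assumes S: "S \<subseteq> {..<k}" shows "partial_vec S n \<in> grid k"
  unfolding grid_def
proof (intro CollectI allI impI)
  fix i assume "k \<le> i"
  then have "i \<notin> S" using S by auto
  then show "Polynomial.coeff (partial_vec S n) i = 0"
    by (simp add: coeff_partial_vec[OF finite_subset[OF S finite_lessThan]])
qed

locale poly_group_action =
  fixes k d n :: nat and \<alpha> :: real and \<psi> :: "int poly \<times> (int poly \<Rightarrow> int) \<Rightarrow> real \<Rightarrow> real"
  assumes k1: "k \<ge> 1" and d2: "d \<ge> 2"
    and mon: "\<psi> \<in> mon (poly_group k d) (Diff_plus n \<alpha>)"
begin

abbreviation "G \<equiv> poly_group k d"

sublocale group G by (rule group_poly_group)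

lemma psi_Diff: "x \<in> carrier G \<Longrightarrow> \<psi> x \<in> carrier (Diff_plus n \<alpha>)"
  using mon by (auto simp: mon_def hom_def)

lemma psi_mult: "x \<in> carrier G \<Longrightarrow> y \<in> carrier G \<Longrightarrow> t \<in> {0..1} \<Longrightarrow> \<psi> (x \<otimes>\<^bsub>G\<^esub> y) t = \<psi> x (\<psi> y t)"
  using mon Diff_plus_mult[OF psi_Diff psi_Diff] by (auto simp: mon_def hom_def)

lemma psi_inj: "x \<in> carrier G \<Longrightarrow> y \<in> carrier G \<Longrightarrow> \<psi> x = \<psi> y \<Longrightarrow> x = y"
  using mon by (auto simp: mon_def inj_on_def)

lemma psi_Bij: "x \<in> carrier G \<Longrightarrow> \<psi> x \<in> Bij {0..1}" "x \<in> carrier G \<Longrightarrow> strict_mono_on {0..1} (\<psi> x)"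
  using psi_Diff by (auto simp: Diff_plus_carrier)

lemma psi_less: "x \<in> carrier G \<Longrightarrow> s \<in> {0..1} \<Longrightarrow> t \<in> {0..1} \<Longrightarrow> s < t \<Longrightarrow> \<psi> x s < \<psi> x t"
  using strict_mono_onD[OF psi_Bij(2)] by blast

lemma psi_less_iff: "x \<in> carrier G \<Longrightarrow> s \<in> {0..1} \<Longrightarrow> t \<in> {0..1} \<Longrightarrow> \<psi> x s < \<psi> x t \<longleftrightarrow> s < t"
  using psi_less[of x s t] psi_less[of x t s] by (cases s t rule: linorder_cases) auto

lemma psi_eq_iff: "x \<in> carrier G \<Longrightarrow> s \<in> {0..1} \<Longrightarrow> t \<in> {0..1} \<Longrightarrow> \<psi> x s = \<psi> x t \<longleftrightarrow> s = t"
  using psi_less[of x s t] psi_less[of x t s] by (cases s t rule: linorder_cases) auto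

lemma psi_unit: "x \<in> carrier G \<Longrightarrow> t \<in> {0..1} \<Longrightarrow> \<psi> x t \<in> {0..1}"
  using unit_bij_endpoints(1)[OF psi_Bij] by blast

lemma psi_continuous: "x \<in> carrier G \<Longrightarrow> continuous_on {0..1} (\<psi> x)"
  using Diff_plus_continuous[OF psi_Diff] .

lemma psi_one: "t \<in> {0..1} \<Longrightarrow> \<psi> \<one>\<^bsub>G\<^esub> t = t"
  using psi_mult[of "\<one>\<^bsub>G\<^esub>" "\<one>\<^bsub>G\<^esub>" t] psi_eq_iff[of "\<one>\<^bsub>G\<^esub>" "\<psi> \<one>\<^bsub>G\<^esub> t" t] psi_unit[of "\<one>\<^bsub>G\<^esub>" t]
  by (simp del: poly_group_simps(3))

lemma psi_inv: "x \<in> carrier G \<Longrightarrow> t \<in> {0..1} \<Longrightarrow> \<psi> x (\<psi> (inv\<^bsub>G\<^esub> x) t) = t"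
  "x \<in> carrier G \<Longrightarrow> t \<in> {0..1} \<Longrightarrow> \<psi> (inv\<^bsub>G\<^esub> x) (\<psi> x t) = t"
  using psi_mult[of x "inv\<^bsub>G\<^esub> x" t] psi_mult[of "inv\<^bsub>G\<^esub> x" x t] psi_one[of t]
  by (simp_all del: poly_group_simps)

definition C :: "int \<Rightarrow> int poly \<times> (int poly \<Rightarrow> int)" where
  "C m = (0, const_fun k m)"

lemma C_carrier [simp]: "C m \<in> carrier G"
proof -
  obtain e where "d = Suc e" using d2 by (cases d) auto
  then show ?thesis by (simp add: C_def const_fun_polyfun)
qed

lemma C_mult: "C m \<otimes>\<^bsub>G\<^esub> C m' = C (m + m')"
  by (auto simp: C_def const_fun_def fun_eq_iff)

lemma C_0: "C 0 = \<one>\<^bsub>G\<^esub>"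
  by (auto simp: C_def const_fun_def)

lemma C_central: "x \<in> carrier G \<Longrightarrow> C m \<otimes>\<^bsub>G\<^esub> x = x \<otimes>\<^bsub>G\<^esub> C m"
  by (cases x) (auto simp: C_def const_fun_def fun_eq_iff)

lemma psi_C_commute: "x \<in> carrier G \<Longrightarrow> t \<in> {0..1} \<Longrightarrow> \<psi> (C m) (\<psi> x t) = \<psi> x (\<psi> (C m) t)"
  using psi_mult[of "C m" x t] psi_mult[of x "C m" t] by (simp add: C_central)

lemma psi_C_add: "t \<in> {0..1} \<Longrightarrow> \<psi> (C m) (\<psi> (C m') t) = \<psi> (C (m + m')) t"
  using psi_mult[of "C m" "C m'" t] by (simp add: C_mult)

lemma psi_C_0: "t \<in> {0..1} \<Longrightarrow> \<psi> (C 0) t = t"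
  by (simp add: C_0 psi_one del: poly_group_simps)

text \<open>
The sign \<open>\<sigma>\<close> is chosen such that the constant \<open>\<sigma>\<close> moves the points of the component up.
\<close>

lemma central_component:
  obtains a b \<sigma> where "0 \<le> a" "a < b" "b \<le> 1" "\<sigma> = 1 \<or> \<sigma> = -1"
    "\<forall>m. \<psi> (C m) a = a \<and> \<psi> (C m) b = b"
    "\<forall>y. a < y \<and> y < b \<longrightarrow> y < \<psi> (C \<sigma>) y"
proof -
  have "const_fun k 1 0 \<noteq> const_fun k 0 0" by (simp add: const_fun_def)
  then have "const_fun k 1 \<noteq> const_fun k 0" by metis
  then have "C 1 \<noteq> C 0" unfolding C_def by simp
  then have "\<psi> (C 1) \<noteq> \<psi> (C 0)" using psi_inj[OF C_carrier C_carrier] by (rule contrapos_nn)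
  note neq = this
  have ext: "\<psi> (C m) \<in> extensional {0..1}" for m
    using psi_Bij(1)[of "C m"] by (simp add: Bij_def)
  have "\<exists>x\<in>{0..1}. \<psi> (C 1) x \<noteq> \<psi> (C 0) x"
  proof (rule ccontr)
    assume "\<not> ?thesis"
    then have "\<psi> (C 1) = \<psi> (C 0)" by (intro extensionalityI[OF ext ext]) simp
    with neq show False by simp
  qed
  then obtain x where x0: "x \<in> {0..1}" "\<psi> (C 1) x \<noteq> \<psi> (C 0) x" ..
  have x: "x \<in> {0..1}" "\<psi> (C 1) x \<noteq> x" using x0 psi_C_0[OF x0(1)] by metis+
  note ends = unit_bij_endpoints(2,3)[OF psi_Bij(1)[OF C_carrier] psi_Bij(2)[OF C_carrier]]
  obtain a b where ab: "0 \<le> a" "a < b" "b \<le> 1" "\<psi> (C 1) a = a" "\<psi> (C 1) b = b"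
    and free: "\<forall>y. a < y \<and> y < b \<longrightarrow> \<psi> (C 1) y \<noteq> y"
    by (rule moved_component[OF psi_continuous[OF C_carrier] ends x])
  have fixed: "\<psi> (C m) e = e" if "\<psi> (C 1) e = e" "e \<in> {0..1}" for e m
  proof (induction m rule: int_induct[where k = 0])
    case base
    show ?case by (rule psi_C_0[OF that(2)])
  next
    case (step1 i)
    then show ?case using psi_C_add[OF that(2), of 1 i] that(1) by (simp add: add.commute)
  next
    case (step2 i)
    then show ?case using psi_C_add[OF that(2), of "i - 1" 1] that(1) by simp
  qed
  have fa: "\<psi> (C m) a = a" and fb: "\<psi> (C m) b = b" for m
    using fixed[OF ab(4), of m] fixed[OF ab(5), of m] ab(1-3) by auto
  have up_or_down: "(\<forall>y. a < y \<and> y < b \<longrightarrow> y < \<psi> (C 1) y) \<or> (\<forall>y. a < y \<and> y < b \<longrightarrow> \<psi> (C 1) y < y)"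
  proof (rule ccontr)
    assume "\<not> ?thesis"
    then obtain y y' where y: "a < y" "y < b" "\<not> y < \<psi> (C 1) y" "a < y'" "y' < b" "\<not> \<psi> (C 1) y' < y'"
      by blast
    have conn: "connected ((\<lambda>t. \<psi> (C 1) t - t) ` {a<..<b})"
    proof (rule connected_continuous_image)
      have "continuous_on {a<..<b} (\<psi> (C 1))"
        by (rule continuous_on_subset[OF psi_continuous]) (use ab in auto)
      then show "continuous_on {a<..<b} (\<lambda>t. \<psi> (C 1) t - t)" by (intro continuous_intros)
    qed simp
    have "0 \<in> (\<lambda>t. \<psi> (C 1) t - t) ` {a<..<b}"
    proof (rule connectedD_interval[OF conn])
      show "\<psi> (C 1) y - y \<in> (\<lambda>t. \<psi> (C 1) t - t) ` {a<..<b}"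
        using y by (intro imageI) simp
      show "\<psi> (C 1) y' - y' \<in> (\<lambda>t. \<psi> (C 1) t - t) ` {a<..<b}"
        using y by (intro imageI) simp
    qed (use y in auto)
    then obtain t where "a < t" "t < b" "\<psi> (C 1) t - t = 0" by force
    then show False using free by simp
  qed
  then show ?thesis
  proof
    assume "\<forall>y. a < y \<and> y < b \<longrightarrow> y < \<psi> (C 1) y"
    then show ?thesis by (intro that[OF ab(1-3), of 1]) (auto simp: fa fb)
  next
    assume down: "\<forall>y. a < y \<and> y < b \<longrightarrow> \<psi> (C 1) y < y"
    have "y < \<psi> (C (-1)) y" if y: "a < y" "y < b" for y
    proof -
      have y01: "y \<in> {0..1}" "a \<in> {0..1}" "b \<in> {0..1}" using y ab by auto
      have "a < \<psi> (C (-1)) y" "\<psi> (C (-1)) y < b"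
        using psi_less[of "C (-1)" a y] psi_less[of "C (-1)" y b] y y01 fa fb by simp_all
      with down have "\<psi> (C 1) (\<psi> (C (-1)) y) < \<psi> (C (-1)) y" by blast
      then show ?thesis using psi_C_add[of y 1 "-1"] psi_C_0[of y] y01 by simp
    qed
    then show ?thesis by (intro that[OF ab(1-3), of "-1"]) (auto simp: fa fb)
  qed
qed

end

text \<open>
The interval \<open>{a<..<b}\<close> is a component of the set moved by the constant functions, and \<open>c m\<close> below
acts as the \<open>m\<close>-th power of the one that moves up.
\<close>

locale poly_group_component = poly_group_action +
  fixes a b :: real and \<sigma> :: int
  assumes ab: "0 \<le> a" "a < b" "b \<le> 1" and sigma: "\<sigma> = 1 \<or> \<sigma> = -1"
    and fixed: "\<And>m. \<psi> (C m) a = a" "\<And>m. \<psi> (C m) b = b"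
    and up: "\<And>y. a < y \<Longrightarrow> y < b \<Longrightarrow> y < \<psi> (C \<sigma>) y"
begin

lemma ab01 [simp]: "a \<in> {0..1}" "b \<in> {0..1}" "a < y \<Longrightarrow> y < b \<Longrightarrow> y \<in> {0..1}"
  using ab by auto

lemma ab_simps [simp]: "0 \<le> a" "a \<le> 1" "0 \<le> b" "b \<le> 1" "a < y \<Longrightarrow> 0 \<le> y" "y < b \<Longrightarrow> y \<le> 1"
  using ab by auto

definition c :: "int \<Rightarrow> real \<Rightarrow> real" where
  "c m = \<psi> (C (\<sigma> * m))"

lemma c_add: "t \<in> {0..1} \<Longrightarrow> c m (c m' t) = c (m + m') t"
  by (simp add: c_def psi_C_add distrib_left)

lemma c_0: "t \<in> {0..1} \<Longrightarrow> c 0 t = t"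
  by (simp add: c_def psi_C_0)

lemma c_ends: "c m a = a" "c m b = b"
  by (simp_all add: c_def fixed)

lemma c_unit: "t \<in> {0..1} \<Longrightarrow> c m t \<in> {0..1}"
  unfolding c_def by (rule psi_unit) simp_all

lemma c_less: "s \<in> {0..1} \<Longrightarrow> t \<in> {0..1} \<Longrightarrow> s < t \<Longrightarrow> c m s < c m t"
  unfolding c_def by (rule psi_less) auto

lemma c_commute: "x \<in> carrier G \<Longrightarrow> t \<in> {0..1} \<Longrightarrow> c m (\<psi> x t) = \<psi> x (c m t)"
  unfolding c_def by (rule psi_C_commute)

lemma c_inside:
  assumes "a < y" "y < b" shows "a < c m y" "c m y < b"
  using c_less[of a y m] c_less[of y b m] assms by (simp_all add: c_ends)

lemma c_mono:
  assumes y: "a < y" "y < b" and "m < m'" shows "c m y < c m' y"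
proof -
  have step: "c m y < c (m + 1) y" for m
  proof -
    have "c m y < c 1 (c m y)" using up[OF c_inside[OF y]] by (simp add: c_def)
    then show ?thesis using c_add[of y 1 m] y by (simp add: add.commute)
  qed
  have "c m y < c (m + 1 + int j) y" for j
  proof (induction j)
    case (Suc j)
    then show ?case using step[of "m + 1 + int j"] by (simp add: algebra_simps)
  qed (simp add: step)
  from this[of "nat (m' - m - 1)"] \<open>m < m'\<close> show ?thesis by simp
qed

lemma c_mono_le: "a < y \<Longrightarrow> y < b \<Longrightarrow> m \<le> m' \<Longrightarrow> c m y \<le> c m' y"
  using c_mono[of y m m'] by (cases "m = m'") auto

lemma c_attract:
  assumes y: "a < y" "y < b" shows "(\<lambda>m. c (int m) y) \<longlonglongrightarrow> b"
proof -
  have "incseq (\<lambda>m. c (int m) y)"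
    by (intro incseq_SucI c_mono_le y) simp
  moreover have "\<forall>m. c (int m) y \<le> b" using c_inside(2)[OF y] by (auto intro: less_imp_le)
  ultimately obtain L where L: "(\<lambda>m. c (int m) y) \<longlonglongrightarrow> L" "\<forall>m. c (int m) y \<le> L"
    by (rule incseq_convergent)
  have "y \<le> L" using L(2)[rule_format, of 0] c_0[of y] y by simp
  moreover have "L \<le> b" by (rule LIMSEQ_le_const2[OF L(1)]) (use c_inside[OF y] in \<open>auto intro: less_imp_le\<close>)
  ultimately have L01: "L \<in> {0..1}" "a < L" "L \<le> b"
    using y order_trans[of L b 1] order_trans[of 0 y L] by auto
  have "(\<lambda>m. c 1 (c (int m) y)) \<longlonglongrightarrow> c 1 L"
  proof (rule continuous_on_tendsto_compose[OF _ L(1) L01(1)])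
    show "continuous_on {0..1} (c 1)" unfolding c_def by (rule psi_continuous) simp
    show "\<forall>\<^sub>F m in sequentially. c (int m) y \<in> {0..1}" using c_unit y by simp
  qed
  then have "(\<lambda>m. c (int (Suc m)) y) \<longlonglongrightarrow> c 1 L"
    using c_add[of y 1] y by simp
  then have "c 1 L = L" using LIMSEQ_unique LIMSEQ_Suc[OF L(1)] by blast
  then have "L = b" using up[of L] L01 by (cases "L = b") (auto simp: c_def)
  with L show ?thesis by simp
qed

lemma c_repel:
  assumes y: "a < y" "y < b" and e: "a < e" "e < b" shows "\<exists>m. c m y < e"
proof -
  have "\<forall>\<^sub>F m in sequentially. y < c (int m) e"
    using c_attract[OF e] y(2) by (rule order_tendstoD)
  then obtain m where "y < c (int m) e" by (auto simp: eventually_sequentially)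
  then have "c (- int m) y < c (- int m) (c (int m) e)"
    using c_unit[of e] y e by (intro c_less) auto
  then show ?thesis using c_add[of e "- int m" "int m"] c_0[of e] e by auto
qed

definition Stab :: "(int poly \<times> (int poly \<Rightarrow> int)) set" where
  "Stab = {x \<in> carrier G. \<psi> x a = a \<and> \<psi> x b = b}"

lemma Stab_inv: "x \<in> Stab \<Longrightarrow> inv\<^bsub>G\<^esub> x \<in> Stab"
  unfolding Stab_def using psi_inv(2)[of x a] psi_inv(2)[of x b] by auto

lemma Stab_inside:
  assumes "x \<in> Stab" "a < y" "y < b" shows "a < \<psi> x y" "\<psi> x y < b"
  using psi_less[of x a y] psi_less[of x y b] assms by (auto simp: Stab_def)

text \<open>
An element of the stabilizer commutes with \<open>c\<close>, so the displacement of one point \<open>t\<close>, measured in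
fundamental domains of \<open>c\<close>, controls the displacement of all points up to one fundamental domain.
\<close>

lemma Stab_bounded_displacement:
  assumes h: "h \<in> Stab"
  shows "\<exists>K. \<forall>y. a < y \<and> y < b \<longrightarrow> \<psi> h y < c K y"
proof -
  have hG: "h \<in> carrier G" using h by (simp add: Stab_def)
  define t where "t = (a + b) / 2"
  have "a < t" "t < b" using ab(2) by (simp_all add: t_def field_simps)
  then have t: "a < t" "t < b" "t \<in> {0..1}" by simp_all
  obtain K0 where K0: "\<psi> h t < c (int K0) t"
    using order_tendstoD(1)[OF c_attract[OF t(1,2)] Stab_inside(2)[OF h t(1,2)]]
    by (auto simp: eventually_sequentially)
  show ?thesis
  proof (intro exI[of _ "int K0 + 1"] allI impI)
    fix y assume y: "a < y \<and> y < b"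
    obtain lo where lo: "c lo t < y" using c_repel[of t y] t y by blast
    obtain hi where hi: "y < c (int hi) t"
      using order_tendstoD(1)[OF c_attract[OF t(1,2)], of y] y by (auto simp: eventually_sequentially)
    define M where "M = {j \<in> {lo..int hi}. c j t \<le> y}"
    have fin: "finite M" unfolding M_def by (rule finite_subset[of _ "{lo..int hi}"]) auto
    \<comment> \<open>The fundamental domain \<open>{c j t..<c (j + 1) t}\<close> contains \<open>y\<close>.\<close>
    define j where "j = Max M"
    have "lo \<le> int hi"
      using c_mono_le[OF t(1,2), of "int hi" lo] lo hi by linarith
    then have "lo \<in> M" using lo by (simp add: M_def)
    then have "j \<in> M" unfolding j_def using fin by (intro Max_in) auto
    then have j: "lo \<le> j" "j \<le> int hi" "c j t \<le> y" by (auto simp: M_def)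
    have j': "y < c (j + 1) t"
    proof (rule ccontr)
      assume *: "\<not> ?thesis"
      then have "j \<noteq> int hi" using hi c_mono[OF t(1,2), of j "j + 1"] by auto
      then have "j + 1 \<in> M" using * j by (auto simp: M_def)
      from Max_ge[OF fin this] show False by (simp add: j_def)
    qed
    have "\<psi> h y < \<psi> h (c (j + 1) t)" using j' y c_unit[OF t(3)] by (intro psi_less hG) auto
    also have "\<dots> = c (j + 1) (\<psi> h t)" using c_commute[OF hG t(3)] by simp
    also have "\<dots> < c (j + 1) (c (int K0) t)"
      using K0 psi_unit[OF hG t(3)] c_unit[OF t(3)] by (intro c_less) auto
    also have "\<dots> = c (int K0 + 1) (c j t)"
      using c_add[OF t(3)] by (simp add: algebra_simps)
    also have "\<dots> \<le> c (int K0 + 1) y"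
      using c_less[of "c j t" y "int K0 + 1"] j(3) c_unit[OF t(3)] y by (cases "c j t = y") auto
    finally show "\<psi> h y < c (int K0 + 1) y" .
  qed
qed

text \<open>
Conjugating \<open>h\<close> by the \<open>j\<close>-th power of \<open>g\<close> multiplies it by \<open>c (m * j)\<close>. Conjugation does not
change bounds on the displacement, but the factor \<open>c (m * j)\<close> eventually violates them.
\<close>

lemma no_central_commutator_pos:
  assumes g: "g \<in> Stab" and h: "h \<in> Stab" and m: "m > 0"
    and comm: "g \<otimes>\<^bsub>G\<^esub> h = h \<otimes>\<^bsub>G\<^esub> g \<otimes>\<^bsub>G\<^esub> C (\<sigma> * m)"
  shows False
proof -
  have gG: "g \<in> carrier G" and hG: "h \<in> carrier G" using g h by (simp_all add: Stab_def)
  obtain K where K: "\<And>y. a < y \<Longrightarrow> y < b \<Longrightarrow> \<psi> h y < c K y"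
    using Stab_bounded_displacement[OF h] by blast
  obtain K' where K': "\<And>y. a < y \<Longrightarrow> y < b \<Longrightarrow> \<psi> (inv\<^bsub>G\<^esub> h) y < c K' y"
    using Stab_bounded_displacement[OF Stab_inv[OF h]] by blast
  have commute: "\<psi> g (\<psi> h s) = \<psi> h (c m (\<psi> g s))" if "s \<in> {0..1}" for s
  proof -
    have "\<psi> g (\<psi> h s) = \<psi> (g \<otimes>\<^bsub>G\<^esub> h) s" using psi_mult[OF gG hG that] by simp
    also have "\<dots> = \<psi> h (\<psi> g (c m s))"
      unfolding comm c_def using gG hG that psi_unit[OF C_carrier that] by (simp add: psi_mult del: poly_group_simps)
    finally show ?thesis using c_commute[OF gG that] by simp
  qed
  define gs where "gs j s = (\<psi> g ^^ j) s" for j s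
  have gs: "a < gs j s \<and> gs j s < b" if "a < s" "s < b" for j s
    unfolding gs_def using that by (induction j) (auto intro: Stab_inside[OF g])
  have gs_c: "gs j (c i s) = c i (gs j s)" if "a < s" "s < b" for i j s
  proof (induction j)
    case (Suc j)
    have "gs j s \<in> {0..1}" using gs[OF that] ab01(3) by blast
    then show ?case using Suc c_commute[OF gG, of "gs j s" i] by (simp add: gs_def)
  qed (simp add: gs_def)
  have gs_less: "gs j s < gs j s'" if "a < s" "s < b" "a < s'" "s' < b" "s < s'" for j s s'
  proof (induction j)
    case (Suc j)
    have "gs j s \<in> {0..1}" "gs j s' \<in> {0..1}" using gs that ab01(3) by blast+
    then show ?case using Suc psi_less[OF gG, of "gs j s" "gs j s'"] by (simp add: gs_def)
  qed (simp add: gs_def that)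
  have gs_h: "gs j (\<psi> h s) = \<psi> h (c (m * int j) (gs j s))" if s: "a < s" "s < b" for j s
  proof (induction j)
    case 0
    then show ?case using c_0[of s] s by (simp add: gs_def)
  next
    case (Suc j)
    have s01: "gs j s \<in> {0..1}" using gs[OF s] ab01(3) by blast
    have "gs (Suc j) (\<psi> h s) = \<psi> g (\<psi> h (c (m * int j) (gs j s)))"
      using Suc by (simp add: gs_def)
    also have "\<dots> = \<psi> h (c m (c (m * int j) (\<psi> g (gs j s))))"
      using commute[OF c_unit[OF s01]] c_commute[OF gG s01] by simp
    also have "c m (c (m * int j) (\<psi> g (gs j s))) = c (m * int (Suc j)) (gs (Suc j) s)"
      using c_add[OF psi_unit[OF gG s01]] by (simp add: gs_def algebra_simps)
    finally show ?case .
  qed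
  define t where "t = (a + b) / 2"
  have t: "a < t" "t < b" using ab by (auto simp: t_def)
  \<comment> \<open>Large enough for the shift \<open>m * j\<close> to exceed the sum of both displacement bounds.\<close>
  define j where "j = nat (\<bar>K\<bar> + \<bar>K'\<bar>)"
  let ?u = "gs j t"
  have u: "a < ?u" "?u < b" "?u \<in> {0..1}" using gs[OF t] ab01(3) by blast+
  have ht: "a < \<psi> h t" "\<psi> h t < b" using Stab_inside[OF h t] by auto
  have "\<psi> h (c (m * int j) ?u) = gs j (\<psi> h t)" using gs_h[OF t] by simp
  also have "\<dots> < gs j (c K t)"
    using ht c_inside[OF t] K[OF t] by (intro gs_less) auto
  also have "\<dots> = c K ?u" by (rule gs_c[OF t])
  finally have 1: "\<psi> h (c (m * int j) ?u) < c K ?u" .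
  let ?w = "\<psi> h (c (m * int j) ?u)"
  have w: "a < ?w" "?w < b" using Stab_inside[OF h c_inside[OF u(1,2)]] by auto
  have "c (m * int j) ?u = \<psi> (inv\<^bsub>G\<^esub> h) ?w"
    using psi_inv(2)[OF hG c_unit[OF u(3)]] by simp
  also have "\<dots> < c K' ?w" by (rule K'[OF w])
  also have "\<dots> < c K' (c K ?u)"
    using 1 w c_unit[OF u(3)] by (intro c_less) auto
  also have "\<dots> = c (K' + K) ?u" using c_add[OF u(3)] by simp
  finally have "c (m * int j) ?u < c (K' + K) ?u" .
  moreover have "K' + K \<le> m * int j"
  proof -
    have "K' + K \<le> int j" by (simp add: j_def)
    moreover have "int j \<le> m * int j" using m by (simp add: mult_le_cancel_right1)
    ultimately show ?thesis by linarith
  qed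
  ultimately show False using c_mono_le[OF u(1,2), of "K' + K" "m * int j"] by linarith
qed

lemma no_central_commutator:
  assumes g: "g \<in> Stab" and h: "h \<in> Stab"
    and comm: "g \<otimes>\<^bsub>G\<^esub> h = h \<otimes>\<^bsub>G\<^esub> g \<otimes>\<^bsub>G\<^esub> C m"
  shows "m = 0"
proof (rule ccontr)
  assume "m \<noteq> 0"
  have gG: "g \<in> carrier G" and hG: "h \<in> carrier G" using g h by (simp_all add: Stab_def)
  have m: "m = \<sigma> * (\<sigma> * m)" using sigma by auto
  show False
  proof (cases "\<sigma> * m > 0")
    case True
    then show False using no_central_commutator_pos[OF g h True] comm m by simp
  next
    case False
    then have "- (\<sigma> * m) > 0" using \<open>m \<noteq> 0\<close> sigma by auto
    moreover have "h \<otimes>\<^bsub>G\<^esub> g = g \<otimes>\<^bsub>G\<^esub> h \<otimes>\<^bsub>G\<^esub> C (\<sigma> * - (\<sigma> * m))"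
    proof -
      have "g \<otimes>\<^bsub>G\<^esub> h \<otimes>\<^bsub>G\<^esub> C (- m) = h \<otimes>\<^bsub>G\<^esub> g \<otimes>\<^bsub>G\<^esub> (C m \<otimes>\<^bsub>G\<^esub> C (- m))"
        unfolding comm using gG hG by (simp only: m_assoc m_closed C_carrier)
      also have "\<dots> = h \<otimes>\<^bsub>G\<^esub> g" using gG hG by (simp add: C_mult C_0 del: poly_group_simps)
      moreover have "\<sigma> * - (\<sigma> * m) = - m" using sigma by auto
      ultimately show ?thesis by (simp only:)
    qed
    ultimately show False using no_central_commutator_pos[OF h g] by blast
  qed
qed

text \<open>
Images of the component are again components of the set moved by \<open>c\<close>: their endpoints are fixed and
their interior contains no fixed points. So an endpoint of one image cannot lie inside another.
\<close>

lemma translation_component: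
  assumes x: "x \<in> carrier G" and y: "y \<in> carrier G"
    and meet: "{\<psi> x a<..<\<psi> x b} \<inter> {\<psi> y a<..<\<psi> y b} \<noteq> {}"
  shows "\<psi> x a = \<psi> y a \<and> \<psi> x b = \<psi> y b"
proof -
  have ends: "c 1 (\<psi> x a) = \<psi> x a" "c 1 (\<psi> x b) = \<psi> x b" if "x \<in> carrier G" for x
    using c_commute[OF that, of _ 1] c_ends[of 1] by auto
  have free: "c 1 t \<noteq> t" if "x \<in> carrier G" "\<psi> x a < t" "t < \<psi> x b" for x t
  proof
    assume t: "c 1 t = t"
    have t01: "t \<in> {0..1}" using that psi_unit[of x a] psi_unit[of x b] by auto
    let ?s = "\<psi> (inv\<^bsub>G\<^esub> x) t"
    have xi: "inv\<^bsub>G\<^esub> x \<in> carrier G" using that(1) by (rule inv_closed)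
    have s: "?s \<in> {0..1}" "\<psi> x ?s = t" using psi_unit[OF xi t01] psi_inv(1)[OF that(1) t01] by auto
    then have "a < ?s" "?s < b"
      using psi_less_iff[OF that(1), of a ?s] psi_less_iff[OF that(1), of ?s b] that by auto
    then have "?s < c 1 ?s" using up by (simp add: c_def)
    moreover have "c 1 ?s = ?s" using c_commute[OF xi t01] t by simp
    ultimately show False by simp
  qed
  obtain t where t: "\<psi> x a < t" "t < \<psi> x b" "\<psi> y a < t" "t < \<psi> y b"
  proof -
    obtain t where "t \<in> {\<psi> x a<..<\<psi> x b} \<inter> {\<psi> y a<..<\<psi> y b}" using meet by blast
    then show ?thesis using that[of t] by (simp del: greaterThanLessThan_iff add: greaterThanLessThan_iff)
  qed
  have "\<not> \<psi> x a < \<psi> y a" using free[OF x, of "\<psi> y a"] ends(1)[OF y] t by linarith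
  moreover have "\<not> \<psi> y a < \<psi> x a" using free[OF y, of "\<psi> x a"] ends(1)[OF x] t by linarith
  moreover have "\<not> \<psi> x b < \<psi> y b" using free[OF y, of "\<psi> x b"] ends(2)[OF x] t by linarith
  moreover have "\<not> \<psi> y b < \<psi> x b" using free[OF x, of "\<psi> y b"] ends(2)[OF y] t by linarith
  ultimately show ?thesis by linarith
qed

end

context poly_group_component
begin

text \<open>
Translations in the coordinates of \<open>S\<close> together with linear functions of the other coordinates. These
functions are invariant under these translations, so the elements form an abelian subgroup: a
Lagrangian for the commutator pairing.
\<close>

definition split_elem :: "nat set \<Rightarrow> (nat \<Rightarrow> int) \<Rightarrow> int poly \<times> (int poly \<Rightarrow> int)" where
  "split_elem S m = (partial_vec S m, partial_coord k ({..<k} - S) m)"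

lemma split_elem_carrier:
  assumes "S \<subseteq> {..<k}" shows "split_elem S m \<in> carrier G"
proof -
  have "d = Suc (Suc (d - 2))" using d2 by simp
  then have "partial_coord k ({..<k} - S) m \<in> polyfun k d"
    using partial_coord_polyfun[of "{..<k} - S" k m "d - 2"] by simp
  then show ?thesis by (simp add: split_elem_def partial_vec_grid[OF assms])
qed

lemma partial_vec_add: "partial_vec S m + partial_vec S m' = partial_vec S (\<lambda>i. m i + m' i)"
  by (simp add: partial_vec_def sum.distrib[symmetric] add_monom)

lemma partial_coord_translate:
  assumes "v \<in> grid k" "w \<in> grid k"
  shows "partial_coord k I m (w + v) = partial_coord k I m w + (\<Sum>i\<in>I. m i * Polynomial.coeff v i)"
  using assms by (simp add: partial_coord_def distrib_left sum.distrib)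

lemma split_elem_mult:
  assumes S: "S \<subseteq> {..<k}"
  shows "split_elem S m \<otimes>\<^bsub>G\<^esub> split_elem S m' = split_elem S (\<lambda>i. m i + m' i)"
proof -
  have fin: "finite S" using S by (rule finite_subset) simp
  have "partial_coord k ({..<k} - S) m (w + partial_vec S m') + partial_coord k ({..<k} - S) m' w
      = partial_coord k ({..<k} - S) (\<lambda>i. m i + m' i) w" for w
  proof (cases "w \<in> grid k")
    case True
    have "(\<Sum>i\<in>{..<k} - S. m i * Polynomial.coeff (partial_vec S m') i) = 0"
      by (intro sum.neutral) (auto simp: coeff_partial_vec[OF fin])
    then show ?thesis
      using partial_coord_translate[OF partial_vec_grid[OF S] True] True
      by (simp add: partial_coord_def distrib_right sum.distrib)
  next
    case False
    then show ?thesis by (simp add: partial_coord_def partial_vec_grid[OF S])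
  qed
  then show ?thesis by (simp add: split_elem_def partial_vec_add)
qed

lemma split_elem_0: "split_elem S (\<lambda>_. 0) = \<one>\<^bsub>G\<^esub>"
  by (auto simp: split_elem_def partial_vec_def partial_coord_def)

text \<open>
Take \<open>S\<close> maximal such that no nonzero translation in the coordinates of \<open>S\<close> stabilizes the component.
For \<open>j\<close> outside \<open>S\<close>, maximality gives a stabilizing translation \<open>v\<close> along \<open>S\<close> and \<open>j\<close> with \<open>j\<close>-th
coordinate nonzero. If \<open>split_elem S m\<close> stabilizes the component as well, its commutator with \<open>v\<close> is
the constant \<open>m j * coeff v j\<close>, so \<open>m j = 0\<close>. What remains of \<open>split_elem S m\<close> is a translation in the
coordinates of \<open>S\<close>, which vanishes by the choice of \<open>S\<close>.
\<close>

lemma exists_transverse_split: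
  "\<exists>S\<subseteq>{..<k}. \<forall>m. (\<forall>i\<ge>k. m i = 0) \<and> split_elem S m \<in> Stab \<longrightarrow> m = (\<lambda>_. 0)"
proof -
  define \<S> where "\<S> = {S. S \<subseteq> {..<k} \<and> (\<forall>v\<in>grid k. (\<forall>i. i \<notin> S \<longrightarrow> Polynomial.coeff v i = 0) \<and> (v, \<lambda>_. 0) \<in> Stab \<longrightarrow> v = 0)}"
  have "finite \<S>" by (rule finite_subset[of _ "Pow {..<k}"]) (auto simp: \<S>_def)
  moreover have "{} \<in> \<S>" by (auto simp: \<S>_def poly_eq_iff)
  ultimately obtain S where S: "S \<in> \<S>" and max: "\<And>S'. S' \<in> \<S> \<Longrightarrow> S \<subseteq> S' \<Longrightarrow> S' = S"
    using finite_has_maximal[of \<S>] by blast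
  have Sk: "S \<subseteq> {..<k}" using S by (simp add: \<S>_def)
  have finS: "finite S" using Sk by (rule finite_subset) simp
  show ?thesis
  proof (intro exI[of _ S] conjI Sk allI impI; elim conjE)
    fix m :: "nat \<Rightarrow> int" assume supp: "\<forall>i\<ge>k. m i = 0" and stab: "split_elem S m \<in> Stab"
    have out: "m j = 0" if j: "j < k" "j \<notin> S" for j
    proof -
      have "insert j S \<notin> \<S>" using max[of "insert j S"] j by auto
      then obtain v where v: "v \<in> grid k" "\<forall>i. i \<notin> insert j S \<longrightarrow> Polynomial.coeff v i = 0"
          "(v, \<lambda>_. 0) \<in> Stab" "v \<noteq> 0"
        using Sk j by (auto simp: \<S>_def)
      have vj: "Polynomial.coeff v j \<noteq> 0"
      proof
        assume "Polynomial.coeff v j = 0"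
        then have "\<forall>i. i \<notin> S \<longrightarrow> Polynomial.coeff v i = 0" using v(2) by (metis insert_iff)
        with S v show False by (auto simp: \<S>_def)
      qed
      have "(\<Sum>i\<in>{..<k} - S. m i * Polynomial.coeff v i) = (\<Sum>i\<in>{j}. m i * Polynomial.coeff v i)"
        using j v(2) by (intro sum.mono_neutral_right) auto
      then have sum: "(\<Sum>i\<in>{..<k} - S. m i * Polynomial.coeff v i) = m j * Polynomial.coeff v j" by simp
      have "partial_coord k ({..<k} - S) m (w + v) = partial_coord k ({..<k} - S) m w + const_fun k (m j * Polynomial.coeff v j) w" for w
      proof (cases "w \<in> grid k")
        case True
        then show ?thesis using partial_coord_translate[OF v(1) True] sum by (simp add: const_fun_def)
      next
        case False
        then show ?thesis using v(1) by (simp add: partial_coord_def const_fun_def)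
      qed
      then have "split_elem S m \<otimes>\<^bsub>G\<^esub> (v, \<lambda>_. 0)
          = (v, \<lambda>_. 0) \<otimes>\<^bsub>G\<^esub> split_elem S m \<otimes>\<^bsub>G\<^esub> C (m j * Polynomial.coeff v j)"
        by (simp add: split_elem_def C_def add.commute)
      from no_central_commutator[OF stab v(3) this] vj show ?thesis by simp
    qed
    have "partial_coord k ({..<k} - S) m = (\<lambda>_. 0)"
      using out by (auto simp: partial_coord_def fun_eq_iff)
    then have "(partial_vec S m, \<lambda>_. 0) \<in> Stab" using stab by (simp add: split_elem_def)
    moreover have "\<forall>i. i \<notin> S \<longrightarrow> Polynomial.coeff (partial_vec S m) i = 0"
      by (simp add: coeff_partial_vec[OF finS])
    ultimately have "partial_vec S m = 0"
      using S partial_vec_grid[OF Sk, of m] unfolding \<S>_def by blast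
    then have "m j = 0" if "j \<in> S" for j
      using coeff_partial_vec[OF finS, of m j] that by simp
    with out supp have "m j = 0" for j by (cases "j < k"; cases "j \<in> S") auto
    then show "m = (\<lambda>_. 0)" by (rule ext)
  qed
qed

text \<open>
For \<open>n = 1\<close> the exponent \<open>\<tau>\<close> is \<open>\<alpha>\<close>; for \<open>n \<ge> 2\<close> it can be any number in \<open>{1 / k<..<1}\<close> or, if
\<open>k = 1\<close>, the number \<open>1\<close>.
\<close>

theorem regularity_bound:
  assumes "n = 1 \<and> \<alpha> > 1 / real k \<and> \<alpha> < 1 \<or> n \<ge> 2"
  shows False
proof -
  obtain \<tau> where \<tau>: "1 / real k < \<tau> \<and> \<tau> < 1 \<or> k = 1 \<and> \<tau> = 1"
    and n: "n = 1 \<and> \<tau> = \<alpha> \<or> n \<ge> 2 \<and> \<tau> \<le> 1"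
    using assms
  proof
    assume *: "n = 1 \<and> \<alpha> > 1 / real k \<and> \<alpha> < 1"
    show ?thesis by (rule that[of \<alpha>]) (use * in blast)+
  next
    assume "n \<ge> 2"
    show ?thesis
    proof (cases "k = 1")
      case True
      with \<open>n \<ge> 2\<close> show ?thesis using that[of 1] by simp
    next
      case False
      with k1 have "1 / real k < 1" by simp
      with \<open>n \<ge> 2\<close> show ?thesis using that[of "(1 / real k + 1) / 2"] by simp
    qed
  qed
  have "0 \<le> 1 / real k" by simp
  then have \<tau>0: "\<tau> > 0" using \<tau> by linarith
  have dist: "bounded_distortion \<tau> (\<psi> x)" if "x \<in> carrier G" for x
    by (rule Diff_plus_bounded_distortion[OF psi_Diff[OF that] n \<tau>0])
  obtain S where S: "S \<subseteq> {..<k}"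
    and "\<forall>m. (\<forall>i\<ge>k. m i = 0) \<and> split_elem S m \<in> Stab \<longrightarrow> m = (\<lambda>_. 0)"
    using exists_transverse_split by (elim exE conjE)
  then have transverse: "m = (\<lambda>_. 0)" if "\<forall>i\<ge>k. m i = 0" "split_elem S m \<in> Stab" for m
    using that by simp
  note car = split_elem_carrier[OF S]
  \<comment> \<open>The generators \<open>split_elem S (e i)\<close> are the steps of the lattice path.\<close>
  define e :: "nat \<Rightarrow> nat \<Rightarrow> int" where "e i j = (if j = i then 1 else 0)" for i j
  define g where "g m = \<psi> (split_elem S (\<lambda>i. int (m i)))" for m :: "nat \<Rightarrow> nat"
  show False
  proof (rule generalized_Kopell[OF k1 \<tau>, of "\<lambda>i. \<psi> (split_elem S (e i))" "\<lambda>m. c (int m)" g a b])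
    show "bounded_distortion \<tau> (\<psi> (split_elem S (e i)))" for i by (rule dist[OF car])
    show "bounded_distortion \<tau> (c (int m))" for m unfolding c_def by (rule dist[OF C_carrier])
    show "g (\<lambda>_. 0) x = x" if "x \<in> {0..1}" for x
      using psi_one[OF that] by (simp add: g_def split_elem_0 del: poly_group_simps)
    show "g (step m i) x = \<psi> (split_elem S (e i)) (g m x)" if "i < k" "x \<in> {0..1}" for m i x
    proof -
      have "(\<lambda>j. int (step m i j)) = (\<lambda>j. e i j + int (m j))" by (auto simp: e_def)
      then show ?thesis
        unfolding g_def psi_mult[OF car car that(2), symmetric] split_elem_mult[OF S] by simp
    qed
    show "g m x \<in> {0..1}" if "x \<in> {0..1}" for m x unfolding g_def by (rule psi_unit[OF car that])
    show "strict_mono_on {0..1} (g m)" for m unfolding g_def by (rule psi_Bij(2)[OF car])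
    show "c (int j) (g m x) = g m (c (int j) x)" if "x \<in> {0..1}" for m j x
      unfolding g_def by (rule c_commute[OF car that])
    show "0 \<le> a" "a < b" "b \<le> 1" by (fact ab)+
    show "c (int m) a = a" "c (int m) b = b" for m by (fact c_ends)+
    show "a \<le> c (int m) y \<and> c (int m) y \<le> b" if "a < y" "y < b" for m y
      using c_inside[OF that, of "int m"] by simp
    show "(\<lambda>m. c (int m) y) \<longlonglongrightarrow> b" if "a < y" "y < b" for y by (rule c_attract[OF that])
    show "{g m a<..<g m b} \<inter> {g m' a<..<g m' b} = {}"
      if m: "m \<in> orthant k" "m' \<in> orthant k" "m \<noteq> m'" for m m'
    proof (rule ccontr)
      assume meet: "{g m a<..<g m b} \<inter> {g m' a<..<g m' b} \<noteq> {}"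
      have same: "g m a = g m' a" "g m b = g m' b"
        using translation_component[OF car car meet[unfolded g_def]] by (simp_all add: g_def)
      define r where "r i = int (m i) - int (m' i)" for i
      have "split_elem S (\<lambda>i. int (m i)) = split_elem S (\<lambda>i. int (m' i)) \<otimes>\<^bsub>G\<^esub> split_elem S r"
        by (simp only: split_elem_mult[OF S]) (simp add: r_def)
      then have "g m x = g m' (\<psi> (split_elem S r) x)" if "x \<in> {0..1}" for x
        unfolding g_def using psi_mult[OF car car that] by simp
      with same have "g m' (\<psi> (split_elem S r) a) = g m' a" "g m' (\<psi> (split_elem S r) b) = g m' b"
        by auto
      then have "\<psi> (split_elem S r) a = a" "\<psi> (split_elem S r) b = b"
        unfolding g_def using psi_eq_iff[OF car psi_unit[OF car ab01(1)] ab01(1)]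
          psi_eq_iff[OF car psi_unit[OF car ab01(2)] ab01(2)] by simp_all
      then have "split_elem S r \<in> Stab" using car by (simp add: Stab_def)
      moreover have "\<forall>i\<ge>k. r i = 0" using m(1,2) by (simp add: r_def orthant_def)
      ultimately have "r = (\<lambda>_. 0)" by (intro transverse)
      then have "r i = 0" for i by (rule fun_cong)
      then have "m i = m' i" for i unfolding r_def by simp
      with m(3) show False by auto
    qed
  qed
qed

end

theorem (in poly_group_action) regularity_le:
  assumes "0 \<le> \<alpha>" "\<alpha> < 1"
  shows "real n + \<alpha> \<le> 1 + 1 / real k"
proof (rule ccontr)
  assume *: "\<not> ?thesis"
  have k0: "0 \<le> 1 / real k" by simp
  have n: "n = 1 \<and> \<alpha> > 1 / real k \<and> \<alpha> < 1 \<or> n \<ge> 2"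
  proof (cases "n \<ge> 2")
    case False
    have "n \<noteq> 0" using * assms k0 by (intro notI) auto
    with False have "n = 1" by simp
    then show ?thesis using * assms by simp
  qed simp
  obtain a b \<sigma> where "0 \<le> a" "a < b" "b \<le> 1" "\<sigma> = 1 \<or> \<sigma> = -1"
    "\<forall>m. \<psi> (C m) a = a \<and> \<psi> (C m) b = b"
    "\<forall>y. a < y \<and> y < b \<longrightarrow> y < \<psi> (C \<sigma>) y"
    by (rule central_component)
  then interpret poly_group_component k d n \<alpha> \<psi> a b \<sigma>
    by unfold_locales auto
  show False by (rule regularity_bound[OF n])
qed

section \<open>Transformations of ordered families of intervals\<close>

lemma has_sum_diff_real:
  fixes f g :: "'a \<Rightarrow> real"
  assumes "(f has_sum a) A" "(g has_sum b) A" shows "((\<lambda>x. f x - g x) has_sum (a - b)) A"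
  using has_sum_add[of f A a "\<lambda>x. - g x" "- b"] assms by (simp add: has_sum_uminus)

text \<open>
For every \<open>w\<close> in an ordered abelian group \<open>L\<close>, an interval of length \<open>len w\<close> is parametrized by the
real line with density \<open>\<rho> w\<close> and distribution function \<open>F w\<close>. The intervals are lined up in the
order of \<open>L\<close>, and their lengths fill the unit interval.
\<close>

locale ordered_interval_flow =
  fixes L :: "'v::linordered_ab_group_add set" and F \<rho> :: "'v \<Rightarrow> real \<Rightarrow> real" and len :: "'v \<Rightarrow> real"
  assumes L_zero [simp]: "0 \<in> L"
    and L_add [simp]: "v \<in> L \<Longrightarrow> w \<in> L \<Longrightarrow> v + w \<in> L"
    and L_uminus [simp]: "v \<in> L \<Longrightarrow> - v \<in> L"
    and len_pos: "w \<in> L \<Longrightarrow> len w > 0"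
    and len_sum: "(len has_sum 1) L"
    and F_deriv: "w \<in> L \<Longrightarrow> (F w has_real_derivative \<rho> w t) (at t)"
    and density_pos: "w \<in> L \<Longrightarrow> \<rho> w t > 0"
    and F_bot: "w \<in> L \<Longrightarrow> (F w \<longlongrightarrow> 0) at_bot"
    and F_top: "w \<in> L \<Longrightarrow> (F w \<longlongrightarrow> len w) at_top"
begin

lemma F_less: "w \<in> L \<Longrightarrow> s < t \<Longrightarrow> F w s < F w t"
  using DERIV_pos_imp_increasing[of s t "F w"] F_deriv density_pos by blast

lemma F_less_iff: "w \<in> L \<Longrightarrow> F w s < F w t \<longleftrightarrow> s < t"
  using F_less[of w s t] F_less[of w t s] by (cases s t rule: linorder_cases) auto

lemma F_le: "w \<in> L \<Longrightarrow> s \<le> t \<Longrightarrow> F w s \<le> F w t"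
  using F_less[of w s t] by (cases "s = t") auto

lemma F_pos: assumes w: "w \<in> L" shows "F w t > 0"
proof -
  have "\<forall>\<^sub>F s in at_bot. F w s \<le> F w (t - 1)"
    using eventually_le_at_bot[of "t - 1"] by eventually_elim (rule F_le[OF w])
  then have "0 \<le> F w (t - 1)" by (rule tendsto_upperbound[OF F_bot[OF w]]) simp
  also have "\<dots> < F w t" by (rule F_less[OF w]) simp
  finally show ?thesis .
qed

lemma F_lt: assumes w: "w \<in> L" shows "F w t < len w"
proof -
  have "F w t < F w (t + 1)" by (rule F_less[OF w]) simp
  also have "\<forall>\<^sub>F s in at_top. F w (t + 1) \<le> F w s"
    using eventually_ge_at_top[of "t + 1"] by eventually_elim (rule F_le[OF w])
  then have "F w (t + 1) \<le> len w" by (rule tendsto_lowerbound[OF F_top[OF w]]) simp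
  finally show ?thesis .
qed

lemma F_onto:
  assumes w: "w \<in> L" and y: "0 < y" "y < len w" shows "\<exists>t. F w t = y"
proof -
  obtain s where s: "F w s < y"
    using order_tendstoD(2)[OF F_bot[OF w] y(1)] by (auto simp: eventually_at_bot_linorder)
  obtain t where t: "y < F w t"
    using order_tendstoD(1)[OF F_top[OF w] y(2)] by (auto simp: eventually_at_top_linorder)
  have "F w s < F w t" using s t by simp
  then have "s \<le> t" using F_less_iff[OF w] by (simp add: less_imp_le)
  moreover have "continuous_on {s..t} (F w)"
    by (rule DERIV_continuous_on) (rule has_field_derivative_at_within[OF F_deriv[OF w]])
  ultimately show ?thesis using IVT'[of "F w" s y t] s t by force
qed

definition time :: "'v \<Rightarrow> real \<Rightarrow> real" where
  "time w y = (SOME t. F w t = y)"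

lemma F_time: "w \<in> L \<Longrightarrow> 0 < y \<Longrightarrow> y < len w \<Longrightarrow> F w (time w y) = y"
  unfolding time_def by (rule someI_ex) (rule F_onto)

lemma time_F: "w \<in> L \<Longrightarrow> time w (F w t) = t"
  using F_time[of w "F w t"] F_pos[of w t] F_lt[of w t] F_less_iff[of w] by (metis linorder_neqE_linordered_idom less_irrefl)

definition start :: "'v \<Rightarrow> real" where
  "start w = infsum len {u \<in> L. u < w}"

lemma len_summable: "A \<subseteq> L \<Longrightarrow> len summable_on A"
  using len_sum summable_on_subset_banach has_sum_imp_summable by blast

lemma len_nonneg: "A \<subseteq> L \<Longrightarrow> x \<in> A \<Longrightarrow> 0 \<le> len x"
  using len_pos less_imp_le by blast

lemma infsum_len_mono:
  assumes "A \<subseteq> B" "B \<subseteq> L" shows "infsum len A \<le> infsum len B"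
  using assms len_nonneg[OF assms(2)] len_summable by (intro infsum_mono2) auto

lemma start_add_len:
  assumes w: "w \<in> L" shows "start w + len w = infsum len {u \<in> L. u \<le> w}"
proof -
  have "{u \<in> L. u \<le> w} = {u \<in> L. u < w} \<union> {w}" using w by auto
  then have "infsum len {u \<in> L. u \<le> w} = infsum len {u \<in> L. u < w} + infsum len {w}"
    by (simp only:) (intro infsum_Un_disjoint len_summable; use w in auto)
  then show ?thesis by (simp add: start_def)
qed

lemma start_mono: "u \<in> L \<Longrightarrow> u < w \<Longrightarrow> start u + len u \<le> start w"
  unfolding start_add_len unfolding start_def by (intro infsum_len_mono) auto

lemma start_nonneg: "0 \<le> start w"
  unfolding start_def by (intro infsum_nonneg len_nonneg[of "{u \<in> L. u < w}"]) auto

lemma infsum_len [simp]: "infsum len L = 1"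
  using len_sum by (rule infsumI)

lemma end_le_1: "w \<in> L \<Longrightarrow> start w + len w \<le> 1"
  using infsum_len_mono[of "{u \<in> L. u \<le> w}" L] by (simp add: start_add_len)

lemma infsum_len_ge:
  assumes w: "w \<in> L" shows "infsum len {u \<in> L. w \<le> u} = 1 - start w"
proof -
  have "L = {u \<in> L. u < w} \<union> {u \<in> L. w \<le> u}" by auto
  then have "infsum len L = infsum len ({u \<in> L. u < w} \<union> {u \<in> L. w \<le> u})" by simp
  also have "\<dots> = start w + infsum len {u \<in> L. w \<le> u}"
    unfolding start_def by (intro infsum_Un_disjoint len_summable) auto
  finally show ?thesis by simp
qed

text \<open>
The length of the part of the interval of \<open>w\<close> that lies to the left of \<open>x\<close>.
\<close>

definition cover :: "'v \<Rightarrow> real \<Rightarrow> real" where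
  "cover w x = max 0 (min (len w) (x - start w))"

lemma cover_left: "x \<le> start w \<Longrightarrow> cover w x = 0"
  by (simp add: cover_def)

lemma cover_right: "w \<in> L \<Longrightarrow> start w + len w \<le> x \<Longrightarrow> cover w x = len w"
  using len_pos[of w] by (auto simp: cover_def)

lemma cover_inside: "start w \<le> x \<Longrightarrow> x \<le> start w + len w \<Longrightarrow> cover w x = x - start w"
  by (auto simp: cover_def)

lemma has_sum_point:
  fixes f g :: "'v \<Rightarrow> real"
  assumes w: "w \<in> L" and f: "\<And>u. u \<in> L \<Longrightarrow> u < w \<Longrightarrow> f u = g u" "\<And>u. u \<in> L \<Longrightarrow> w < u \<Longrightarrow> f u = 0"
    and g: "(g has_sum s) {u \<in> L. u < w}"
  shows "(f has_sum (s + f w)) L"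
proof -
  have "(f has_sum s) {u \<in> L. u < w}"
    using g by (rule has_sum_cong[THEN iffD2, rotated]) (use f in auto)
  moreover have "(f has_sum f w) {w}" by (simp add: has_sum_finite_iff)
  ultimately have "(f has_sum (s + f w)) ({u \<in> L. u < w} \<union> {w})"
    by (rule has_sum_Un_disjoint) auto
  then show ?thesis
    by (rule has_sum_cong_neutral[THEN iffD1, rotated 3]) (use f w in auto)
qed

text \<open>
The intervals cover the unit interval up to a null set. If \<open>x\<close> lies in no closed interval, the
intervals to its left have total length at most \<open>x\<close> and those to its right at most \<open>1 - x\<close>; as
all lengths add up to \<open>1\<close>, both bounds are attained.
\<close>

lemma cover_has_sum:
  assumes x: "0 \<le> x" "x \<le> 1" shows "((\<lambda>w. cover w x) has_sum x) L"
proof (cases "\<exists>w\<in>L. start w \<le> x \<and> x \<le> start w + len w")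
  case True
  then obtain w where w: "w \<in> L" "start w \<le> x" "x \<le> start w + len w" by blast
  have "((\<lambda>w. cover w x) has_sum (start w + cover w x)) L"
  proof (rule has_sum_point[OF w(1)])
    show "(len has_sum start w) {u \<in> L. u < w}"
      unfolding start_def by (rule has_sum_infsum) (auto intro: len_summable)
    show "cover u x = len u" if "u \<in> L" "u < w" for u
      using start_mono[OF that] w that by (intro cover_right) auto
    show "cover u x = 0" if "u \<in> L" "w < u" for u
      using start_mono[OF w(1) that(2)] w by (intro cover_left) auto
  qed
  then show ?thesis using cover_inside[OF w(2,3)] by simp
next
  case False
  define S where "S = {w \<in> L. start w + len w < x}"
  have out: "x < start w" if "w \<in> L - S" for w
    using that False by (auto simp: S_def not_less)
  have SL: "S \<subseteq> L" by (auto simp: S_def)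
  have "infsum len S \<le> x"
  proof (rule infsum_le_finite_sums)
    show "len summable_on S" using SL by (rule len_summable)
    fix T assume T: "finite T" "T \<subseteq> S"
    show "sum len T \<le> x"
    proof (cases "T = {}")
      case False
      let ?m = "Max T"
      have m: "?m \<in> S" using Max_in[OF T(1) False] T by auto
      have "sum len T = infsum len T" using T by simp
      also have "\<dots> \<le> infsum len {u \<in> L. u \<le> ?m}"
        using T SL by (intro infsum_len_mono) (auto intro: Max_ge)
      also have "\<dots> = start ?m + len ?m" using m SL by (subst start_add_len) auto
      also have "\<dots> \<le> x" using m by (simp add: S_def)
      finally show ?thesis .
    qed (use x in simp)
  qed
  moreover have "infsum len (L - S) \<le> 1 - x"
  proof (rule infsum_le_finite_sums)
    show "len summable_on (L - S)" by (rule len_summable) auto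
    fix T assume T: "finite T" "T \<subseteq> L - S"
    show "sum len T \<le> 1 - x"
    proof (cases "T = {}")
      case False
      let ?m = "Min T"
      have m: "?m \<in> L - S" using Min_in[OF T(1) False] T by auto
      have "sum len T = infsum len T" using T by simp
      also have "\<dots> \<le> infsum len {u \<in> L. ?m \<le> u}"
        using T by (intro infsum_len_mono) (auto intro: Min_le)
      also have "\<dots> = 1 - start ?m" using m by (intro infsum_len_ge) auto
      also have "\<dots> \<le> 1 - x" using out[OF m] by simp
      finally show ?thesis .
    qed (use x in simp)
  qed
  moreover have "infsum len S + infsum len (L - S) = 1"
  proof -
    have "infsum len S + infsum len (L - S) = infsum len (S \<union> (L - S))"
      using SL by (intro infsum_Un_disjoint[symmetric] len_summable) auto
    also have "S \<union> (L - S) = L" using SL by auto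
    finally show ?thesis by simp
  qed
  ultimately have "infsum len S = x" by linarith
  then have "(len has_sum x) S" using len_summable[OF SL] has_sum_infsum by blast
  then show ?thesis
    by (rule has_sum_cong_neutral[THEN iffD1, rotated 3])
       (use out SL cover_left cover_right in \<open>auto simp: S_def less_imp_le\<close>)
qed

text \<open>
The length of the part of the interval of \<open>w + v\<close> onto which the part of the interval of \<open>w\<close> to the
left of \<open>x\<close> is mapped, when the point with time \<open>t\<close> goes to the point with time \<open>t + p w\<close>.
\<close>

definition piece :: "'v \<Rightarrow> ('v \<Rightarrow> real) \<Rightarrow> 'v \<Rightarrow> real \<Rightarrow> real" where
  "piece v p w x = (if x \<le> start w then 0 else if start w + len w \<le> x then len (w + v)
     else F (w + v) (time w (x - start w) + p w))"

text \<open>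
Defining the map by summing over the pieces avoids extending it by continuity to the points outside
all intervals, and yields its increments as sums as well.
\<close>

definition act :: "'v \<Rightarrow> ('v \<Rightarrow> real) \<Rightarrow> real \<Rightarrow> real" where
  "act v p x = infsum (\<lambda>w. piece v p w x) L"

lemma piece_bounds:
  assumes "v \<in> L" "w \<in> L" shows "0 \<le> piece v p w x \<and> piece v p w x \<le> len (w + v)"
  using assms len_pos[of "w + v"] F_pos[of "w + v"] F_lt[of "w + v"]
  by (auto simp: piece_def less_imp_le)

lemma len_translate:
  assumes v: "v \<in> L" shows "((\<lambda>w. len (w + v)) has_sum 1) L"
    and "((\<lambda>w. len (w + v)) has_sum start (w + v)) {u \<in> L. u < w}"
proof -
  have image: "(\<lambda>w. w + v) ` {u \<in> L. P (u + v)} = {u \<in> L. P u}" for P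
  proof
    show "{u \<in> L. P u} \<subseteq> (\<lambda>w. w + v) ` {u \<in> L. P (u + v)}"
    proof
      fix u assume "u \<in> {u \<in> L. P u}"
      then show "u \<in> (\<lambda>w. w + v) ` {u \<in> L. P (u + v)}"
        using L_add[of u "- v"] v by (intro image_eqI[of _ _ "u - v"]) auto
    qed
  qed (use v in auto)
  have inj: "inj_on (\<lambda>w. w + v) A" for A by (auto simp: inj_on_def)
  show "((\<lambda>w. len (w + v)) has_sum 1) L"
    using has_sum_reindex[OF inj[of L], of len] image[of "\<lambda>_. True"] len_sum by (simp add: comp_def)
  have "(len has_sum start (w + v)) {u \<in> L. u < w + v}"
    unfolding start_def by (rule has_sum_infsum) (auto intro: len_summable)
  then show "((\<lambda>w. len (w + v)) has_sum start (w + v)) {u \<in> L. u < w}"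
    using has_sum_reindex[OF inj[of "{u \<in> L. u < w}"], of len] image[of "\<lambda>u. u < w + v"]
    by (simp add: comp_def)
qed

lemma piece_has_sum:
  assumes v: "v \<in> L" shows "((\<lambda>w. piece v p w x) has_sum act v p x) L"
  unfolding act_def
proof (rule has_sum_infsum, rule summable_on_comparison_test[where f = "\<lambda>w. len (w + v)"])
  show "(\<lambda>w. len (w + v)) summable_on L" using len_translate(1)[OF v] by (rule has_sum_imp_summable)
qed (use piece_bounds[OF v] in auto)

lemma piece_inside:
  assumes "w \<in> L" shows "piece v p w (start w + F w t) = F (w + v) (t + p w)"
  using F_pos[OF assms, of t] F_lt[OF assms, of t] time_F[OF assms] by (simp add: piece_def)

lemma act_inside:
  assumes v: "v \<in> L" and w: "w \<in> L"
  shows "act v p (start w + F w t) = start (w + v) + F (w + v) (t + p w)"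
proof -
  let ?x = "start w + F w t"
  have x: "start w < ?x" "?x < start w + len w" using F_pos[OF w, of t] F_lt[OF w, of t] by auto
  have "((\<lambda>w. piece v p w ?x) has_sum (start (w + v) + piece v p w ?x)) L"
  proof (rule has_sum_point[OF w _ _ len_translate(2)[OF v]])
    show "piece v p u ?x = len (u + v)" if "u \<in> L" "u < w" for u
      using start_mono[OF that] x len_pos[OF that(1)] by (auto simp: piece_def)
    show "piece v p u ?x = 0" if "u \<in> L" "w < u" for u
      using start_mono[OF w that(2)] x by (auto simp: piece_def)
  qed
  from has_sum_unique[OF piece_has_sum[OF v] this] show ?thesis
    by (simp add: piece_inside[OF w])
qed

lemma act_ends: assumes v: "v \<in> L" shows "act v p 0 = 0" "act v p 1 = 1"
proof -
  have "piece v p w 0 = 0" for w using start_nonneg[of w] by (simp add: piece_def)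
  then show "act v p 0 = 0" by (simp add: act_def)
  have "piece v p w 1 = len (w + v)" if "w \<in> L" for w
    using end_le_1[OF that] len_pos[OF that] by (auto simp: piece_def)
  then have "act v p 1 = infsum (\<lambda>w. len (w + v)) L" unfolding act_def by (intro infsum_cong)
  also have "\<dots> = 1" using len_translate(1)[OF v] by (rule infsumI)
  finally show "act v p 1 = 1" .
qed

definition ratio :: "'v \<Rightarrow> ('v \<Rightarrow> real) \<Rightarrow> 'v \<Rightarrow> real \<Rightarrow> real" where
  "ratio v p w t = \<rho> (w + v) (t + p w) / \<rho> w t"

text \<open>
The derivative of \<open>act v p\<close>. At the remaining points, which include the endpoints of all intervals,
it is \<open>1\<close>.
\<close>

definition slope :: "'v \<Rightarrow> ('v \<Rightarrow> real) \<Rightarrow> real \<Rightarrow> real" where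
  "slope v p x = (if \<exists>w\<in>L. start w < x \<and> x < start w + len w
     then (let w = (SOME w. w \<in> L \<and> start w < x \<and> x < start w + len w) in ratio v p w (time w (x - start w)))
     else 1)"

lemma intervals_disjoint:
  assumes "w \<in> L" "u \<in> L" "start w < x" "x < start w + len w" "start u < x" "x < start u + len u"
  shows "w = u"
  using assms start_mono[of w u] start_mono[of u w] by (cases w u rule: linorder_cases) auto

lemma slope_inside:
  assumes w: "w \<in> L" shows "slope v p (start w + F w t) = ratio v p w t"
proof -
  let ?x = "start w + F w t"
  have x: "start w < ?x" "?x < start w + len w" using F_pos[OF w, of t] F_lt[OF w, of t] by auto
  have "(SOME w. w \<in> L \<and> start w < ?x \<and> ?x < start w + len w) = w"
  proof (rule some_equality)
    fix u assume "u \<in> L \<and> start u < ?x \<and> ?x < start u + len u"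
    then show "u = w" using intervals_disjoint[of u w ?x] w x by blast
  qed (use x w in simp)
  moreover have "\<exists>w\<in>L. start w < ?x \<and> ?x < start w + len w" using x w by blast
  ultimately show ?thesis by (simp only: slope_def Let_def if_True add_diff_cancel_left' time_F[OF w])
qed

lemma slope_outside: "\<not> (\<exists>w\<in>L. start w < x \<and> x < start w + len w) \<Longrightarrow> slope v p x = 1"
  unfolding slope_def by (simp only: if_False)

lemma inside_cases:
  assumes "w \<in> L" "start w < x" "x < start w + len w"
  obtains t where "x = start w + F w t"
proof -
  obtain t where "F w t = x - start w" using F_onto[of w "x - start w"] assms by auto
  then show ?thesis using that[of t] by simp
qed

text \<open>
If the derivative differs from \<open>q\<close> by at most \<open>\<epsilon>\<close>, both functions \<open>(\<epsilon> + q) * F - F'\<close> and \<open>F' - (q - \<epsilon>) * F\<close>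
increase, where \<open>F'\<close> is the distribution function of the image.
\<close>

lemma piece_increment_finite:
  assumes v: "v \<in> L" and w: "w \<in> L" and st: "s \<le> t"
    and slope: "\<And>u. s \<le> u \<Longrightarrow> u \<le> t \<Longrightarrow> \<bar>ratio v p w u - q\<bar> \<le> \<epsilon>"
  shows "\<bar>(F (w + v) (t + p w) - F (w + v) (s + p w)) - q * (F w t - F w s)\<bar> \<le> \<epsilon> * (F w t - F w s)"
proof -
  have wv: "w + v \<in> L" using v w by simp
  have shifted: "((\<lambda>u. F (w + v) (u + p w)) has_real_derivative \<rho> (w + v) (u + p w)) (at u)" for u
    using F_deriv[OF wv, of "u + p w"] by (simp only: DERIV_shift)
  have der: "\<rho> (w + v) (u + p w) = ratio v p w u * \<rho> w u" for u
    using density_pos[OF w, of u] by (simp add: ratio_def)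
  have "(\<epsilon> + q) * F w s - F (w + v) (s + p w) \<le> (\<epsilon> + q) * F w t - F (w + v) (t + p w)"
  proof (rule DERIV_nonneg_imp_nondecreasing[OF st])
    fix u assume u: "s \<le> u" "u \<le> t"
    have "((\<lambda>u. (\<epsilon> + q) * F w u - F (w + v) (u + p w)) has_real_derivative (\<epsilon> + q) * \<rho> w u - \<rho> (w + v) (u + p w)) (at u)"
      by (intro DERIV_diff DERIV_cmult F_deriv[OF w] shifted)
    moreover have "(\<epsilon> + q) * \<rho> w u - \<rho> (w + v) (u + p w) = (\<epsilon> + q - ratio v p w u) * \<rho> w u"
      by (simp add: der left_diff_distrib)
    moreover have "(\<epsilon> + q - ratio v p w u) * \<rho> w u \<ge> 0"
      using slope[OF u] density_pos[OF w, of u] by (intro mult_nonneg_nonneg) auto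
    ultimately show "\<exists>y. ((\<lambda>u. (\<epsilon> + q) * F w u - F (w + v) (u + p w)) has_real_derivative y) (at u) \<and> 0 \<le> y"
      by metis
  qed
  moreover have "F (w + v) (s + p w) - (q - \<epsilon>) * F w s \<le> F (w + v) (t + p w) - (q - \<epsilon>) * F w t"
  proof (rule DERIV_nonneg_imp_nondecreasing[OF st])
    fix u assume u: "s \<le> u" "u \<le> t"
    have "((\<lambda>u. F (w + v) (u + p w) - (q - \<epsilon>) * F w u) has_real_derivative \<rho> (w + v) (u + p w) - (q - \<epsilon>) * \<rho> w u) (at u)"
      by (intro DERIV_diff DERIV_cmult F_deriv[OF w] shifted)
    moreover have "\<rho> (w + v) (u + p w) - (q - \<epsilon>) * \<rho> w u = (ratio v p w u - (q - \<epsilon>)) * \<rho> w u"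
      by (simp add: der left_diff_distrib)
    moreover have "(ratio v p w u - (q - \<epsilon>)) * \<rho> w u \<ge> 0"
      using slope[OF u] density_pos[OF w, of u] by (intro mult_nonneg_nonneg) auto
    ultimately show "\<exists>y. ((\<lambda>u. F (w + v) (u + p w) - (q - \<epsilon>) * F w u) has_real_derivative y) (at u) \<and> 0 \<le> y"
      by metis
  qed
  ultimately show ?thesis by (simp add: abs_le_iff algebra_simps)
qed

text \<open>
The same estimate for arbitrary bounds \<open>x\<close> and \<open>y\<close>: a bound inside the interval corresponds to a time,
and a bound outside it is approximated by letting the time tend to infinity.
\<close>

lemma piece_increment:
  assumes v: "v \<in> L" and w: "w \<in> L" and xy: "x \<le> y"
    and slope: "\<And>z. x \<le> z \<Longrightarrow> z \<le> y \<Longrightarrow> \<bar>slope v p z - q\<bar> \<le> \<epsilon>"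
  shows "\<bar>(piece v p w y - piece v p w x) - q * (cover w y - cover w x)\<bar> \<le> \<epsilon> * (cover w y - cover w x)"
proof -
  consider "y \<le> start w" | "start w + len w \<le> x" | "start w < y" "x < start w + len w" by linarith
  then show ?thesis
  proof cases
    case 1
    then show ?thesis using xy by (simp add: piece_def cover_left)
  next
    case 2
    then show ?thesis using xy len_pos[OF w] by (simp add: piece_def cover_right[OF w])
  next
    case 3
    have wv: "w + v \<in> L" using v w by simp
    have fin: "\<bar>(F (w + v) (t + p w) - F (w + v) (s + p w)) - q * (F w t - F w s)\<bar> \<le> \<epsilon> * (F w t - F w s)"
      if "s \<le> t" "x \<le> start w + F w s" "start w + F w t \<le> y" for s t
    proof (rule piece_increment_finite[OF v w that(1)])
      fix u assume "s \<le> u" "u \<le> t"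
      then show "\<bar>ratio v p w u - q\<bar> \<le> \<epsilon>"
        using slope[of "start w + F w u"] F_le[OF w, of s u] F_le[OF w, of u t] that
        by (simp add: slope_inside[OF w])
    qed
    have right: "\<bar>(piece v p w y - F (w + v) (s + p w)) - q * (cover w y - F w s)\<bar> \<le> \<epsilon> * (cover w y - F w s)"
      if s: "x \<le> start w + F w s" "start w + F w s \<le> y" for s
    proof (cases "y < start w + len w")
      case True
      then obtain t where t: "y = start w + F w t" using inside_cases[OF w] 3 by blast
      then have "s \<le> t" using s F_less_iff[OF w, of t s] by (simp add: not_less[symmetric])
      then show ?thesis
        using fin[of s t] s t F_pos[OF w, of t] True by (simp add: piece_inside[OF w] cover_inside)
    next
      case False
      then have y: "piece v p w y = len (w + v)" "cover w y = len w"
        using 3 by (auto simp: piece_def cover_right[OF w])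
      have "\<forall>\<^sub>F t in at_top. \<bar>(F (w + v) (t + p w) - F (w + v) (s + p w)) - q * (F w t - F w s)\<bar> \<le> \<epsilon> * (F w t - F w s)"
        using eventually_ge_at_top[of s]
      proof eventually_elim
        case (elim t)
        then show ?case using fin[of s t] s F_lt[OF w, of t] False by simp
      qed
      moreover have top: "((\<lambda>t. F (w + v) (t + p w)) \<longlongrightarrow> len (w + v)) at_top"
      proof (rule filterlim_compose[OF F_top[OF wv]])
        show "filterlim (\<lambda>t. t + p w) at_top at_top"
          by (subst add.commute) (rule filterlim_tendsto_add_at_top[OF tendsto_const filterlim_ident])
      qed
      ultimately show ?thesis unfolding y
        by (intro tendsto_le[of at_top, rotated 2]) (auto intro!: tendsto_intros F_top[OF w])
    qed
    show ?thesis
    proof (cases "start w < x")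
      case True
      then obtain s where s: "x = start w + F w s" using inside_cases[OF w] 3 by blast
      then show ?thesis
        using right[of s] xy F_pos[OF w, of s] F_lt[OF w, of s] by (simp add: piece_inside[OF w] cover_inside)
    next
      case False
      then have x: "piece v p w x = 0" "cover w x = 0" by (auto simp: piece_def cover_left)
      have "\<forall>\<^sub>F s in at_bot. F w s < y - start w"
        using 3 by (intro order_tendstoD(2)[OF F_bot[OF w]]) simp
      then have "\<forall>\<^sub>F s in at_bot. \<bar>(piece v p w y - F (w + v) (s + p w)) - q * (cover w y - F w s)\<bar> \<le> \<epsilon> * (cover w y - F w s)"
      proof eventually_elim
        case (elim s)
        then show ?case using right[of s] False F_pos[OF w, of s] by simp
      qed
      moreover have bot: "((\<lambda>t. F (w + v) (t + p w)) \<longlongrightarrow> 0) at_bot"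
      proof (rule filterlim_compose[OF F_bot[OF wv]])
        show "filterlim (\<lambda>t. t + p w) at_bot at_bot"
          by (subst add.commute) (simp add: filterlim_tendsto_add_at_bot_iff[OF tendsto_const] filterlim_ident)
      qed
      ultimately show ?thesis unfolding x
      proof (intro tendsto_le[of at_bot, rotated 2])
        show "((\<lambda>s. \<bar>(piece v p w y - F (w + v) (s + p w)) - q * (cover w y - F w s)\<bar>)
            \<longlongrightarrow> \<bar>(piece v p w y - 0) - q * (cover w y - 0)\<bar>) at_bot"
          by (intro tendsto_intros bot F_bot[OF w])
        show "((\<lambda>s. \<epsilon> * (cover w y - F w s)) \<longlongrightarrow> \<epsilon> * (cover w y - 0)) at_bot"
          by (intro tendsto_intros F_bot[OF w])
      qed auto
    qed
  qed
qed

text \<open>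
Sum of the estimates for the pieces, since the parts of the intervals between \<open>x\<close> and \<open>y\<close> add up to
\<open>y - x\<close>.
\<close>

lemma act_increment:
  assumes v: "v \<in> L" and xy: "0 \<le> x" "x \<le> y" "y \<le> 1"
    and slope: "\<And>z. x \<le> z \<Longrightarrow> z \<le> y \<Longrightarrow> \<bar>slope v p z - q\<bar> \<le> \<epsilon>"
  shows "\<bar>act v p y - act v p x - q * (y - x)\<bar> \<le> \<epsilon> * (y - x)"
proof -
  have c: "((\<lambda>w. cover w y - cover w x) has_sum (y - x)) L"
    using cover_has_sum[of y] cover_has_sum[of x] xy by (intro has_sum_diff_real) auto
  have s: "((\<lambda>w. (piece v p w y - piece v p w x) - q * (cover w y - cover w x)) has_sum (act v p y - act v p x - q * (y - x))) L"
    by (intro has_sum_diff_real has_sum_cmult_right c piece_has_sum v)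
  have e: "((\<lambda>w. \<epsilon> * (cover w y - cover w x)) has_sum (\<epsilon> * (y - x))) L"
    by (intro has_sum_cmult_right c)
  note inc = piece_increment[OF v _ xy(2) slope]
  have "act v p y - act v p x - q * (y - x) \<le> \<epsilon> * (y - x)"
    by (rule has_sum_mono[OF s e]) (use inc in \<open>simp add: abs_le_iff\<close>)
  moreover have "- (\<epsilon> * (y - x)) \<le> act v p y - act v p x - q * (y - x)"
  proof (rule has_sum_mono[OF _ s])
    show "((\<lambda>w. - (\<epsilon> * (cover w y - cover w x))) has_sum - (\<epsilon> * (y - x))) L"
      using e by (simp only: has_sum_uminus)  simp
    show "- (\<epsilon> * (cover w y - cover w x)) \<le> (piece v p w y - piece v p w x) - q * (cover w y - cover w x)"
      if "w \<in> L" for w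
      using inc[OF that] unfolding abs_le_iff by linarith
  qed
  ultimately show ?thesis by (simp add: abs_le_iff)
qed

end

context ordered_interval_flow
begin

text \<open>
The condition under which \<open>act v p\<close> has an \<open>\<alpha>\<close>-Hoelder derivative: uniform Hoelder continuity inside
the intervals, and derivative \<open>1\<close> at their endpoints.
\<close>

definition tame :: "real \<Rightarrow> 'v \<Rightarrow> ('v \<Rightarrow> real) \<Rightarrow> bool" where
  "tame \<alpha> v p \<longleftrightarrow> v \<in> L \<and>
     (\<exists>C\<ge>0. \<forall>w\<in>L. \<forall>s t. s \<le> t \<longrightarrow> \<bar>ratio v p w t - ratio v p w s\<bar> \<le> C * (F w t - F w s) powr \<alpha>) \<and>
     (\<forall>w\<in>L. (ratio v p w \<longlongrightarrow> 1) at_top \<and> (ratio v p w \<longlongrightarrow> 1) at_bot)"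

text \<open>
Points of different intervals are compared via the endpoints between them, where the derivative is \<open>1\<close>;
this costs a factor of \<open>2\<close>.
\<close>

lemma slope_Holder:
  assumes tame: "tame \<alpha> v p" and \<alpha>: "\<alpha> > 0"
  shows "\<exists>C\<ge>0. \<forall>x y. x \<le> y \<longrightarrow> \<bar>slope v p x - slope v p y\<bar> \<le> C * (y - x) powr \<alpha>"
proof -
  obtain C where C: "C \<ge> 0" and v: "v \<in> L"
    and hold: "\<And>w s t. w \<in> L \<Longrightarrow> s \<le> t \<Longrightarrow> \<bar>ratio v p w t - ratio v p w s\<bar> \<le> C * (F w t - F w s) powr \<alpha>"
    and top: "\<And>w. w \<in> L \<Longrightarrow> (ratio v p w \<longlongrightarrow> 1) at_top"
    and bot: "\<And>w. w \<in> L \<Longrightarrow> (ratio v p w \<longlongrightarrow> 1) at_bot"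
    using tame unfolding tame_def by metis
  have right: "\<bar>slope v p x - 1\<bar> \<le> C * (y - x) powr \<alpha>"
    if w: "w \<in> L" "start w < x" "x < start w + len w" "start w + len w \<le> y" for w x y
  proof -
    obtain t where t: "x = start w + F w t" using inside_cases[OF w(1-3)] by blast
    have "\<bar>ratio v p w t - 1\<bar> \<le> C * (y - x) powr \<alpha>"
    proof (rule tendsto_upperbound)
      show "((\<lambda>s. \<bar>ratio v p w t - ratio v p w s\<bar>) \<longlongrightarrow> \<bar>ratio v p w t - 1\<bar>) at_top"
        by (intro tendsto_intros top w)
      show "\<forall>\<^sub>F s in at_top. \<bar>ratio v p w t - ratio v p w s\<bar> \<le> C * (y - x) powr \<alpha>"
        using eventually_ge_at_top[of t]
      proof eventually_elim
        case (elim s)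
        have "\<bar>ratio v p w s - ratio v p w t\<bar> \<le> C * (F w s - F w t) powr \<alpha>"
          by (rule hold[OF w(1) elim])
        also have "\<dots> \<le> C * (y - x) powr \<alpha>"
          using C \<alpha> F_le[OF w(1) elim] F_lt[OF w(1), of s] w t
          by (intro mult_left_mono powr_mono2) auto
        finally show ?case by (simp add: abs_minus_commute)
      qed
    qed simp
    then show ?thesis using slope_inside[OF w(1), of v p t] t by simp
  qed
  have left: "\<bar>slope v p y - 1\<bar> \<le> C * (y - x) powr \<alpha>"
    if w: "w \<in> L" "start w < y" "y < start w + len w" "x \<le> start w" for w x y
  proof -
    obtain t where t: "y = start w + F w t" using inside_cases[OF w(1-3)] by blast
    have "\<bar>ratio v p w t - 1\<bar> \<le> C * (y - x) powr \<alpha>"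
    proof (rule tendsto_upperbound)
      show "((\<lambda>s. \<bar>ratio v p w t - ratio v p w s\<bar>) \<longlongrightarrow> \<bar>ratio v p w t - 1\<bar>) at_bot"
        by (intro tendsto_intros bot w)
      show "\<forall>\<^sub>F s in at_bot. \<bar>ratio v p w t - ratio v p w s\<bar> \<le> C * (y - x) powr \<alpha>"
        using eventually_le_at_bot[of t]
      proof eventually_elim
        case (elim s)
        have "\<bar>ratio v p w t - ratio v p w s\<bar> \<le> C * (F w t - F w s) powr \<alpha>"
          by (rule hold[OF w(1) elim])
        also have "\<dots> \<le> C * (y - x) powr \<alpha>"
          using C \<alpha> F_le[OF w(1) elim] F_pos[OF w(1), of s] w t
          by (intro mult_left_mono powr_mono2) auto
        finally show ?case .
      qed
    qed simp
    then show ?thesis using slope_inside[OF w(1), of v p t] t by simp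
  qed
  let ?in = "\<lambda>w x. w \<in> L \<and> start w < x \<and> x < start w + len w"
  have "\<bar>slope v p x - slope v p y\<bar> \<le> 2 * C * (y - x) powr \<alpha>" if xy: "x \<le> y" for x y
  proof (cases "\<exists>w. ?in w x \<and> ?in w y")
    case True
    then obtain w where w: "?in w x" "?in w y" by blast
    obtain s where s: "x = start w + F w s" using inside_cases[of w x] w by blast
    obtain t where t: "y = start w + F w t" using inside_cases[of w y] w by blast
    have wL: "w \<in> L" using w by simp
    have "s \<le> t" using xy s t F_less_iff[OF wL, of t s] by simp
    from hold[OF wL this] have "\<bar>slope v p y - slope v p x\<bar> \<le> C * (y - x) powr \<alpha>"
      using slope_inside[OF wL] s t by simp
    moreover have "C * (y - x) powr \<alpha> \<ge> 0" using C by simp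
    ultimately show ?thesis by (simp add: abs_minus_commute)
  next
    case False
    have "\<bar>slope v p x - 1\<bar> \<le> C * (y - x) powr \<alpha>"
    proof (cases "\<exists>w. ?in w x")
      case True
      then obtain w where w: "?in w x" by blast
      then have "start w + len w \<le> y" using False xy by force
      then show ?thesis using right[of w x y] w by simp
    next
      case out: False
      then have "slope v p x = 1" by (intro slope_outside) auto
      then show ?thesis using C by simp
    qed
    moreover have "\<bar>slope v p y - 1\<bar> \<le> C * (y - x) powr \<alpha>"
    proof (cases "\<exists>w. ?in w y")
      case True
      then obtain w where w: "?in w y" by blast
      then have "x \<le> start w" using False xy by force
      then show ?thesis using left[of w y x] w by simp
    next
      case out: False
      then have "slope v p y = 1" by (intro slope_outside) auto
      then show ?thesis using C by simp
    qed
    ultimately show ?thesis by linarith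
  qed
  then show ?thesis using C by (intro exI[of _ "2 * C"]) auto
qed

text \<open>
Between \<open>x\<close> and \<open>y\<close> the slope deviates from \<open>slope v p x\<close> by at most a multiple of \<open>|y - x| powr \<alpha>\<close>, so
by \<open>act_increment\<close> the difference quotient does as well.
\<close>

lemma act_deriv:
  assumes tame: "tame \<alpha> v p" and \<alpha>: "\<alpha> > 0" and x: "x \<in> {0..1}"
  shows "(act v p has_real_derivative slope v p x) (at x within {0..1})"
proof -
  have v: "v \<in> L" using tame by (simp add: tame_def)
  obtain C where C: "C \<ge> 0" and hold: "\<And>x y. x \<le> y \<Longrightarrow> \<bar>slope v p x - slope v p y\<bar> \<le> C * (y - x) powr \<alpha>"
    using slope_Holder[OF tame \<alpha>] by blast
  have bound: "\<bar>(act v p y - act v p x) / (y - x) - slope v p x\<bar> \<le> C * \<bar>y - x\<bar> powr \<alpha>"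
    if y: "y \<in> {0..1}" "y \<noteq> x" for y
  proof -
    have "\<bar>act v p y - act v p x - slope v p x * (y - x)\<bar> \<le> (C * \<bar>y - x\<bar> powr \<alpha>) * \<bar>y - x\<bar>"
    proof (cases "x < y")
      case True
      have "\<bar>slope v p z - slope v p x\<bar> \<le> C * (y - x) powr \<alpha>" if "x \<le> z" "z \<le> y" for z
      proof -
        have "\<bar>slope v p x - slope v p z\<bar> \<le> C * (z - x) powr \<alpha>" by (rule hold[OF that(1)])
        also have "\<dots> \<le> C * (y - x) powr \<alpha>" using that C \<alpha> by (intro mult_left_mono powr_mono2) auto
        finally show ?thesis by (simp add: abs_minus_commute)
      qed
      from act_increment[OF v _ _ _ this, of x y] show ?thesis using True x y by simp
    next
      case False
      then have yx: "y < x" using y by simp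
      have "\<bar>slope v p z - slope v p x\<bar> \<le> C * (x - y) powr \<alpha>" if "y \<le> z" "z \<le> x" for z
      proof -
        have "\<bar>slope v p z - slope v p x\<bar> \<le> C * (x - z) powr \<alpha>" by (rule hold[OF that(2)])
        also have "\<dots> \<le> C * (x - y) powr \<alpha>" using that C \<alpha> by (intro mult_left_mono powr_mono2) auto
        finally show ?thesis .
      qed
      from act_increment[OF v _ _ _ this, of y x]
      have "\<bar>act v p x - act v p y - slope v p x * (x - y)\<bar> \<le> C * (x - y) powr \<alpha> * (x - y)"
        using yx x y by simp
      moreover have "act v p x - act v p y - slope v p x * (x - y) = - (act v p y - act v p x - slope v p x * (y - x))"
        by (simp add: algebra_simps)
      ultimately show ?thesis using yx by (simp only: abs_minus_cancel) (simp add: abs_if)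
    qed
    moreover have "(act v p y - act v p x) / (y - x) - slope v p x = (act v p y - act v p x - slope v p x * (y - x)) / (y - x)"
      using y by (simp add: field_simps)
    ultimately show ?thesis using y by (simp add: abs_divide divide_le_eq)
  qed
  have "((\<lambda>y. C * \<bar>y - x\<bar> powr \<alpha>) \<longlongrightarrow> C * \<bar>x - x\<bar> powr \<alpha>) (at x within {0..1})"
    using \<alpha> by (intro tendsto_intros tendsto_powr') auto
  then have lim: "((\<lambda>y. C * \<bar>y - x\<bar> powr \<alpha>) \<longlongrightarrow> 0) (at x within {0..1})" using \<alpha> by simp
  have "((\<lambda>y. (act v p y - act v p x) / (y - x) - slope v p x) \<longlongrightarrow> 0) (at x within {0..1})"
    by (rule Lim_null_comparison[OF _ lim]) (use bound in \<open>auto simp: eventually_at_filter\<close>)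
  then show ?thesis by (simp add: has_field_derivative_iff LIM_zero_iff)
qed

lemma act_continuous:
  assumes "tame \<alpha> v p" "\<alpha> > 0" shows "continuous_on {0..1} (act v p)"
  using act_deriv[OF assms] by (intro DERIV_continuous_on) auto

lemma slope_continuous:
  assumes "tame \<alpha> v p" "\<alpha> > 0" shows "continuous_on {0..1} (slope v p)"
proof -
  obtain C where C: "C \<ge> 0" and hold: "\<And>x y. x \<le> y \<Longrightarrow> \<bar>slope v p x - slope v p y\<bar> \<le> C * (y - x) powr \<alpha>"
    using slope_Holder[OF assms] by blast
  show ?thesis unfolding continuous_on_def
  proof
    fix x :: real
    have "((\<lambda>y. C * \<bar>y - x\<bar> powr \<alpha>) \<longlongrightarrow> C * \<bar>x - x\<bar> powr \<alpha>) (at x within {0..1})"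
      using assms by (intro tendsto_intros tendsto_powr') auto
    then have lim: "((\<lambda>y. C * \<bar>y - x\<bar> powr \<alpha>) \<longlongrightarrow> 0) (at x within {0..1})" using assms by simp
    have "\<bar>slope v p y - slope v p x\<bar> \<le> C * \<bar>y - x\<bar> powr \<alpha>" for y
      using hold[of x y] hold[of y x] by (cases "x \<le> y") (auto simp: abs_minus_commute)
    then have "((\<lambda>y. slope v p y - slope v p x) \<longlongrightarrow> 0) (at x within {0..1})"
      by (intro Lim_null_comparison[OF _ lim]) auto
    then show "(slope v p \<longlongrightarrow> slope v p x) (at x within {0..1})" by (simp add: LIM_zero_iff)
  qed
qed

lemma act_mono:
  assumes v: "v \<in> L" and xy: "x \<le> y" shows "act v p x \<le> act v p y"
proof (rule has_sum_mono[OF piece_has_sum[OF v] piece_has_sum[OF v]])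
  fix w assume w: "w \<in> L"
  have wv: "w + v \<in> L" using v w by simp
  show "piece v p w x \<le> piece v p w y"
  proof (cases "start w < x \<and> y < start w + len w")
    case True
    obtain s where s: "x = start w + F w s" using inside_cases[OF w, of x] True xy by auto
    obtain t where t: "y = start w + F w t" using inside_cases[OF w, of y] True xy by auto
    have "s \<le> t" using xy s t F_less_iff[OF w, of t s] by simp
    then show ?thesis using s t by (simp add: piece_inside[OF w] F_le[OF wv])
  next
    case False
    then have "piece v p w x = 0 \<or> piece v p w y = len (w + v)"
      using len_pos[OF w] by (auto simp: piece_def)
    then show ?thesis using piece_bounds[OF v w, of p x] piece_bounds[OF v w, of p y] by auto
  qed
qed

lemma act_unit: "v \<in> L \<Longrightarrow> x \<in> {0..1} \<Longrightarrow> act v p x \<in> {0..1}"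
  using act_mono[of v 0 x p] act_mono[of v x 1 p] act_ends[of v p] by auto

lemma inside_dense:
  assumes cd: "0 \<le> c" "c < d" "d \<le> 1"
  shows "\<exists>w\<in>L. \<exists>t. c < start w + F w t \<and> start w + F w t < d"
proof -
  have "((\<lambda>w. cover w d - cover w c) has_sum (d - c)) L"
    using cover_has_sum[of c] cover_has_sum[of d] cd by (intro has_sum_diff_real) auto
  moreover have "\<exists>w\<in>L. cover w d - cover w c \<noteq> 0"
  proof (rule ccontr)
    assume "\<not> ?thesis"
    then have "((\<lambda>w. cover w d - cover w c) has_sum 0) L" by (intro has_sum_0) auto
    with \<open>((\<lambda>w. cover w d - cover w c) has_sum (d - c)) L\<close> have "d - c = 0" by (rule has_sum_unique)
    with cd show False by simp
  qed
  ultimately obtain w where w: "w \<in> L" "cover w d \<noteq> cover w c" by auto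
  then have *: "start w < d" "c < start w + len w"
    using cover_left[of d w] cover_left[of c w] cover_right[of w c] cover_right[of w d] cd by (force simp: not_less[symmetric])+
  define z where "z = (max c (start w) + min d (start w + len w)) / 2"
  have z: "max c (start w) < z" "z < min d (start w + len w)"
    using * cd len_pos[OF w(1)] by (auto simp: z_def)
  obtain t where "z = start w + F w t" using inside_cases[OF w(1), of z] z by auto
  with z w show ?thesis by force
qed

lemma continuous_eq_from_inside:
  fixes f g :: "real \<Rightarrow> real"
  assumes f: "continuous_on {0..1} f" and g: "continuous_on {0..1} g"
    and eq: "\<And>w t. w \<in> L \<Longrightarrow> f (start w + F w t) = g (start w + F w t)" and x: "x \<in> {0..1}"
  shows "f x = g x"
proof (rule ccontr)
  assume "f x \<noteq> g x"
  then have pos: "\<bar>f x - g x\<bar> > 0" by simp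
  have "continuous_on {0..1} (\<lambda>y. f y - g y)" by (intro continuous_intros f g)
  then obtain e where e: "e > 0" "\<And>y. y \<in> {0..1} \<Longrightarrow> \<bar>y - x\<bar> < e \<Longrightarrow> \<bar>(f y - g y) - (f x - g x)\<bar> < \<bar>f x - g x\<bar>"
    using x pos unfolding continuous_on_iff dist_real_def by metis
  define c where "c = max 0 (x - e / 2)"
  define d where "d = min 1 (x + e / 2)"
  have cd: "0 \<le> c" "c < d" "d \<le> 1" using x e(1) by (auto simp: c_def d_def)
  obtain w t where w: "w \<in> L" and t: "c < start w + F w t" "start w + F w t < d"
    using inside_dense[OF cd] by blast
  let ?y = "start w + F w t"
  have "x - e / 2 \<le> c" "d \<le> x + e / 2" by (simp_all add: c_def d_def)
  then have "?y \<in> {0..1}" "\<bar>?y - x\<bar> < e" using t cd e(1) by auto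
  from e(2)[OF this] show False by (simp add: eq[OF w])
qed

text \<open>
Both sides are continuous and agree at the points inside intervals, which are dense.
\<close>

lemma act_mult:
  assumes t1: "tame \<alpha> v p" and t2: "tame \<alpha> v' p'" and t3: "tame \<alpha> (v + v') (\<lambda>w. p (w + v') + p' w)"
    and \<alpha>: "\<alpha> > 0" and x: "x \<in> {0..1}"
  shows "act v p (act v' p' x) = act (v + v') (\<lambda>w. p (w + v') + p' w) x"
proof (rule continuous_eq_from_inside[OF _ _ _ x])
  have L: "v \<in> L" "v' \<in> L" using t1 t2 by (simp_all add: tame_def)
  show "continuous_on {0..1} (\<lambda>x. act v p (act v' p' x))"
    by (rule continuous_on_compose2[OF act_continuous[OF t1 \<alpha>] act_continuous[OF t2 \<alpha>]]) (use act_unit[OF L(2)] in blast)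
  show "continuous_on {0..1} (act (v + v') (\<lambda>w. p (w + v') + p' w))" by (rule act_continuous[OF t3 \<alpha>])
  fix w t assume w: "w \<in> L"
  show "act v p (act v' p' (start w + F w t)) = act (v + v') (\<lambda>w. p (w + v') + p' w) (start w + F w t)"
  proof -
    have wv: "w + v' \<in> L" using w L by simp
    have "act v' p' (start w + F w t) = start (w + v') + F (w + v') (t + p' w)"
      by (rule act_inside[OF L(2) w])
    moreover have "act v p \<dots> = start (w + v' + v) + F (w + v' + v) (t + p' w + p (w + v'))"
      by (rule act_inside[OF L(1) wv])
    moreover have "act (v + v') (\<lambda>w. p (w + v') + p' w) (start w + F w t)
        = start (w + (v + v')) + F (w + (v + v')) (t + (p (w + v') + p' w))"
      using L by (intro act_inside w) simp
    moreover have "w + v' + v = w + (v + v')" "t + p' w + p (w + v') = t + (p (w + v') + p' w)"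
      by (simp_all add: ac_simps)
    ultimately show ?thesis by (simp only:)
  qed
qed

lemma act_zero:
  assumes "x \<in> {0..1}" shows "act 0 (\<lambda>_. 0) x = x"
proof -
  have "piece 0 (\<lambda>_. 0) w x = cover w x" if w: "w \<in> L" for w
  proof -
    consider "x \<le> start w" | "start w + len w \<le> x" | "start w < x" "x < start w + len w" by linarith
    then show ?thesis
    proof cases
      case 3
      then show ?thesis using F_time[OF w, of "x - start w"] by (simp add: piece_def cover_inside)
    qed (use len_pos[OF w] in \<open>auto simp: piece_def cover_left cover_right[OF w]\<close>)
  qed
  then have "act 0 (\<lambda>_. 0) x = infsum (\<lambda>w. cover w x) L" unfolding act_def by (intro infsum_cong)
  also have "\<dots> = x" using cover_has_sum[of x] assms by (intro infsumI) auto
  finally show ?thesis .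
qed

lemma act_Diff:
  assumes t1: "tame \<alpha> v p" and t2: "tame \<alpha> (- v) (\<lambda>w. - p (w - v))" and \<alpha>: "\<alpha> > 0"
  shows "restrict (act v p) {0..1} \<in> carrier (Diff_plus 1 \<alpha>)"
proof -
  have v: "v \<in> L" "- v \<in> L" using t1 t2 by (simp_all add: tame_def)
  have "ratio 0 (\<lambda>_. 0) w t = 1" if "w \<in> L" for w t
    using density_pos[OF that, of t] by (simp add: ratio_def)
  then have ratio1: "ratio 0 (\<lambda>_. 0) w = (\<lambda>_. 1)" if "w \<in> L" for w
    using that by (intro ext)
  have id: "tame \<alpha> 0 (\<lambda>_. 0)" unfolding tame_def
    by (rule conjI, simp, rule conjI, rule exI[of _ 0]) (simp_all add: ratio1)
  have e1: "v + - v = 0" "(\<lambda>w. p (w + - v) + - p (w - v)) = (\<lambda>_. 0)"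
    and e2: "- v + v = 0" "(\<lambda>w. - p (w + v - v) + p w) = (\<lambda>_. 0)" by simp_all
  have t3: "tame \<alpha> (v + - v) (\<lambda>w. p (w + - v) + - p (w - v))"
    unfolding e1 by (rule id)
  have t4: "tame \<alpha> (- v + v) (\<lambda>w. - p (w + v - v) + p w)"
    unfolding e2 by (rule id)
  have inv1: "act v p (act (- v) (\<lambda>w. - p (w - v)) x) = x" if "x \<in> {0..1}" for x
    unfolding act_mult[OF t1 t2 t3 \<alpha> that] e1 by (rule act_zero[OF that])
  have inv2: "act (- v) (\<lambda>w. - p (w - v)) (act v p x) = x" if "x \<in> {0..1}" for x
    unfolding act_mult[OF t2 t1 t4 \<alpha> that] e2 by (rule act_zero[OF that])
  let ?f = "restrict (act v p) {0..1}" and ?h = "act (- v) (\<lambda>w. - p (w - v))"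
  have bij: "bij_betw (act v p) {0..1} {0..1}"
  proof (rule bij_betwI[of _ _ _ ?h])
    show "act v p \<in> {0..1} \<rightarrow> {0..1}" using act_unit[OF v(1)] by (rule Pi_I)
    show "?h \<in> {0..1} \<rightarrow> {0..1}" using act_unit[OF v(2)] by (rule Pi_I)
  qed (fact inv1 inv2)+
  then have bij': "bij_betw ?f {0..1} {0..1}"
    by (rule bij_betw_cong[THEN iffD1, rotated]) simp
  have inv: "inv_into {0..1} ?f x = ?h x" if "x \<in> {0..1}" for x
  proof (rule inv_into_f_eq)
    show "inj_on ?f {0..1}" using bij' by (rule bij_betw_imp_inj_on)
    show hx: "?h x \<in> {0..1}" by (rule act_unit[OF v(2) that])
    show "?f (?h x) = x" using inv1[OF that] hx by (simp only: restrict_apply if_True)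
  qed
  have mono: "strict_mono_on {0..1} ?f"
  proof (rule strict_mono_onI)
    fix x y :: real assume xy: "x \<in> {0..1}" "y \<in> {0..1}" "x < y"
    have "act v p x \<noteq> act v p y" using inv2[OF xy(1)] inv2[OF xy(2)] xy(3) by (metis less_irrefl)
    moreover have "act v p x \<le> act v p y" using act_mono[OF v(1)] xy by simp
    ultimately show "?f x < ?f y" using xy by simp
  qed
  have C1: "C_on_unit 1 f \<and> (\<forall>x\<in>{0..1}. unit_deriv 1 f x = slope u r x)"
    if u: "tame \<alpha> u r" and eq: "\<And>x. x \<in> {0..1} \<Longrightarrow> f x = act u r x" for f u r
  proof -
    have der: "(f has_real_derivative slope u r x) (at x within {0..1})" if x: "x \<in> {0..1}" for x
      by (rule has_field_derivative_transform_within[OF act_deriv[OF u \<alpha> x], of 1]) (use x eq in auto)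
    then have ud: "unit_deriv 1 f x = slope u r x" if "x \<in> {0..1}" for x
      using that at_within_unit_nontrivial[OF that]
      by (simp add: has_real_derivative_iff_has_vector_derivative vector_derivative_within)
    have "continuous_on {0..1} (unit_deriv 1 f)"
      using slope_continuous[OF u \<alpha>] by (rule continuous_on_eq) (simp only: ud)
    moreover have "f differentiable_on {0..1}"
      unfolding differentiable_on_def real_differentiable_def using der by blast
    ultimately have "C_on_unit 1 f" unfolding C_on_unit_def by simp
    with ud show ?thesis by blast
  qed
  have "C_on_unit 1 ?f \<and> (\<forall>x\<in>{0..1}. unit_deriv 1 ?f x = slope v p x)"
    by (rule C1[OF t1]) simp
  then have f: "C_on_unit 1 ?f" "\<And>x. x \<in> {0..1} \<Longrightarrow> unit_deriv 1 ?f x = slope v p x"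
    by blast+
  have "C_on_unit 1 (inv_into {0..1} ?f) \<and> (\<forall>x\<in>{0..1}. unit_deriv 1 (inv_into {0..1} ?f) x = slope (- v) (\<lambda>w. - p (w - v)) x)"
    by (rule C1[OF t2]) (rule inv)
  then have g: "C_on_unit 1 (inv_into {0..1} ?f)" ..
  obtain C where C: "C \<ge> 0" "\<And>x y. x \<le> y \<Longrightarrow> \<bar>slope v p x - slope v p y\<bar> \<le> C * (y - x) powr \<alpha>"
    using slope_Holder[OF t1 \<alpha>] by blast
  have C': "\<bar>slope v p x - slope v p y\<bar> \<le> C * \<bar>x - y\<bar> powr \<alpha>" for x y
    using C(2)[of x y] C(2)[of y x] by (cases "x \<le> y") (simp_all add: abs_minus_commute)
  have "holder_on_unit \<alpha> (unit_deriv 1 ?f)"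
    unfolding holder_on_unit_def
  proof (intro exI[of _ C] ballI)
    fix x y :: real assume "x \<in> {0..1}" "y \<in> {0..1}"
    then show "\<bar>unit_deriv 1 ?f x - unit_deriv 1 ?f y\<bar> \<le> C * \<bar>x - y\<bar> powr \<alpha>"
      unfolding f(2)[OF \<open>x \<in> {0..1}\<close>] f(2)[OF \<open>y \<in> {0..1}\<close>] by (intro C')
  qed
  then show ?thesis
    unfolding Diff_plus_carrier Bij_def using bij' mono f(1) g by blast
qed

end

section \<open>A family of densities with slowly varying ratios\<close>

lemma increasing_bounded_limit_at_top:
  fixes f :: "real \<Rightarrow> real"
  assumes mono: "\<And>x y. x \<le> y \<Longrightarrow> f x \<le> f y" and bound: "\<And>x. f x \<le> B"
  shows "(f \<longlongrightarrow> (SUP x. f x)) at_top"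
proof (rule order_tendstoI)
  have bdd: "bdd_above (range f)" using bound by (intro bdd_aboveI) auto
  fix y assume "y < (SUP x. f x)"
  then obtain x where x: "y < f x" using less_cSUP_iff[OF _ bdd] by auto
  show "\<forall>\<^sub>F t in at_top. y < f t"
    using eventually_ge_at_top[of x]
  proof eventually_elim
    case (elim t)
    then show ?case using x mono[of x t] by simp
  qed
next
  have bdd: "bdd_above (range f)" using bound by (intro bdd_aboveI) auto
  fix y assume y: "(SUP x. f x) < y"
  have "f t < y" for t using cSUP_upper[OF UNIV_I bdd, of t] y by simp
  then show "\<forall>\<^sub>F t in at_top. f t < y" by simp
qed

text \<open>
Comparison with the primitive \<open>- K * (1 + u) powr (1 - 2 * \<beta>)\<close> of an explicit majorant of the density.
\<close>

lemma cauchy_type_primitive_bound: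
  fixes f :: "real \<Rightarrow> real"
  assumes \<beta>: "\<beta> > 1 / 2" and f: "\<And>u. (f has_real_derivative (1 + u\<^sup>2) powr (- \<beta>)) (at u)" and x: "x \<ge> 0"
  shows "f x \<le> f 0 + 2 powr \<beta> / (2 * \<beta> - 1)"
proof -
  define K where "K = 2 powr \<beta> / (2 * \<beta> - 1)"
  have K: "K * (2 * \<beta> - 1) = 2 powr \<beta>" "K > 0" using \<beta> by (auto simp: K_def)
  have "- K * (1 + 0) powr (1 - 2 * \<beta>) - f 0 \<le> - K * (1 + x) powr (1 - 2 * \<beta>) - f x"
  proof (rule DERIV_nonneg_imp_nondecreasing[OF x])
    fix u :: real assume u: "0 \<le> u" "u \<le> x"
    have "((\<lambda>u. - K * (1 + u) powr (1 - 2 * \<beta>) - f u) has_real_derivative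
        - K * ((1 - 2 * \<beta>) * (1 + u) powr (1 - 2 * \<beta> - 1)) - (1 + u\<^sup>2) powr (- \<beta>)) (at u)"
      using u by (auto intro!: derivative_eq_intros f)
    moreover have "(1 + u\<^sup>2) powr (- \<beta>) \<le> 2 powr \<beta> * (1 + u) powr (- 2 * \<beta>)"
    proof -
      have "(1 + u)\<^sup>2 \<le> 2 * (1 + u\<^sup>2)"
        using zero_le_power2[of "1 - u"] by (simp add: power2_eq_square algebra_simps)
      then have "((1 + u)\<^sup>2 / 2) powr (- \<beta>) \<ge> (1 + u\<^sup>2) powr (- \<beta>)"
        using \<beta> u by (intro powr_mono2') auto
      also have "((1 + u)\<^sup>2 / 2) powr (- \<beta>) = 2 powr \<beta> * ((1 + u)\<^sup>2) powr (- \<beta>)"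
        using u by (simp add: powr_divide powr_minus field_simps)
      also have "((1 + u)\<^sup>2) powr (- \<beta>) = (1 + u) powr (- 2 * \<beta>)"
      proof -
        have "(1 + u)\<^sup>2 = (1 + u) powr 2" using u by simp
        then show ?thesis by (simp only: powr_powr) simp
      qed
      finally show ?thesis .
    qed
    moreover have "- K * ((1 - 2 * \<beta>) * (1 + u) powr (1 - 2 * \<beta> - 1)) = 2 powr \<beta> * (1 + u) powr (- 2 * \<beta>)"
      unfolding K(1)[symmetric] by (simp add: algebra_simps)
    ultimately show "\<exists>y. ((\<lambda>u. - K * (1 + u) powr (1 - 2 * \<beta>) - f u) has_real_derivative y) (at u) \<and> 0 \<le> y"
      by (intro exI conjI) auto
  qed
  moreover have "0 \<le> K * (1 + x) powr (1 - 2 * \<beta>)" using K by simp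
  ultimately show ?thesis unfolding K_def[symmetric] by simp
qed

text \<open>
The distribution function of the density \<open>(1 + u\<^sup>2) powr (- \<beta>)\<close>, which has finite total mass \<open>c\<close>. A
value of \<open>\<beta>\<close> only slightly larger than \<open>1 / 2\<close> makes the tails heavy, so that a time shift changes the
density very little compared to the remaining length.
\<close>

lemma exists_cauchy_type_distribution:
  fixes \<beta> :: real assumes \<beta>: "\<beta> > 1 / 2"
  obtains f c where "c > 0" "\<forall>u. (f has_real_derivative (1 + u\<^sup>2) powr (- \<beta>)) (at u)"
    "(f \<longlongrightarrow> 0) at_bot" "(f \<longlongrightarrow> c) at_top"
proof -
  have pos: "1 + u\<^sup>2 > 0" for u :: real by (rule add_pos_nonneg) simp_all
  have "\<exists>g. \<forall>x::real. -\<infinity> < ereal x \<longrightarrow> ereal x < \<infinity> \<longrightarrow> (g has_vector_derivative (1 + x\<^sup>2) powr (- \<beta>)) (at x)"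
  proof (rule einterval_antiderivative)
    fix x :: real
    show "isCont (\<lambda>x. (1 + x\<^sup>2) powr (- \<beta>)) x"
      using pos[of x] by (intro continuous_intros) auto
  qed simp
  then obtain g where g: "\<And>x. (g has_real_derivative (1 + x\<^sup>2) powr (- \<beta>)) (at x)"
    by (auto simp: has_real_derivative_iff_has_vector_derivative)
  have neg: "((\<lambda>x. - g (- x)) has_real_derivative (1 + x\<^sup>2) powr (- \<beta>)) (at x)" for x
    using g[of "- x"] by (auto intro!: derivative_eq_intros DERIV_chain2[OF g])
  have less: "g x < g y" if "x < y" for x y
    using DERIV_pos_imp_increasing[OF that, of g] g pos by (metis powr_gt_zero less_numeral_extra(3))
  have le: "g x \<le> g y" if "x \<le> y" for x y using less[of x y] that by (cases "x = y") auto
  define K where "K = 2 powr \<beta> / (2 * \<beta> - 1)"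
  have K: "K > 0" using \<beta> by (simp add: K_def)
  have above: "g x \<le> g 0 + K" for x
    using cauchy_type_primitive_bound[OF \<beta> g, of x] le[of x 0] K by (cases "x \<ge> 0") (auto simp: K_def)
  have below: "- g (- x) \<le> - g 0 + K" for x
    using cauchy_type_primitive_bound[OF \<beta> neg, of x] le[of 0 "- x"] K by (cases "x \<ge> 0") (auto simp: K_def)
  define m where "m = (SUP x. - g (- x))"
  define c where "c = (SUP x. g x)"
  have top: "(g \<longlongrightarrow> c) at_top"
    unfolding c_def by (rule increasing_bounded_limit_at_top[OF le above])
  have bot0: "((\<lambda>x. - g (- x)) \<longlongrightarrow> m) at_top"
    unfolding m_def by (rule increasing_bounded_limit_at_top[OF _ below]) (use le in simp)
  have bot: "(g \<longlongrightarrow> - m) at_bot"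
    using tendsto_minus[OF bot0] by (simp add: filterlim_at_bot_mirror)
  have "- m \<le> g 0"
    by (rule tendsto_upperbound[OF bot]) (auto intro!: eventually_at_bot_linorderI[of 0] le)
  also have "g 0 < g 1" by (rule less) simp
  also have "g 1 \<le> c"
    by (rule tendsto_lowerbound[OF top]) (auto intro!: eventually_at_top_linorderI[of 1] le)
  finally have "c + m > 0" by simp
  moreover have "((\<lambda>x. g x + m) has_real_derivative (1 + x\<^sup>2) powr (- \<beta>)) (at x)" for x
    using DERIV_add[OF g[of x] DERIV_const[of m]] by simp
  moreover have "((\<lambda>x. g x + m) \<longlongrightarrow> 0) at_bot"
    using tendsto_add[OF bot tendsto_const[of m]] by simp
  moreover have "((\<lambda>x. g x + m) \<longlongrightarrow> c + m) at_top"
    using tendsto_add[OF top tendsto_const[of m]] by simp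
  ultimately show ?thesis using that[of "c + m" "\<lambda>x. g x + m"] by blast
qed

text \<open>
The lattice norm dominates every coordinate, so the term is at most a product of \<open>k\<close> one-dimensional
terms with exponent \<open>r / k > 1\<close>.
\<close>

lemma summable_grid:
  assumes k: "k \<ge> 1" and r: "r > real k"
  shows "(\<lambda>w. (1 + real (gnorm k w)) powr (- r)) summable_on grid k"
proof (rule nonneg_bdd_above_summable_on)
  show "0 \<le> (1 + real (gnorm k w)) powr (- r)" for w by simp
  \<comment> \<open>Each of the \<open>k\<close> coordinates receives the share \<open>r / k\<close> of the exponent.\<close>
  define s where "s = r / real k"
  have s: "s > 1" using k r by (simp add: s_def)
  define b where "b j = (1 + real (nat \<bar>j\<bar>)) powr (- s)" for j :: int
  have "summable (\<lambda>n. real n powr (- s))" using s by (simp add: summable_real_powr_iff)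
  then have sn: "summable (\<lambda>n. real (Suc n) powr (- s))" by (subst summable_Suc_iff)
  define B where "B = 2 * suminf (\<lambda>n. real (Suc n) powr (- s))"
  have bsum: "(\<Sum>j\<in>{-int m..int m}. b j) \<le> B" for m
  proof -
    have "(\<Sum>j\<in>{-int m..int m}. b j) \<le> (\<Sum>j\<in>int ` {..m} \<union> (\<lambda>n. - int n) ` {..m}. b j)"
    proof (rule sum_mono2)
      show "{- int m..int m} \<subseteq> int ` {..m} \<union> (\<lambda>n. - int n) ` {..m}"
      proof
        fix j assume j: "j \<in> {- int m..int m}"
        show "j \<in> int ` {..m} \<union> (\<lambda>n. - int n) ` {..m}"
        proof (cases "j \<ge> 0")
          case True
          then have "j = int (nat j)" "nat j \<in> {..m}" using j by auto
          then show ?thesis by blast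
        next
          case False
          then have "j = - int (nat (- j))" "nat (- j) \<in> {..m}" using j by auto
          then show ?thesis by blast
        qed
      qed
    qed (auto simp: b_def)
    also have "\<dots> \<le> (\<Sum>j\<in>int ` {..m}. b j) + (\<Sum>j\<in>(\<lambda>n. - int n) ` {..m}. b j)"
      by (subst sum_Un) (auto simp: b_def intro!: sum_nonneg)
    also have "\<dots> = 2 * (\<Sum>n\<le>m. real (Suc n) powr (- s))"
      by (simp add: sum.reindex inj_on_def b_def)
    also have "(\<Sum>n\<le>m. real (Suc n) powr (- s)) \<le> suminf (\<lambda>n. real (Suc n) powr (- s))"
      by (intro sum_le_suminf sn) auto
    finally show ?thesis by (simp add: B_def)
  qed
  have B0: "B \<ge> 0" unfolding B_def using sn by (intro mult_nonneg_nonneg suminf_nonneg) auto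
  have summand: "(1 + real (gnorm k w)) powr (- r) \<le> (\<Prod>i<k. b (Polynomial.coeff w i))" for w
  proof -
    have "(\<Prod>i<k. b (Polynomial.coeff w i)) \<ge> (\<Prod>i<k. (1 + real (gnorm k w)) powr (- s))"
    proof (intro prod_mono conjI)
      fix i assume "i \<in> {..<k}"
      then have "nat \<bar>Polynomial.coeff w i\<bar> \<le> gnorm k w"
        unfolding gnorm_def by (intro member_le_sum) auto
      then show "(1 + real (gnorm k w)) powr (- s) \<le> b (Polynomial.coeff w i)"
        unfolding b_def using s by (intro powr_mono2') auto
    qed auto
    also have "(\<Prod>i<k. (1 + real (gnorm k w)) powr (- s)) = ((1 + real (gnorm k w)) powr (- s)) ^ k"
      by simp
    also have "\<dots> = ((1 + real (gnorm k w)) powr (- s)) powr real k"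
      by (intro powr_realpow[symmetric]) simp
    also have "\<dots> = (1 + real (gnorm k w)) powr (- r)"
      using k by (simp add: powr_powr s_def)
    finally show ?thesis .
  qed
  show "bdd_above (sum (\<lambda>w. (1 + real (gnorm k w)) powr (- r)) ` {F. F \<subseteq> grid k \<and> finite F})"
  proof (rule bdd_aboveI2)
    fix F assume "F \<in> {F. F \<subseteq> grid k \<and> finite F}"
    then have F: "F \<subseteq> grid k" "finite F" by auto
    \<comment> \<open>A bound for all coordinates of the finitely many vectors in \<open>F\<close>.\<close>
    define m where "m = (\<Sum>w\<in>F. gnorm k w)"
    define \<Phi> where "\<Phi> w = (\<lambda>i\<in>{..<k}. Polynomial.coeff w i)" for w :: "int poly"
    have inj: "inj_on \<Phi> F"
    proof (rule inj_onI)
      fix u w assume uw: "u \<in> F" "w \<in> F" "\<Phi> u = \<Phi> w"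
      have "Polynomial.coeff u i = Polynomial.coeff w i" for i
      proof (cases "i < k")
        case True
        then show ?thesis using fun_cong[OF uw(3), of i] by (simp add: \<Phi>_def)
      next
        case False
        moreover have "u \<in> grid k" "w \<in> grid k" using F(1) uw(1,2) by auto
        ultimately show ?thesis by (simp add: grid_def)
      qed
      then show "u = w" by (simp add: poly_eq_iff)
    qed
    have image: "\<Phi> ` F \<subseteq> Pi\<^sub>E {..<k} (\<lambda>_. {-int m..int m})"
    proof (rule image_subsetI)
      fix w assume w: "w \<in> F"
      show "\<Phi> w \<in> Pi\<^sub>E {..<k} (\<lambda>_. {-int m..int m})"
      proof (rule PiE_I)
        fix i assume i: "i \<in> {..<k}"
        then have "nat \<bar>Polynomial.coeff w i\<bar> \<le> gnorm k w"
          unfolding gnorm_def by (intro member_le_sum) auto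
        also have "gnorm k w \<le> m" unfolding m_def using w F by (intro member_le_sum) auto
        finally show "\<Phi> w i \<in> {-int m..int m}" using i by (auto simp: \<Phi>_def)
      qed (simp add: \<Phi>_def)
    qed
    have "(\<Sum>w\<in>F. (1 + real (gnorm k w)) powr (- r)) \<le> (\<Sum>w\<in>F. \<Prod>i<k. b (\<Phi> w i))"
      using summand by (intro sum_mono) (simp add: \<Phi>_def)
    also have "\<dots> = (\<Sum>g\<in>\<Phi> ` F. \<Prod>i<k. b (g i))" using inj by (simp add: sum.reindex)
    also have "\<dots> \<le> (\<Sum>g\<in>Pi\<^sub>E {..<k} (\<lambda>_. {-int m..int m}). \<Prod>i<k. b (g i))"
      by (intro sum_mono2 image finite_PiE) (auto intro!: prod_nonneg simp: b_def)
    also have "\<dots> = (\<Prod>i<k. \<Sum>j\<in>{-int m..int m}. b j)"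
      by (rule prod_sum_PiE[symmetric]) auto
    also have "\<dots> \<le> B ^ k"
      using bsum[of m] by (simp add: power_mono sum_nonneg b_def)
    finally show "(\<Sum>w\<in>F. (1 + real (gnorm k w)) powr (- r)) \<le> B ^ k" .
  qed
qed

lemma power_difference_bound:
  fixes x y B :: real
  assumes "0 \<le> x" "x \<le> B" "0 \<le> y" "y \<le> B"
  shows "\<bar>x ^ n - y ^ n\<bar> * B \<le> real n * B ^ n * \<bar>x - y\<bar>"
proof (induction n)
  case (Suc n)
  have "x ^ Suc n - y ^ Suc n = x * (x ^ n - y ^ n) + y ^ n * (x - y)"
    by (simp add: algebra_simps)
  then have "\<bar>x ^ Suc n - y ^ Suc n\<bar> \<le> x * \<bar>x ^ n - y ^ n\<bar> + y ^ n * \<bar>x - y\<bar>"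
    using assms by (metis abs_mult abs_of_nonneg abs_triangle_ineq zero_le_power)
  also have "\<dots> \<le> \<bar>x ^ n - y ^ n\<bar> * B + B ^ n * \<bar>x - y\<bar>"
  proof (rule add_mono)
    show "x * \<bar>x ^ n - y ^ n\<bar> \<le> \<bar>x ^ n - y ^ n\<bar> * B"
      using mult_right_mono[OF assms(2), of "\<bar>x ^ n - y ^ n\<bar>"] by (simp add: mult.commute)
    show "y ^ n * \<bar>x - y\<bar> \<le> B ^ n * \<bar>x - y\<bar>"
      using assms by (intro mult_right_mono power_mono) auto
  qed
  also have "\<dots> \<le> real n * B ^ n * \<bar>x - y\<bar> + B ^ n * \<bar>x - y\<bar>"
    using Suc by simp
  finally have "\<bar>x ^ Suc n - y ^ Suc n\<bar> * B \<le> (real n * B ^ n * \<bar>x - y\<bar> + B ^ n * \<bar>x - y\<bar>) * B"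
    using assms by (intro mult_right_mono) auto
  then show ?case by (simp add: algebra_simps)
qed simp

lemma sqrt_le_of_square_le:
  fixes a b :: real assumes "a\<^sup>2 \<le> b" shows "\<bar>a\<bar> \<le> sqrt b"
  using assms real_le_rsqrt[of "\<bar>a\<bar>" b] by simp

text \<open>
Here \<open>W\<close> and \<open>W'\<close> stand for \<open>1\<close> plus the norms of \<open>w\<close> and \<open>w + v\<close>, and \<open>p\<close> for the time shift on the
interval of \<open>w\<close>. The bounds \<open>g\<close>, \<open>a\<close> and \<open>A\<close> do not depend on \<open>w\<close>; the point of the estimates below is
that their constants only depend on these. The function \<open>Q\<close> is the quotient of the two densities
\<open>h' t powr (- \<beta>)\<close> and \<open>h t powr (- \<beta>)\<close>.
\<close>

locale density_comparison =
  fixes W W' g a A p \<beta> :: real and M :: nat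
  assumes W: "W \<ge> 1" "W' \<ge> 1" and M: "M \<ge> 1" and g: "\<bar>W' - W\<bar> \<le> g"
    and a: "a \<ge> 1" "W' \<le> a * W" "W \<le> a * W'"
    and A: "A \<ge> 0" "\<bar>p\<bar> * W \<le> A * W ^ M"
    and \<beta>: "0 < \<beta>" "\<beta> < 1"
begin

definition "h t = W ^ (2 * M) + t\<^sup>2" for t :: real
definition "h' t = W' ^ (2 * M) + (t + p)\<^sup>2" for t :: real
definition "Q t = h t powr \<beta> * h' t powr (- \<beta>)" for t

definition "D = real (2 * M) * a ^ (2 * M) * g"
definition "E = D + 2 * A + A\<^sup>2"
definition "H = (1 + 2 * A\<^sup>2) * a ^ (2 * M) + 2"

lemma S_pos: "W ^ M > 0" "W ^ M \<ge> 1" using W by (auto intro: one_le_power less_le_trans[OF zero_less_one])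

lemma S_square: "W ^ (2 * M) = (W ^ M)\<^sup>2" by (simp add: power_mult mult.commute[of 2 M])

lemma g0: "g \<ge> 0" using g by linarith

lemma h_pos: "h t > 0" "h' t > 0"
proof -
  have "W ^ (2 * M) > 0" "W' ^ (2 * M) > 0" using W by simp_all
  then show "h t > 0" "h' t > 0" unfolding h_def h'_def by (simp_all add: add_pos_nonneg)
qed

lemma S_le: "(W ^ M)\<^sup>2 \<le> h t" "W ^ M \<le> sqrt (h t)" "\<bar>t\<bar> \<le> sqrt (h t)"
proof -
  show 1: "(W ^ M)\<^sup>2 \<le> h t" by (simp add: h_def S_square)
  show "W ^ M \<le> sqrt (h t)" using sqrt_le_of_square_le[OF 1] S_pos by simp
  show "\<bar>t\<bar> \<le> sqrt (h t)" by (rule sqrt_le_of_square_le) (use W in \<open>simp add: h_def\<close>)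
qed

lemma p_small: "\<bar>p\<bar> \<le> A * W ^ M / W"
  using A W by (simp add: pos_le_divide_eq)

lemma p_le: "\<bar>p\<bar> \<le> A * W ^ M"
proof -
  have "\<bar>p\<bar> * 1 \<le> \<bar>p\<bar> * W" using W by (intro mult_left_mono) auto
  with A show ?thesis by simp
qed

lemma scale_difference: "\<bar>W' ^ (2 * M) - W ^ (2 * M)\<bar> \<le> D * (W ^ M)\<^sup>2 / W"
proof -
  have aW: "a * W \<ge> W" using a W by simp
  have "\<bar>W' ^ (2 * M) - W ^ (2 * M)\<bar> * (a * W) \<le> real (2 * M) * (a * W) ^ (2 * M) * \<bar>W' - W\<bar>"
    using a W aW by (intro power_difference_bound) auto
  also have "\<dots> \<le> real (2 * M) * (a * W) ^ (2 * M) * g"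
    using g a W by (intro mult_left_mono) auto
  also have "\<dots> = D * (W ^ M)\<^sup>2" by (simp add: D_def power_mult_distrib S_square)
  finally have *: "\<bar>W' ^ (2 * M) - W ^ (2 * M)\<bar> * (a * W) \<le> D * (W ^ M)\<^sup>2" .
  have "\<bar>W' ^ (2 * M) - W ^ (2 * M)\<bar> * W \<le> \<bar>W' ^ (2 * M) - W ^ (2 * M)\<bar> * (a * W)"
    using aW by (intro mult_left_mono) auto
  also note *
  finally show ?thesis using W by (simp add: pos_le_divide_eq)
qed

lemma D0: "D \<ge> 0" unfolding D_def using a g0 by simp

lemma E0: "E \<ge> 0" unfolding E_def using D0 A by simp

text \<open>
The change of scale, the mixed term and the squared shift are each smaller than \<open>h t\<close> by a factor of
order \<open>W\<close>. Stating the bound with \<open>sqrt (h t) * W ^ M\<close> instead of the larger \<open>h t\<close> retains the decay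
at large times on which \<open>Q'_bound\<close> depends.
\<close>

lemma h_difference: "\<bar>h' t - h t\<bar> \<le> E * (sqrt (h t) * W ^ M) / W"
proof -
  let ?S = "W ^ M" and ?R = "sqrt (h t)"
  have SR: "?S * ?S \<le> ?R * ?S" using S_le(2)[of t] S_pos by (intro mult_right_mono) auto
  have "\<bar>W' ^ (2 * M) - W ^ (2 * M)\<bar> \<le> D * (?R * ?S) / W"
  proof -
    have "D * ?S\<^sup>2 / W \<le> D * (?R * ?S) / W"
      using SR D0 W by (intro divide_right_mono mult_left_mono) (auto simp: power2_eq_square)
    with scale_difference show ?thesis by linarith
  qed
  moreover have "\<bar>2 * t * p\<bar> \<le> 2 * A * (?R * ?S) / W"
  proof -
    have "\<bar>t\<bar> * \<bar>p\<bar> \<le> ?R * (A * ?S / W)"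
      using S_le(3)[of t] p_small less_imp_le[OF h_pos(1)] by (intro mult_mono) simp_all
    moreover have "2 * A * (?R * ?S) / W = 2 * (?R * (A * ?S / W))" by simp
    moreover have "\<bar>2 * t * p\<bar> = 2 * (\<bar>t\<bar> * \<bar>p\<bar>)" by (simp add: abs_mult)
    ultimately show ?thesis by linarith
  qed
  moreover have "p\<^sup>2 \<le> A\<^sup>2 * (?R * ?S) / W"
  proof -
    have "\<bar>p\<bar> * \<bar>p\<bar> \<le> (A * ?S) * (A * ?S / W)"
      using p_le p_small A S_pos(1) by (intro mult_mono) simp_all
    also have "\<dots> = A\<^sup>2 * (?S * ?S) / W" by (simp add: power2_eq_square)
    also have "\<dots> \<le> A\<^sup>2 * (?R * ?S) / W"
      using SR W by (intro divide_right_mono mult_left_mono) auto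
    finally show ?thesis by (simp add: power2_eq_square)
  qed
  moreover have "h' t - h t = (W' ^ (2 * M) - W ^ (2 * M)) + 2 * t * p + p\<^sup>2"
    by (simp add: h_def h'_def power2_eq_square algebra_simps)
  ultimately have "\<bar>h' t - h t\<bar> \<le> D * (?R * ?S) / W + 2 * A * (?R * ?S) / W + A\<^sup>2 * (?R * ?S) / W"
    by (smt (verit) zero_le_power2)
  also have "\<dots> = E * (?R * ?S) / W" by (simp add: E_def add_divide_distrib distrib_right)
  finally show ?thesis .
qed

lemma h_le: "h t \<le> H * h' t"
proof -
  have "W ^ (2 * M) \<le> (a * W') ^ (2 * M)" using a W by (intro power_mono) auto
  then have T: "W ^ (2 * M) \<le> a ^ (2 * M) * W' ^ (2 * M)" by (simp add: power_mult_distrib)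
  have "\<bar>p\<bar>\<^sup>2 \<le> (A * W ^ M)\<^sup>2" using p_le by (intro power_mono) auto
  then have p2: "p\<^sup>2 \<le> A\<^sup>2 * W ^ (2 * M)" by (simp add: power_mult_distrib S_square)
  have "t\<^sup>2 \<le> 2 * (t + p)\<^sup>2 + 2 * p\<^sup>2"
    using zero_le_power2[of "t + 2 * p"] by (simp add: power2_eq_square algebra_simps)
  then have "h t \<le> (1 + 2 * A\<^sup>2) * W ^ (2 * M) + 2 * (t + p)\<^sup>2"
    using p2 by (simp add: h_def algebra_simps)
  also have "\<dots> \<le> (1 + 2 * A\<^sup>2) * (a ^ (2 * M) * W' ^ (2 * M)) + 2 * (t + p)\<^sup>2"
    using T by (intro add_right_mono mult_left_mono) auto
  also have "\<dots> \<le> H * W' ^ (2 * M) + H * (t + p)\<^sup>2"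
  proof (rule add_mono)
    have "0 \<le> 2 * W' ^ (2 * M)" using W by simp
    then show "(1 + 2 * A\<^sup>2) * (a ^ (2 * M) * W' ^ (2 * M)) \<le> H * W' ^ (2 * M)"
      by (simp add: H_def algebra_simps)
    show "2 * (t + p)\<^sup>2 \<le> H * (t + p)\<^sup>2"
      using a by (intro mult_right_mono) (auto simp: H_def)
  qed
  finally show ?thesis by (simp add: h'_def distrib_left)
qed

lemma H_pos: "H > 0" unfolding H_def using a by (simp add: add_nonneg_pos)

lemma Q_pos: "Q t > 0" using h_pos[of t] by (simp add: Q_def)

lemma Q_le: "Q t \<le> H powr \<beta>"
proof -
  have "h t powr \<beta> \<le> (H * h' t) powr \<beta>" using h_le[of t] h_pos[of t] \<beta> by (intro powr_mono2) auto
  also have "\<dots> = H powr \<beta> * h' t powr \<beta>" using H_pos h_pos(2)[of t] by (simp add: powr_mult)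
  finally have "Q t \<le> (H powr \<beta> * h' t powr \<beta>) * h' t powr (- \<beta>)"
    unfolding Q_def by (intro mult_right_mono) auto
  also have "\<dots> = H powr \<beta>" using h_pos(2)[of t] by (simp add: powr_minus)
  finally show ?thesis .
qed

definition "Q' t = \<beta> * Q t * (2 * (t * (h' t - h t) - p * h t)) / (h t * h' t)" for t

lemma Q_deriv: "(Q has_real_derivative Q' t) (at t)"
proof -
  have h: "(h has_real_derivative 2 * t) (at t)"
    unfolding h_def by (auto intro!: derivative_eq_intros)
  have h': "(h' has_real_derivative 2 * (t + p)) (at t)"
    unfolding h'_def by (auto intro!: derivative_eq_intros)
  have "(Q has_real_derivative
      h t powr \<beta> * (- \<beta> * h' t powr (- \<beta> - 1) * (2 * (t + p))) + (\<beta> * h t powr (\<beta> - 1) * (2 * t)) * h' t powr (- \<beta>)) (at t)"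
    unfolding Q_def
    by (rule DERIV_mult'[OF DERIV_fun_powr[OF h h_pos(1)] DERIV_fun_powr[OF h' h_pos(2)], THEN DERIV_cong]) simp
  also have "h t powr \<beta> * (- \<beta> * h' t powr (- \<beta> - 1) * (2 * (t + p))) + (\<beta> * h t powr (\<beta> - 1) * (2 * t)) * h' t powr (- \<beta>)
     = \<beta> * Q t * (2 * (t / h t) - 2 * ((t + p) / h' t))"
    using h_pos[of t] by (simp add: Q_def powr_diff field_simps)
  also have "\<dots> = Q' t"
    using h_pos[of t] by (simp add: Q'_def field_simps)
  finally show ?thesis .
qed

definition "C = 2 * (E + A) * H * H powr \<beta>"

lemma C0: "C \<ge> 0" unfolding C_def using E0 A H_pos by simp

text \<open>
In the right hand side \<open>h t powr (- \<beta>)\<close> is, up to a constant, the density on the interval of \<open>w\<close>, so the estimate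
bounds the derivative of \<open>Q\<close> with respect to the position in the interval by a multiple of
\<open>W powr (r - 1)\<close>.
\<close>

lemma Q'_bound:
  assumes r: "\<beta> = 1 / 2 + r / real (2 * M)"
  shows "\<bar>Q' t\<bar> \<le> C * W powr (r - 1) * h t powr (- \<beta>)"
proof -
  let ?S = "W ^ M" and ?h = "h t"
  have hh: "?h > 0" "h' t > 0" using h_pos by auto
  have num: "\<bar>t * (h' t - ?h) - p * ?h\<bar> \<le> (E + A) * (?h * ?S) / W"
  proof -
    have "\<bar>t\<bar> * \<bar>h' t - ?h\<bar> \<le> sqrt ?h * (E * (sqrt ?h * ?S) / W)"
      using S_le(3)[of t] h_difference[of t] less_imp_le[OF h_pos(1)] by (intro mult_mono) simp_all
    also have "\<dots> = E * ((sqrt ?h * sqrt ?h) * ?S) / W" by simp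
    also have "sqrt ?h * sqrt ?h = ?h" using hh by simp
    finally have 1: "\<bar>t * (h' t - ?h)\<bar> \<le> E * (?h * ?S) / W" by (simp add: abs_mult)
    have "\<bar>p\<bar> * ?h \<le> (A * ?S / W) * ?h" using p_small hh by (intro mult_right_mono) auto
    then have 2: "\<bar>p * ?h\<bar> \<le> A * (?h * ?S) / W" using hh by (simp add: abs_mult mult_ac)
    have "\<bar>t * (h' t - ?h) - p * ?h\<bar> \<le> E * (?h * ?S) / W + A * (?h * ?S) / W"
      using 1 2 by linarith
    then show ?thesis by (simp add: distrib_right add_divide_distrib)
  qed
  define z where "z = t * (h' t - ?h) - p * ?h"
  note num = num[folded z_def]
  have "\<bar>Q' t\<bar> = \<beta> * Q t * (2 * \<bar>z\<bar>) / (?h * h' t)"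
    unfolding Q'_def z_def[symmetric] using \<beta> Q_pos[of t] hh by (simp add: abs_mult abs_divide)
  also have "\<dots> \<le> 1 * H powr \<beta> * (2 * ((E + A) * (?h * ?S) / W)) / (?h * h' t)"
    using \<beta> Q_pos[of t] Q_le[of t] hh num by (intro divide_right_mono mult_mono) auto
  also have "\<dots> = H powr \<beta> * 2 * (E + A) * ?S / W * (1 / h' t)" using hh by simp
  also have "\<dots> \<le> H powr \<beta> * 2 * (E + A) * ?S / W * (H / ?h)"
  proof (rule mult_left_mono)
    show "1 / h' t \<le> H / ?h" using h_le[of t] hh by (simp add: field_simps)
    show "0 \<le> H powr \<beta> * 2 * (E + A) * ?S / W" using E0 A W by simp
  qed
  also have "\<dots> = C / W * (?S / ?h)" by (simp add: C_def)
  also have "\<dots> \<le> C / W * (?S powr (2 * \<beta> - 1) * ?h powr (- \<beta>))"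
  proof (rule mult_left_mono)
    have "?h powr (\<beta> - 1) \<le> (?S\<^sup>2) powr (\<beta> - 1)"
      by (rule powr_mono2'[OF _ zero_less_power[OF S_pos(1)] S_le(1)]) (use \<beta> in simp)
    also have "?S\<^sup>2 = ?S powr 2" using S_pos by simp
    also have "(?S powr 2) powr (\<beta> - 1) = ?S powr (2 * \<beta> - 2)" by (simp only: powr_powr) (simp add: algebra_simps)
    finally have "?S powr 1 * ?h powr (\<beta> - 1) \<le> ?S powr 1 * ?S powr (2 * \<beta> - 2)"
      by (intro mult_left_mono) auto
    also have "\<dots> = ?S powr (2 * \<beta> - 1)" by (simp only: powr_add[symmetric]) simp
    finally have "(?S * ?h powr (\<beta> - 1)) * ?h powr (- \<beta>) \<le> ?S powr (2 * \<beta> - 1) * ?h powr (- \<beta>)"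
      using S_pos by (intro mult_right_mono) auto
    moreover have "?h powr (\<beta> - 1) * ?h powr (- \<beta>) = 1 / ?h"
    proof -
      have "?h powr (\<beta> - 1) * ?h powr (- \<beta>) = ?h powr (- 1)" by (simp only: powr_add[symmetric]) simp
      also have "\<dots> = 1 / ?h" using hh by (simp add: powr_minus_divide)
      finally show ?thesis .
    qed
    ultimately show "?S / ?h \<le> ?S powr (2 * \<beta> - 1) * ?h powr (- \<beta>)" by (simp add: mult.assoc)
    show "0 \<le> C / W" using C0 W by simp
  qed
  also have "?S powr (2 * \<beta> - 1) = W powr r"
  proof -
    have "?S = W powr real M" using W by (simp add: powr_realpow)
    then have "?S powr (2 * \<beta> - 1) = W powr (real M * (2 * \<beta> - 1))" by (simp only: powr_powr)
    also have "real M * (2 * \<beta> - 1) = r" using M by (simp add: r field_simps)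
    finally show ?thesis .
  qed
  also have "C / W * (W powr r * ?h powr (- \<beta>)) = C * W powr (r - 1) * ?h powr (- \<beta>)"
    using W by (simp add: powr_diff)
  finally show ?thesis .
qed

lemma Q_limit: "(Q \<longlongrightarrow> 1) at_top" "(Q \<longlongrightarrow> 1) at_bot"
proof -
  have pos: "W ^ (2 * M) > 0" "W' ^ (2 * M) > 0" using W by auto
  show "(Q \<longlongrightarrow> 1) at_top"
    unfolding Q_def h_def h'_def using pos \<beta> by real_asymp
  show "(Q \<longlongrightarrow> 1) at_bot"
    unfolding Q_def h_def h'_def using pos \<beta> by real_asymp
qed

end

lemma filterlim_divide_pos:
  fixes s :: real assumes "s > 0"
  shows "filterlim (\<lambda>t. t / s) at_top at_top" "filterlim (\<lambda>t. t / s) at_bot at_bot"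
  using assms by real_asymp+

text \<open>
The interval of \<open>w\<close> has length of order \<open>W powr (- r)\<close>, and \<open>Q'_bound\<close> gives the Lipschitz constant
\<open>W powr (r - 1)\<close> for the derivative on it. With \<open>r * \<alpha> = 1\<close>, the product of the Lipschitz constant with
the \<open>(1 - \<alpha>)\<close>-th power of the length is bounded, which is the uniform Hoelder estimate.
\<close>

theorem poly_group_embeds:
  fixes k d :: nat and \<alpha> :: real
  assumes k: "k \<ge> 1" and \<alpha>: "0 < \<alpha>" "\<alpha> < 1 / real k"
  shows "\<exists>\<psi>. \<psi> \<in> mon (poly_group k d) (Diff_plus 1 \<alpha>)"
proof -
  define r where "r = 1 / \<alpha>"
  have r: "r > real k" using k \<alpha> by (simp add: r_def field_simps)
  moreover have "real k \<ge> 1" using k by simp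
  ultimately have "r > 1" by linarith
  moreover have "r * \<alpha> = 1" using \<alpha> by (simp add: r_def)
  ultimately have r1: "r > 1" "r * \<alpha> = 1" by simp_all
  have \<alpha>1: "\<alpha> < 1" using r1 \<alpha> by (simp add: r_def field_simps)
  \<comment> \<open>The time scale \<open>W ^ M\<close> exceeds \<open>W\<close> times any polynomial of degree \<open>d\<close>, and \<open>r < M\<close> gives \<open>\<beta> < 1\<close>.
    The value of \<open>\<beta>\<close> makes the total mass proportional to \<open>W powr (- r)\<close>.\<close>
  define M where "M = d + 1 + nat \<lceil>r\<rceil>"
  have M: "M \<ge> 1" "d + 1 \<le> M" "r < real M"
  proof -
    have "r \<le> real (nat \<lceil>r\<rceil>)" by (rule real_nat_ceiling_ge)
    then show "r < real M" by (simp add: M_def)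
  qed (simp_all add: M_def)
  define \<beta> where "\<beta> = 1 / 2 + r / real (2 * M)"
  have \<beta>: "1 / 2 < \<beta>" "\<beta> < 1" "real M * (2 * \<beta>) = real M + r"
    using M r1 by (auto simp: \<beta>_def field_simps)
  obtain f c where c: "c > 0" and f: "\<forall>u. (f has_real_derivative (1 + u\<^sup>2) powr (- \<beta>)) (at u)"
    and f_bot: "(f \<longlongrightarrow> 0) at_bot" and f_top: "(f \<longlongrightarrow> c) at_top"
    by (rule exists_cauchy_type_distribution[OF \<beta>(1)])
  define W where "W w = 1 + real (gnorm k w)" for w
  have W1: "W w \<ge> 1" and W0: "W w > 0" for w by (simp_all add: W_def add_pos_nonneg)
  have Wsum: "(\<lambda>w. W w powr (- r)) summable_on grid k"
    unfolding W_def by (rule summable_grid[OF k r])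
  define Z where "Z = infsum (\<lambda>w. W w powr (- r)) (grid k)"
  have Zsum: "((\<lambda>w. W w powr (- r)) has_sum Z) (grid k)"
    unfolding Z_def using Wsum by (rule has_sum_infsum)
  have "W 0 powr (- r) \<le> Z"
    using has_sum_mono2[OF has_sum_finite[of "{0}" "\<lambda>w. W w powr (- r)"] Zsum] by simp
  then have Z: "Z > 0" using W0[of 0] by (smt (verit) powr_gt_zero)
  define \<kappa> where "\<kappa> = 1 / (c * Z)"
  have \<kappa>: "\<kappa> > 0" using c Z by (simp add: \<kappa>_def)
  define F where "F w t = \<kappa> * W w powr (- r) * f (t / W w ^ M)" for w t
  define \<rho> where "\<rho> w t = \<kappa> * (W w ^ (2 * M) + t\<^sup>2) powr (- \<beta>)" for w t
  define len where "len w = \<kappa> * W w powr (- r) * c" for w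
  have T_pos: "W w ^ (2 * M) + t\<^sup>2 > 0" for w t using W0[of w] by (simp add: add_pos_nonneg)
  have scaled: "\<kappa> * W w powr (- r) * ((1 + (t / W w ^ M)\<^sup>2) powr (- \<beta>) * (1 / W w ^ M)) = \<rho> w t" for w t
  proof -
    have WM: "W w ^ M = W w powr real M" using W0[of w] by (simp add: powr_realpow)
    have "W w ^ (2 * M) + t\<^sup>2 = (W w ^ M)\<^sup>2 * (1 + (t / W w ^ M)\<^sup>2)"
      using W0[of w] by (simp add: power_divide field_simps power_mult[symmetric] mult.commute)
    then have "(W w ^ (2 * M) + t\<^sup>2) powr (- \<beta>) = ((W w ^ M)\<^sup>2) powr (- \<beta>) * (1 + (t / W w ^ M)\<^sup>2) powr (- \<beta>)"
      by (simp add: powr_mult)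
    also have "((W w ^ M)\<^sup>2) powr (- \<beta>) = W w powr (- r) * (1 / W w ^ M)"
    proof -
      have "(W w ^ M)\<^sup>2 = W w powr (2 * real M)"
        unfolding WM using W0[of w] by (simp add: powr_powr powr_numeral[symmetric] mult.commute del: powr_numeral)
      then have "((W w ^ M)\<^sup>2) powr (- \<beta>) = W w powr (2 * real M * - \<beta>)" by (simp only: powr_powr)
      also have "2 * real M * - \<beta> = - r + - real M" using \<beta>(3) by simp
      also have "W w powr (- r + - real M) = W w powr (- r) * W w powr (- real M)" by (rule powr_add)
      also have "W w powr (- real M) = 1 / W w ^ M" unfolding WM by (simp add: powr_minus_divide)
      finally show ?thesis .
    qed
    finally show ?thesis by (simp add: \<rho>_def)
  qed
  interpret flow: ordered_interval_flow "grid k" F \<rho> len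
  proof
    fix w :: "int poly" and t :: real
    have lin: "((\<lambda>t. t / W w ^ M) has_real_derivative 1 / W w ^ M) (at t)"
      by (rule DERIV_cdivide) (rule DERIV_ident)
    have "(F w has_real_derivative \<kappa> * W w powr (- r) * ((1 + (t / W w ^ M)\<^sup>2) powr (- \<beta>) * (1 / W w ^ M))) (at t)"
      unfolding F_def by (rule DERIV_cmult, rule DERIV_chain2[OF _ lin]) (use f in blast)
    then show "(F w has_real_derivative \<rho> w t) (at t)" by (simp only: scaled)
    show "\<rho> w t > 0" using \<kappa> T_pos[of w t] by (simp add: \<rho>_def)
    show "len w > 0" using \<kappa> c W0[of w] by (simp add: len_def)
    have WM: "W w ^ M > 0" using W0 by simp
    have "filterlim (\<lambda>t. t / W w ^ M) at_bot at_bot" by (rule filterlim_divide_pos[OF WM])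
    then have "((\<lambda>t. f (t / W w ^ M)) \<longlongrightarrow> 0) at_bot" by (rule filterlim_compose[OF f_bot])
    from tendsto_mult_left[OF this, of "\<kappa> * W w powr (- r)"]
    show "(F w \<longlongrightarrow> 0) at_bot" unfolding F_def by simp
    have "filterlim (\<lambda>t. t / W w ^ M) at_top at_top" by (rule filterlim_divide_pos[OF WM])
    then have "((\<lambda>t. f (t / W w ^ M)) \<longlongrightarrow> c) at_top" by (rule filterlim_compose[OF f_top])
    from tendsto_mult_left[OF this, of "\<kappa> * W w powr (- r)"]
    show "(F w \<longlongrightarrow> len w) at_top" unfolding F_def len_def .
  next
    have "((\<lambda>w. (\<kappa> * c) * W w powr (- r)) has_sum (\<kappa> * c) * Z) (grid k)"
      by (rule has_sum_cmult_right[OF Zsum])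
    moreover have "(\<kappa> * c) * Z = 1" using c Z by (simp add: \<kappa>_def)
    ultimately show "(len has_sum 1) (grid k)" by (simp add: len_def[abs_def] mult_ac)
  qed simp_all

  have tame: "flow.tame \<alpha> v (\<lambda>w. real_of_int (p w))" if v: "v \<in> grid k" and p: "p \<in> polyfun k d" for v p
  proof -
    obtain A where A: "A \<ge> 0" "\<And>w. w \<in> grid k \<Longrightarrow> real_of_int \<bar>p w\<bar> \<le> A * (1 + real (gnorm k w)) ^ d"
      using polyfun_growth[OF polyfun_mono_Suc[OF p]] by blast
    define g where "g = real (gnorm k v)"
    define a where "a = 1 + g"
    have comparison: "density_comparison (W w) (W (w + v)) g a A (real_of_int (p w)) \<beta> M" if w: "w \<in> grid k" for w
    proof
      have up: "W (w + v) \<le> W w + g"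
        using gnorm_add[of k w v] by (simp add: W_def g_def)
      have down: "W w \<le> W (w + v) + g"
        using gnorm_add[of k "w + v" "- v"] by (simp add: W_def g_def)
      show "\<bar>W (w + v) - W w\<bar> \<le> g" using up down by linarith
      have "g * 1 \<le> g * W u" for u using W1[of u] by (intro mult_left_mono) (simp_all add: g_def)
      then have gW: "W u + g \<le> a * W u" for u by (simp add: a_def distrib_right)
      show "W (w + v) \<le> a * W w" using up gW[of w] by simp
      show "W w \<le> a * W (w + v)" using down gW[of "w + v"] by simp
      have "\<bar>real_of_int (p w)\<bar> * W w \<le> A * W w ^ d * W w"
        using A(2)[OF w] W0[of w] by (intro mult_right_mono) (auto simp: W_def)
      also have "\<dots> = A * W w ^ (d + 1)" by simp
      also have "\<dots> \<le> A * W w ^ M"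
        using A(1) M(2) W1[of w] by (intro mult_left_mono power_increasing) auto
      finally show "\<bar>real_of_int (p w)\<bar> * W w \<le> A * W w ^ M" .
      show "1 \<le> a" by (simp add: a_def g_def)
    qed (use W1 M \<beta> A in auto)
    \<comment> \<open>The constant of \<open>Q'_bound\<close>, which is the same for all \<open>w\<close>.\<close>
    define C where "C = 2 * (real (2 * M) * a ^ (2 * M) * g + 2 * A + A\<^sup>2 + A) * ((1 + 2 * A\<^sup>2) * a ^ (2 * M) + 2) *
       ((1 + 2 * A\<^sup>2) * a ^ (2 * M) + 2) powr \<beta>"
    have C0: "C \<ge> 0" using A(1) by (simp add: C_def a_def g_def)
    have ratio: "flow.ratio v (\<lambda>w. real_of_int (p w)) w = density_comparison.Q (W w) (W (w + v)) (real_of_int (p w)) \<beta> M"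
      if w: "w \<in> grid k" for w
    proof
      fix t
      interpret dc: density_comparison "W w" "W (w + v)" g a A "real_of_int (p w)" \<beta> M by (rule comparison[OF w])
      show "flow.ratio v (\<lambda>w. real_of_int (p w)) w t = dc.Q t"
        using \<kappa> by (simp add: flow.ratio_def \<rho>_def dc.Q_def dc.h_def dc.h'_def powr_minus divide_inverse)
    qed
    define B where "B = C / \<kappa> * (\<kappa> * c) powr (1 - \<alpha>)"
    have holder: "\<bar>flow.ratio v (\<lambda>w. real_of_int (p w)) w t - flow.ratio v (\<lambda>w. real_of_int (p w)) w s\<bar> \<le> B * (F w t - F w s) powr \<alpha>"
      if w: "w \<in> grid k" and st: "s \<le> t" for w s t
    proof -
      interpret dc: density_comparison "W w" "W (w + v)" g a A "real_of_int (p w)" \<beta> M by (rule comparison[OF w])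
      have CC: "dc.C = C" unfolding dc.C_def dc.E_def dc.D_def dc.H_def C_def ..
      define K where "K = C * W w powr (r - 1) / \<kappa>"
      have K: "K \<ge> 0" using C0 \<kappa> by (simp add: K_def)
      have bound: "\<bar>dc.Q' u\<bar> \<le> K * \<rho> w u" for u
        using dc.Q'_bound[OF \<beta>_def, of u] \<kappa> by (simp add: CC K_def \<rho>_def dc.h_def)
      have "K * F w s - dc.Q s \<le> K * F w t - dc.Q t"
      proof (rule DERIV_nonneg_imp_nondecreasing[OF st])
        fix u
        have "((\<lambda>u. K * F w u - dc.Q u) has_real_derivative K * \<rho> w u - dc.Q' u) (at u)"
          by (intro DERIV_diff DERIV_cmult flow.F_deriv[OF w] dc.Q_deriv)
        moreover have "0 \<le> K * \<rho> w u - dc.Q' u" using bound[of u] by linarith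
        ultimately show "\<exists>y. ((\<lambda>u. K * F w u - dc.Q u) has_real_derivative y) (at u) \<and> 0 \<le> y" by blast
      qed
      moreover have "K * F w s + dc.Q s \<le> K * F w t + dc.Q t"
      proof (rule DERIV_nonneg_imp_nondecreasing[OF st])
        fix u
        have "((\<lambda>u. K * F w u + dc.Q u) has_real_derivative K * \<rho> w u + dc.Q' u) (at u)"
          by (intro DERIV_add DERIV_cmult flow.F_deriv[OF w] dc.Q_deriv)
        moreover have "0 \<le> K * \<rho> w u + dc.Q' u" using bound[of u] by linarith
        ultimately show "\<exists>y. ((\<lambda>u. K * F w u + dc.Q u) has_real_derivative y) (at u) \<and> 0 \<le> y" by blast
      qed
      ultimately have lip: "\<bar>dc.Q t - dc.Q s\<bar> \<le> K * (F w t - F w s)"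
        by (simp add: abs_le_iff right_diff_distrib)
      let ?\<Delta> = "F w t - F w s"
      have \<Delta>: "0 \<le> ?\<Delta>" "?\<Delta> \<le> len w"
        using flow.F_le[OF w st] flow.F_lt[OF w, of t] flow.F_pos[OF w, of s] by auto
      have "K * ?\<Delta> \<le> B * ?\<Delta> powr \<alpha>"
      proof (cases "?\<Delta> = 0")
        case False
        then have pos: "?\<Delta> > 0" using \<Delta> by simp
        have "?\<Delta> = ?\<Delta> powr (1 - \<alpha>) * ?\<Delta> powr \<alpha>" using pos by (simp flip: powr_add)
        also have "\<dots> \<le> len w powr (1 - \<alpha>) * ?\<Delta> powr \<alpha>"
          using \<Delta> \<alpha>1 by (intro mult_right_mono powr_mono2) auto
        finally have "K * ?\<Delta> \<le> K * (len w powr (1 - \<alpha>) * ?\<Delta> powr \<alpha>)"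
          using K by (rule mult_left_mono)
        also have "len w powr (1 - \<alpha>) = (\<kappa> * c) powr (1 - \<alpha>) * W w powr (- (r - 1))"
        proof -
          have "len w powr (1 - \<alpha>) = ((\<kappa> * c) * W w powr (- r)) powr (1 - \<alpha>)"
            by (simp add: len_def mult_ac)
          also have "\<dots> = (\<kappa> * c) powr (1 - \<alpha>) * (W w powr (- r)) powr (1 - \<alpha>)"
            by (rule powr_mult)
          also have "(W w powr (- r)) powr (1 - \<alpha>) = W w powr (- r * (1 - \<alpha>))" by (rule powr_powr)
          also have "- r * (1 - \<alpha>) = - (r - 1)" using r1(2) by (simp add: algebra_simps)
          finally show ?thesis .
        qed
        also have "K * ((\<kappa> * c) powr (1 - \<alpha>) * W w powr (- (r - 1)) * ?\<Delta> powr \<alpha>)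
           = (W w powr (r - 1) * W w powr (- (r - 1))) * (B * ?\<Delta> powr \<alpha>)"
          by (simp add: K_def B_def)
        also have "W w powr (r - 1) * W w powr (- (r - 1)) = 1"
          using W0[of w] by (simp flip: powr_add)
        finally show ?thesis by simp
      qed simp
      with lip show ?thesis unfolding ratio[OF w] by linarith
    qed
    have "B \<ge> 0" using C0 \<kappa> by (simp add: B_def)
    moreover have "(flow.ratio v (\<lambda>w. real_of_int (p w)) w \<longlongrightarrow> 1) at_top \<and>
        (flow.ratio v (\<lambda>w. real_of_int (p w)) w \<longlongrightarrow> 1) at_bot" if w: "w \<in> grid k" for w
      unfolding ratio[OF w]
      using density_comparison.Q_limit[OF comparison[OF w]] by blast
    ultimately show ?thesis
      unfolding flow.tame_def using v holder by blast
  qed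

  define \<psi> where "\<psi> = (\<lambda>(v, p). restrict (flow.act v (\<lambda>w. real_of_int (p w))) {0..1})"
  have diff: "\<psi> (v, p) \<in> carrier (Diff_plus 1 \<alpha>)" if vp: "v \<in> grid k" "p \<in> polyfun k d" for v p
  proof -
    have "(\<lambda>w. - p (w + - v)) \<in> polyfun k d"
      by (intro polyfun_uminus polyfun_translate vp grid_minus)
    from tame[OF grid_minus[OF vp(1)] this]
    have "flow.tame \<alpha> (- v) (\<lambda>w. - real_of_int (p (w - v)))" by simp
    from flow.act_Diff[OF tame[OF vp] this \<alpha>(1)] show ?thesis by (simp add: \<psi>_def)
  qed
  have mult: "\<psi> ((v, p) \<otimes>\<^bsub>poly_group k d\<^esub> (v', p')) = \<psi> (v, p) \<otimes>\<^bsub>Diff_plus 1 \<alpha>\<^esub> \<psi> (v', p')"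
    if vp: "v \<in> grid k" "p \<in> polyfun k d" "v' \<in> grid k" "p' \<in> polyfun k d" for v p v' p'
  proof -
    have q: "(\<lambda>w. p (w + v') + p' w) \<in> polyfun k d" by (rule poly_group_mult_closed[OF vp])
    have t3: "flow.tame \<alpha> (v + v') (\<lambda>w. real_of_int (p (w + v')) + real_of_int (p' w))"
      using tame[OF grid_add[OF vp(1,3)] q] by simp
    have B: "\<psi> (v, p) \<in> Bij {0..1}" "\<psi> (v', p') \<in> Bij {0..1}"
      using diff vp by (simp_all add: Diff_plus_carrier)
    have "\<psi> (v + v', \<lambda>w. p (w + v') + p' w) x = compose {0..1} (\<psi> (v, p)) (\<psi> (v', p')) x" for x
    proof (cases "x \<in> {0..1}")
      case True
      have "flow.act v' (\<lambda>w. real_of_int (p' w)) x \<in> {0..1}" by (rule flow.act_unit[OF vp(3) True])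
      then show ?thesis
        using flow.act_mult[OF tame[OF vp(1,2)] tame[OF vp(3,4)] t3 \<alpha>(1) True] True
        by (simp add: \<psi>_def compose_def)
    next
      case False
      then show ?thesis by (simp only: \<psi>_def compose_def prod.case restrict_apply if_False)
    qed
    then have "\<psi> (v + v', \<lambda>w. p (w + v') + p' w) = compose {0..1} (\<psi> (v, p)) (\<psi> (v', p'))" by (rule ext)
    then show ?thesis using B by (simp add: Diff_plus_def BijGroup_def)
  qed
  have inj: "(v, p) = (v', p')"
    if vp: "v \<in> grid k" "p \<in> polyfun k d" "v' \<in> grid k" "p' \<in> polyfun k d" and eq: "\<psi> (v, p) = \<psi> (v', p')" for v p v' p'
  proof -
    have same: "w + v = w + v' \<and> p w = p' w" if w: "w \<in> grid k" for w
    proof -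
      let ?x = "flow.start w + F w 0"
      have wv: "w + v \<in> grid k" "w + v' \<in> grid k" using w vp by simp_all
      have x: "?x \<in> {0..1}"
        using flow.start_nonneg[of w] flow.end_le_1[OF w] flow.F_pos[OF w, of 0] flow.F_lt[OF w, of 0] by auto
      let ?y = "flow.start (w + v) + F (w + v) (real_of_int (p w))"
      have "?y = flow.act v (\<lambda>w. real_of_int (p w)) ?x"
        using flow.act_inside[OF vp(1) w, of "\<lambda>w. real_of_int (p w)" 0] by simp
      also have "\<dots> = \<psi> (v, p) ?x" using x by (simp add: \<psi>_def)
      also have "\<dots> = \<psi> (v', p') ?x" by (simp only: eq)
      also have "\<dots> = flow.act v' (\<lambda>w. real_of_int (p' w)) ?x" using x by (simp add: \<psi>_def)
      also have "\<dots> = flow.start (w + v') + F (w + v') (real_of_int (p' w))"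
        using flow.act_inside[OF vp(3) w, of "\<lambda>w. real_of_int (p' w)" 0] by simp
      finally have y: "?y = flow.start (w + v') + F (w + v') (real_of_int (p' w))" .
      have "w + v = w + v'"
      proof (rule flow.intervals_disjoint[OF wv, of ?y])
        show "flow.start (w + v) < ?y" "?y < flow.start (w + v) + len (w + v)"
          using flow.F_pos[OF wv(1)] flow.F_lt[OF wv(1)] by simp_all
        show "flow.start (w + v') < ?y" "?y < flow.start (w + v') + len (w + v')"
          unfolding y using flow.F_pos[OF wv(2)] flow.F_lt[OF wv(2)] by simp_all
      qed
      moreover from y have "F (w + v') (real_of_int (p w)) = F (w + v') (real_of_int (p' w))"
        unfolding \<open>w + v = w + v'\<close> by simp
      then have "p w = p' w"
        using flow.F_less_iff[OF wv(2), of "real_of_int (p w)" "real_of_int (p' w)"]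
          flow.F_less_iff[OF wv(2), of "real_of_int (p' w)" "real_of_int (p w)"] by simp
      ultimately show ?thesis ..
    qed
    have "p w = p' w" for w
      using same[of w] polyfun_outside[OF vp(2), of w] polyfun_outside[OF vp(4), of w] by (cases "w \<in> grid k") auto
    moreover have "v = v'" using same[of 0] by simp
    ultimately show ?thesis by auto
  qed
  have "\<psi> \<in> mon (poly_group k d) (Diff_plus 1 \<alpha>)"
    unfolding mon_def hom_def
  proof (intro CollectI conjI Pi_I ballI inj_onI)
    fix x assume "x \<in> carrier (poly_group k d)"
    then show "\<psi> x \<in> carrier (Diff_plus 1 \<alpha>)" using diff[of "fst x" "snd x"] by (cases x) simp
  next
    fix x y assume "x \<in> carrier (poly_group k d)" "y \<in> carrier (poly_group k d)"
    then show "\<psi> (x \<otimes>\<^bsub>poly_group k d\<^esub> y) = \<psi> x \<otimes>\<^bsub>Diff_plus 1 \<alpha>\<^esub> \<psi> y"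
      using mult[of "fst x" "snd x" "fst y" "snd y"] by (cases x; cases y) (simp del: poly_group_simps(2) add: poly_group_simps(1))
  next
    fix x y assume "x \<in> carrier (poly_group k d)" "y \<in> carrier (poly_group k d)" "\<psi> x = \<psi> y"
    then show "x = y"
      using inj[of "fst x" "snd x" "fst y" "snd y"] by (cases x; cases y) simp
  qed
  then show ?thesis by (rule exI[of _ \<psi>])
qed

section \<open>Invariance under isomorphism and the critical regularity\<close>

lemma upper_central_iso:
  assumes G: "group G" and H: "group H" and h: "h \<in> iso G H"
  shows "upper_central H i = h ` upper_central G i"
proof (induction i)
  case 0
  interpret group_hom G H h
    using G H h by (simp add: group_hom_def group_hom_axioms_def iso_def)
  show ?case by simp
next
  case (Suc i)
  interpret hom: group_hom G H h
    using G H h by (simp add: group_hom_def group_hom_axioms_def iso_def)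
  have onto: "carrier H = h ` carrier G" and inj: "inj_on h (carrier G)"
    using h by (auto simp: iso_def bij_betw_def)
  have sub: "z \<in> carrier G" if "z \<in> upper_central G i" for z
    using group.upper_central_subset[OF G] that by blast
  have commutes: "h x \<otimes>\<^bsub>H\<^esub> h y = h z \<otimes>\<^bsub>H\<^esub> (h y \<otimes>\<^bsub>H\<^esub> h x) \<longleftrightarrow> x \<otimes>\<^bsub>G\<^esub> y = z \<otimes>\<^bsub>G\<^esub> (y \<otimes>\<^bsub>G\<^esub> x)"
    if "x \<in> carrier G" "y \<in> carrier G" "z \<in> carrier G" for x y z
  proof -
    have "h x \<otimes>\<^bsub>H\<^esub> h y = h (x \<otimes>\<^bsub>G\<^esub> y)" "h z \<otimes>\<^bsub>H\<^esub> (h y \<otimes>\<^bsub>H\<^esub> h x) = h (z \<otimes>\<^bsub>G\<^esub> (y \<otimes>\<^bsub>G\<^esub> x))"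
      using that by simp_all
    then show ?thesis using inj_on_eq_iff[OF inj, of "x \<otimes>\<^bsub>G\<^esub> y" "z \<otimes>\<^bsub>G\<^esub> (y \<otimes>\<^bsub>G\<^esub> x)"] that
      by (simp del: hom.hom_mult)
  qed
  have central: "h x \<in> upper_central H (Suc i) \<longleftrightarrow> x \<in> upper_central G (Suc i)" if x: "x \<in> carrier G" for x
  proof -
    have "h x \<in> upper_central H (Suc i) \<longleftrightarrow>
        (\<forall>y\<in>carrier G. \<exists>z\<in>upper_central G i. h x \<otimes>\<^bsub>H\<^esub> h y = h z \<otimes>\<^bsub>H\<^esub> (h y \<otimes>\<^bsub>H\<^esub> h x))"
      unfolding group.upper_central_Suc[OF H] Suc.IH onto using x by auto
    also have "\<dots> \<longleftrightarrow> (\<forall>y\<in>carrier G. \<exists>z\<in>upper_central G i. x \<otimes>\<^bsub>G\<^esub> y = z \<otimes>\<^bsub>G\<^esub> (y \<otimes>\<^bsub>G\<^esub> x))"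
      using commutes[OF x] sub by (intro ball_cong bex_cong refl) blast+
    also have "\<dots> \<longleftrightarrow> x \<in> upper_central G (Suc i)"
      unfolding group.upper_central_Suc[OF G] using x by simp
    finally show ?thesis .
  qed
  show ?case
  proof
    show "upper_central H (Suc i) \<subseteq> h ` upper_central G (Suc i)"
    proof
      fix y assume y: "y \<in> upper_central H (Suc i)"
      then have "y \<in> h ` carrier G" using group.upper_central_subset[OF H, of "Suc i"] onto by blast
      then obtain x where "y = h x" "x \<in> carrier G" ..
      with y show "y \<in> h ` upper_central G (Suc i)" using central[of x] by blast
    qed
    show "h ` upper_central G (Suc i) \<subseteq> upper_central H (Suc i)"
      using central group.upper_central_subset[OF G, of "Suc i"] by blast
  qed
qed

lemma nilpotent_of_degree_iso:
  assumes G: "group G" and H: "group H" and h: "h \<in> iso G H" and nil: "nilpotent_of_degree G n"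
  shows "nilpotent_of_degree H n"
proof -
  have onto: "carrier H = h ` carrier G" and inj: "inj_on h (carrier G)"
    using h by (auto simp: iso_def bij_betw_def)
  have "h ` upper_central G i = h ` carrier G \<longleftrightarrow> upper_central G i = carrier G" for i
    using inj_on_image_eq_iff[OF inj group.upper_central_subset[OF G] order.refl] .
  then show ?thesis
    using nil H unfolding nilpotent_of_degree_def upper_central_iso[OF G H h] onto by simp
qed

lemma commutative_subgroupI:
  assumes "group G" "subgroup A G" "\<And>x y. x \<in> A \<Longrightarrow> y \<in> A \<Longrightarrow> x \<otimes>\<^bsub>G\<^esub> y = y \<otimes>\<^bsub>G\<^esub> x"
  shows "commutative_subgroup A G"
  unfolding commutative_subgroup_def
  using assms(2) group.group_comm_groupI[OF subgroup.subgroup_is_group[OF assms(2,1)]] assms(3) by simp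

lemma commutative_subgroupD:
  assumes "commutative_subgroup A G" "x \<in> A" "y \<in> A" shows "x \<otimes>\<^bsub>G\<^esub> y = y \<otimes>\<^bsub>G\<^esub> x"
proof -
  interpret comm_group "G\<lparr>carrier := A\<rparr>" using assms(1) by (simp add: commutative_subgroup_def)
  show ?thesis using m_comm[of x y] assms by simp
qed

text \<open>
The coordinate functions, evaluated at \<open>0\<close>, recover the coordinates of \<open>v\<close>.
\<close>

lemma commutes_with_polyfuns:
  assumes d: "d \<ge> 2" and v: "v \<in> grid k" and p: "p \<in> polyfun k d"
    and comm: "\<And>q. q \<in> polyfun k d \<Longrightarrow>
      (v, p) \<otimes>\<^bsub>poly_group k d\<^esub> (0, q) = (0, q) \<otimes>\<^bsub>poly_group k d\<^esub> (v, p)"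
  shows "v = 0"
proof -
  have "Polynomial.coeff v i = 0" for i
  proof -
    have "power_fun k i 1 \<in> polyfun k d"
      using polyfun_mono[OF power_fun_polyfun[of k i 1]] d by simp
    from comm[OF this] have "(\<lambda>w. p w + power_fun k i 1 w) = (\<lambda>w. power_fun k i 1 (w + v) + p w)" by simp
    from fun_cong[OF this, of 0] show ?thesis using v by (simp add: power_fun_def)
  qed
  then show ?thesis by (simp add: poly_eq_iff)
qed

lemma embeds_in_Diff_pullback:
  assumes f: "f \<in> iso K K'" and "embeds_in_Diff K' n \<alpha>" shows "embeds_in_Diff K n \<alpha>"
proof -
  obtain \<psi> where \<psi>: "\<psi> \<in> mon K' (Diff_plus n \<alpha>)"
    using assms(2) by (auto simp: embeds_in_Diff_def)
  have bij: "bij_betw f (carrier K) (carrier K')" using f by (simp add: iso_def)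
  have "\<psi> \<circ> f \<in> hom K (Diff_plus n \<alpha>)"
    using f \<psi> by (intro hom_compose[of f K K']) (simp_all add: iso_def mon_def)
  moreover have "inj_on (\<psi> \<circ> f) (carrier K)"
    using bij \<psi> by (intro comp_inj_on) (simp_all add: bij_betw_def mon_def)
  ultimately have "\<psi> \<circ> f \<in> mon K (Diff_plus n \<alpha>)" by (simp add: mon_def)
  then show ?thesis by (auto simp: embeds_in_Diff_def)
qed

lemma embeds_in_Diff_iso:
  assumes G: "group G" and h: "h \<in> iso G H"
  shows "embeds_in_Diff H n \<alpha> \<longleftrightarrow> embeds_in_Diff G n \<alpha>"
  using embeds_in_Diff_pullback[OF h] embeds_in_Diff_pullback[OF group.iso_set_sym[OF G h]] by blast

lemma Crit_poly_group:
  assumes k: "k \<ge> 1" and d: "d \<ge> 2"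
  shows "Crit (poly_group k d) = ereal (1 + 1 / real k)"
  unfolding Crit_def
proof (rule Sup_eqI)
  fix x assume "x \<in> {ereal (real n + \<alpha>) |n \<alpha>. 0 \<le> \<alpha> \<and> \<alpha> < 1 \<and> embeds_in_Diff (poly_group k d) n \<alpha>}"
  then obtain n \<alpha> \<psi> where x: "x = ereal (real n + \<alpha>)" "0 \<le> \<alpha>" "\<alpha> < 1"
    and "\<psi> \<in> mon (poly_group k d) (Diff_plus n \<alpha>)"
    unfolding embeds_in_Diff_def by blast
  then interpret poly_group_action k d n \<alpha> \<psi> using k d by unfold_locales
  show "x \<le> ereal (1 + 1 / real k)" using regularity_le[OF x(2,3)] x(1) by simp
next
  fix y :: ereal
  assume upper: "\<And>x. x \<in> {ereal (real n + \<alpha>) |n \<alpha>. 0 \<le> \<alpha> \<and> \<alpha> < 1 \<and> embeds_in_Diff (poly_group k d) n \<alpha>} \<Longrightarrow> x \<le> y"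
  have bound: "ereal (1 + \<alpha>) \<le> y" if \<alpha>: "0 < \<alpha>" "\<alpha> < 1 / real k" for \<alpha>
  proof (rule upper)
    have "1 / real k \<le> 1" using k by simp
    then have "\<alpha> < 1" using \<alpha> by simp
    moreover have "embeds_in_Diff (poly_group k d) 1 \<alpha>"
      unfolding embeds_in_Diff_def using poly_group_embeds[OF k \<alpha>, of d] by blast
    ultimately show "ereal (1 + \<alpha>) \<in> {ereal (real n + \<alpha>) |n \<alpha>. 0 \<le> \<alpha> \<and> \<alpha> < 1 \<and> embeds_in_Diff (poly_group k d) n \<alpha>}"
      using \<alpha> by (intro CollectI exI[of _ "1::nat"] exI[of _ \<alpha>]) simp
  qed
  show "ereal (1 + 1 / real k) \<le> y"
  proof (rule dense_le)
    fix x assume x: "x < ereal (1 + 1 / real k)"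
    have pos: "0 < 1 / real k" using k by simp
    define b where "b = max x (ereal 1)"
    have "b < ereal (1 + 1 / real k)" using x pos by (simp add: b_def)
    then obtain z where z: "b < ereal z" "ereal z < ereal (1 + 1 / real k)"
      using ereal_dense2 by blast
    have "ereal 1 < ereal z" using z(1) by (simp add: b_def)
    then have "ereal (1 + (z - 1)) \<le> y" using z(2) by (intro bound) auto
    moreover have "x \<le> ereal z" using z(1) by (simp add: b_def less_imp_le)
    ultimately show "x \<le> y" by simp
  qed
qed

text \<open>
The group \<open>G\<close> is the image of \<open>poly_group k d\<close> under one of its embeddings, which makes its
elements functions on the reals. The subgroup \<open>A\<close> is the kernel of the projection to the lattice.
\<close>

theorem theoremC:
  fixes k d :: nat
  assumes "1 \<le> k" and "k < d"
  shows "\<exists>(G :: (real \<Rightarrow> real) monoid) A.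
    nilpotent_of_degree G d \<and>
    maximal_abelian_subgroup A G \<and>
    derived G (carrier G) \<subseteq> A \<and>
    has_torsion_free_rank (G Mod A) k \<and>
    Crit G = ereal (1 + 1 / real k)"
proof -
  have k: "k \<ge> 1" and d: "d \<ge> 2" "d \<ge> 1" using assms by auto
  let ?P = "poly_group k d"
  have P: "group ?P" by (rule group_poly_group)
  have "0 < 1 / (2 * real k)" "1 / (2 * real k) < 1 / real k" using k by (simp_all add: field_simps)
  from poly_group_embeds[OF k this]
  obtain \<psi> where \<psi>: "\<psi> \<in> mon ?P (Diff_plus 1 (1 / (2 * real k)))" by blast
  let ?B = "BijGroup {0..1::real}"
  have B: "group ?B" by (rule group_BijGroup)
  have psiB: "\<psi> \<in> hom ?P ?B" and inj: "inj_on \<psi> (carrier ?P)"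
    using \<psi> by (auto simp: mon_def hom_def Diff_plus_def BijGroup_def)
  define G where "G = ?B\<lparr>carrier := \<psi> ` carrier ?P\<rparr>"
  have "subgroup (\<psi> ` carrier ?P) ?B"
    using group_hom.img_is_subgroup[of ?P ?B \<psi>] P B psiB by (simp add: group_hom_def group_hom_axioms_def)
  then have G: "group G" unfolding G_def by (rule subgroup.subgroup_is_group[OF _ B])
  have iso: "\<psi> \<in> iso ?P G"
    using psiB inj by (auto simp: G_def iso_def hom_def bij_betw_def)
  have onto: "carrier G = \<psi> ` carrier ?P" by (simp add: G_def)
  have mult: "\<psi> (x \<otimes>\<^bsub>?P\<^esub> y) = \<psi> x \<otimes>\<^bsub>G\<^esub> \<psi> y" if "x \<in> carrier ?P" "y \<in> carrier ?P" for x y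
    using iso that by (simp add: iso_def hom_def)
  define shift where "shift = fst \<circ> inv_into (carrier ?P) \<psi>"
  have shift: "shift (\<psi> (v, p)) = v" if "v \<in> grid k" "p \<in> polyfun k d" for v p
    using that inv_into_f_f[OF inj, of "(v, p)"] by (simp add: shift_def)
  have elemE: "\<exists>v p. x = \<psi> (v, p) \<and> v \<in> grid k \<and> p \<in> polyfun k d" if "x \<in> carrier G" for x
    using that unfolding onto poly_group_def by auto
  have Q: "comm_group (grid_group k)" by (rule comm_group_grid_group)
  have chi_hom: "shift \<in> hom G (grid_group k)"
    unfolding hom_def
  proof (intro CollectI conjI Pi_I ballI)
    fix x assume "x \<in> carrier G"
    then obtain v p where "x = \<psi> (v, p)" "v \<in> grid k" "p \<in> polyfun k d" using elemE by blast
    then show "shift x \<in> carrier (grid_group k)" by (simp add: shift grid_group_def)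
  next
    fix x y assume "x \<in> carrier G" "y \<in> carrier G"
    then obtain v p v' p' where vp: "x = \<psi> (v, p)" "v \<in> grid k" "p \<in> polyfun k d"
      "y = \<psi> (v', p')" "v' \<in> grid k" "p' \<in> polyfun k d" using elemE by metis
    then have "x \<otimes>\<^bsub>G\<^esub> y = \<psi> (v + v', \<lambda>w. p (w + v') + p' w)"
      using mult[of "(v, p)" "(v', p')"] by simp
    then show "shift (x \<otimes>\<^bsub>G\<^esub> y) = shift x \<otimes>\<^bsub>grid_group k\<^esub> shift y"
      using vp poly_group_mult_closed[of v k p d v' p'] by (simp add: shift grid_group_def)
  qed
  interpret chi: group_hom G "grid_group k" shift
    using G Q chi_hom by (simp add: group_hom_def group_hom_axioms_def comm_group_def)
  define A where "A = kernel G (grid_group k) shift"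
  have memA: "\<psi> (v, p) \<in> A \<longleftrightarrow> v = 0" if "v \<in> grid k" "p \<in> polyfun k d" for v p
    using that by (simp add: A_def kernel_def shift onto grid_group_def)
  have subA: "subgroup A G" unfolding A_def by (rule chi.subgroup_kernel)
  have AE: "\<exists>p. x = \<psi> (0, p) \<and> p \<in> polyfun k d" if "x \<in> A" for x
    using elemE[of x] that subgroup.subset[OF subA] memA by blast
  have commA: "commutative_subgroup A G"
  proof (rule commutative_subgroupI[OF G subA])
    fix x y assume "x \<in> A" "y \<in> A"
    then obtain p q where "x = \<psi> (0, p)" "p \<in> polyfun k d" "y = \<psi> (0, q)" "q \<in> polyfun k d" using AE by metis
    then show "x \<otimes>\<^bsub>G\<^esub> y = y \<otimes>\<^bsub>G\<^esub> x"
      using mult[of "(0, p)" "(0, q)"] mult[of "(0, q)" "(0, p)"] by (simp add: add.commute)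
  qed
  have "maximal_abelian_subgroup A G"
    unfolding maximal_abelian_subgroup_def
  proof (intro conjI commA allI impI; elim conjE)
    fix C assume C: "commutative_subgroup C G" "A \<subseteq> C"
    have "x \<in> A" if x: "x \<in> C" for x
    proof -
      have "x \<in> carrier G" using C(1) x subgroup.subset unfolding commutative_subgroup_def by blast
      then obtain v p where vp: "x = \<psi> (v, p)" "v \<in> grid k" "p \<in> polyfun k d" using elemE by blast
      have "v = 0"
      proof (rule commutes_with_polyfuns[OF d(1) vp(2,3)])
        fix q assume q: "q \<in> polyfun k d"
        have car: "(v, p) \<in> carrier ?P" "(0, q) \<in> carrier ?P" using vp q by simp_all
        have "\<psi> (0, q) \<in> C" using memA[of 0 q] q C(2) by auto
        from commutative_subgroupD[OF C(1) x this]
        have "\<psi> ((v, p) \<otimes>\<^bsub>?P\<^esub> (0, q)) = \<psi> ((0, q) \<otimes>\<^bsub>?P\<^esub> (v, p))"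
          unfolding mult[OF car] mult[OF car(2,1)] vp(1) .
        then show "(v, p) \<otimes>\<^bsub>?P\<^esub> (0, q) = (0, q) \<otimes>\<^bsub>?P\<^esub> (v, p)"
          using inj_onD[OF inj] group.is_monoid[OF P] car monoid.m_closed by metis
      qed
      then show ?thesis using memA[OF vp(2,3)] vp(1) by simp
    qed
    with C(2) show "C = A" by blast
  qed
  moreover have "derived G (carrier G) \<subseteq> A"
    unfolding derived_def
  proof (rule group.generate_subgroup_incl[OF G _ subA])
    show "derived_set G (carrier G) \<subseteq> A"
    proof
      fix z assume "z \<in> derived_set G (carrier G)"
      then obtain x y where xy: "x \<in> carrier G" "y \<in> carrier G"
        and z: "z = x \<otimes>\<^bsub>G\<^esub> y \<otimes>\<^bsub>G\<^esub> inv\<^bsub>G\<^esub> x \<otimes>\<^bsub>G\<^esub> inv\<^bsub>G\<^esub> y" by blast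
      note r_inv = group.r_inv[OF G] and m_closed = monoid.m_closed[OF group.is_monoid[OF G]]
        and inv_closed = group.inv_closed[OF G]
      have add: "shift (u \<otimes>\<^bsub>G\<^esub> u') = shift u + shift u'" if "u \<in> carrier G" "u' \<in> carrier G" for u u'
        using hom_mult[OF chi_hom that] by (simp add: grid_group_def)
      have inv: "shift u + shift (inv\<^bsub>G\<^esub> u) = 0" if u: "u \<in> carrier G" for u
      proof -
        have "shift u + shift (inv\<^bsub>G\<^esub> u) = shift (u \<otimes>\<^bsub>G\<^esub> inv\<^bsub>G\<^esub> u)"
          using add[OF u inv_closed[OF u]] by (rule sym)
        also have "\<dots> = shift \<one>\<^bsub>G\<^esub>" by (simp only: r_inv[OF u])
        also have "\<dots> = 0" using chi.hom_one by (simp only:) (simp add: grid_group_def)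
        finally show ?thesis .
      qed
      have "shift z = shift x + shift y + shift (inv\<^bsub>G\<^esub> x) + shift (inv\<^bsub>G\<^esub> y)"
        using xy by (simp only: z add m_closed inv_closed)
      also have "\<dots> = (shift x + shift (inv\<^bsub>G\<^esub> x)) + (shift y + shift (inv\<^bsub>G\<^esub> y))"
        by (simp only: ac_simps)
      also have "\<dots> = \<one>\<^bsub>grid_group k\<^esub>"
        using inv[OF xy(1)] inv[OF xy(2)] by (simp add: grid_group_def)
      finally have "shift z = \<one>\<^bsub>grid_group k\<^esub>" .
      then show "z \<in> A" using xy z by (simp add: A_def kernel_def)
    qed
  qed
  moreover have "has_torsion_free_rank (G Mod A) k"
  proof -
    have "shift ` carrier G = carrier (grid_group k)"
    proof
      show "carrier (grid_group k) \<subseteq> shift ` carrier G"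
      proof
        fix v assume "v \<in> carrier (grid_group k)"
        then have v: "v \<in> grid k" by (simp add: grid_group_def)
        then have "\<psi> (v, \<lambda>_. 0) \<in> carrier G" by (simp add: onto)
        moreover have "v = shift (\<psi> (v, \<lambda>_. 0))" using v by (simp add: shift)
        ultimately show "v \<in> shift ` carrier G" by blast
      qed
    qed (use chi.hom_closed in blast)
    from chi.FactGroup_iso_set[OF this]
    obtain \<phi> where \<phi>: "\<phi> \<in> iso (G Mod A) (grid_group k)" unfolding A_def by blast
    have grp: "group (G Mod A)"
      unfolding A_def by (rule normal.factorgroup_is_group[OF chi.normal_kernel])
    have "grid_group k \<cong> G Mod A"
      using group.iso_set_sym[OF grp \<phi>] by (auto simp: is_iso_def)
    then have "comm_group (G Mod A)"
      using comm_group.iso_imp_comm_group[OF Q] group.is_monoid[OF grp] by blast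
    then show ?thesis using \<phi> by (rule comm_group.tensor_rank_of_iso_grid)
  qed
  moreover have "nilpotent_of_degree G d"
    by (rule nilpotent_of_degree_iso[OF P G iso nilpotent_poly_group[OF k d(2)]])
  moreover have "Crit G = ereal (1 + 1 / real k)"
    using Crit_poly_group[OF k d(1)] unfolding Crit_def embeds_in_Diff_iso[OF P iso] .
  ultimately show ?thesis by blast
qed

end
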